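(* Let $X$ be a compact metrizable space containing an open uncountable zero-dimensional subspace $Z$. Then the following conditions are equivalent: (1) $X$ is finite-dimensional; (2) $X$ is homeomorphic to (the underlying space of) a fractal in a Euclidean space; (3) $X$ admits a topological fractal structure $\mathcal F$ consisting of $4$ maps such that for some $\lambda\in(0,1)$ the Kameyama pseudometric $p^{\mathcal F}_\lambda$ is a metric with the doubling property.
   Context: A self-map of a metric space is contracting if its Lipschitz constant is $<1$. A Euclidean space is a finite-dimensional real Hilbert space. A fractal in a complete metric space $M$ is a pair $(L,\mathcal G)$ where $L\subset M$ is a non-empty compact set with the inherited metric, and $\mathcal G$ is a finite family of self-maps of $L$, each of which is the restriction to $L$ of a contracting self-map of $M$, with $L=\bigcup_{g\in\mathcal G}g(L)$; $L$ is its underlying space. A system $\mathcal F$ of continuous self-maps of a topological space $X$ is topologically contracting if for every open cover $\mathcal U$ of $X$ there is $n\in\mathbb N$ such that for any $f_1,\dots,f_n\in\mathcal F$ the set $f_1\circ\dots\circ f_n(X)$ is contained in some $U\in\mathcal U$. A topological fractal structure on a compact Hausdorff space $X$ is a finite topologically contracting system $\mathcal F$ of continuous self-maps of $X$ with $X=\bigcup_{f\in\mathcal F}f(X)$. Put $\mathcal F^{\circ 0}=\{\mathrm{id}_X\}$, $\mathcal F^{\circ n}=\{f_1\circ\dots\circ f_n:f_1,\dots,f_n\in\mathcal F\}$ for $n\ge1$, and $\mathcal F^{\circ\omega}=\bigcup_{n\ge0}\mathcal F^{\circ n}$. For $f\in\mathcal F^{\circ\omega}$ let $o(f)=\sup\{n\ge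 0:f\in\mathcal F^{\circ n}\}\in\{0,1,2,\dots\}\cup\{\omega\}$. For $\lambda\in(0,1)$ the Kameyama pseudometric is $$p^{\mathcal F}_\lambda(x,y)=\inf\sum_{i=1}^n\lambda^{o(f_i)},$$ where the infimum is over all finite sequences $f_1,\dots,f_n\in\mathcal F^{\circ\omega}$ ($n\ge1$) with $x\in f_1(X)$, $y\in f_n(X)$ and $f_i(X)\cap f_{i+1}(X)\ne\emptyset$ for all $i<n$, and $\lambda^{\omega}:=0$. A metric space has the doubling property if for some $N\in\mathbb N$ each subset $S$ of it can be covered by at most $N$ sets of diameter $\le\frac12\mathrm{diam}(S)$. *)

theory Defs
  imports "HOL-Analysis.Analysis"
begin

text \<open>
  A self-map of a space with carrier \<open>S\<close> is an element of \<open>S \<rightarrow>\<^sub>E S\<close>, that is, a HOL function with the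
  value \<open>undefined\<close> outside \<open>S\<close>. So equality of HOL functions is equality of maps on \<open>S\<close>, which matters
  when maps are counted and when one asks whether a map lies in a given iterate of a system.
\<close>

section \<open>Dimension\<close>

text \<open>
  Dimension is the small inductive dimension \<open>dim_le\<close> of the library. All spaces whose dimension is
  considered are separable metrizable, where the three classical dimension functions agree.
\<close>

definition finite_dimensional :: "'a topology \<Rightarrow> bool" where
  "finite_dimensional X \<longleftrightarrow> (\<exists>n. X dim_le n)"

definition zero_dimensional :: "'a topology \<Rightarrow> bool" where
  "zero_dimensional X \<longleftrightarrow> topspace X \<noteq> {} \<and> X dim_le 0"

section \<open>Fractals in metric spaces\<close>

definition contracting_map :: "'a metric \<Rightarrow> ('a \<Rightarrow> 'a) \<Rightarrow> bool" where
  "contracting_map m h \<longleftrightarrow> h \<in> mspace m \<rightarrow>\<^sub>E mspace m \<and>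
     (\<exists>c. 0 \<le> c \<and> c < 1 \<and>
       (\<forall>x\<in>mspace m. \<forall>y\<in>mspace m. mdist m (h x) (h y) \<le> c * mdist m x y))"

definition fractal_in :: "'a metric \<Rightarrow> 'a set \<Rightarrow> ('a \<Rightarrow> 'a) set \<Rightarrow> bool" where
  "fractal_in m L G \<longleftrightarrow>
     mcomplete_of m \<and>
     L \<noteq> {} \<and> compactin (mtopology_of m) L \<and>
     finite G \<and> G \<subseteq> L \<rightarrow>\<^sub>E L \<and>
     (\<forall>g\<in>G. \<exists>h. contracting_map m h \<and> g = restrict h L) \<and>
     L = (\<Union>g\<in>G. g ` L)"

text \<open>
  The \<open>n\<close>-dimensional Euclidean space on the carrier of the library's \<open>Euclidean_space n\<close> (real
  sequences vanishing from index \<open>n\<close> on), so that \<open>n\<close> can be quantified inside a formula. Every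
  finite-dimensional real Hilbert space is linearly isometric to one of these.
\<close>

definition Euclidean_space_metric :: "nat \<Rightarrow> (nat \<Rightarrow> real) metric" where
  "Euclidean_space_metric n =
     metric (topspace (Euclidean_space n), \<lambda>x y. L2_set (\<lambda>i. x i - y i) {..<n})"

lemma Metric_space_Euclidean_space:
  "Metric_space (topspace (Euclidean_space n)) (\<lambda>x y. L2_set (\<lambda>i. x i - y i) {..<n})"
proof
  fix x y z :: "nat \<Rightarrow> real"
  show "0 \<le> L2_set (\<lambda>i. x i - y i) {..<n}"
    by simp
  show "L2_set (\<lambda>i. x i - y i) {..<n} = L2_set (\<lambda>i. y i - x i) {..<n}"
    by (simp add: L2_set_def power2_commute)
  show "L2_set (\<lambda>i. x i - z i) {..<n} \<le> L2_set (\<lambda>i. x i - y i) {..<n} + L2_set (\<lambda>i. y i - z i) {..<n}"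
    using L2_set_triangle_ineq [of "\<lambda>i. x i - y i" "\<lambda>i. y i - z i" "{..<n}"] by simp
  assume "x \<in> topspace (Euclidean_space n)" "y \<in> topspace (Euclidean_space n)"
  then show "L2_set (\<lambda>i. x i - y i) {..<n} = 0 \<longleftrightarrow> x = y"
    by (auto simp: L2_set_eq_0_iff topspace_Euclidean_space fun_eq_iff)
       (metis not_le lessThan_iff)
qed

lemma mspace_Euclidean_space_metric [simp]:
  "mspace (Euclidean_space_metric n) = topspace (Euclidean_space n)"
  by (simp add: Euclidean_space_metric_def Metric_space.mspace_metric Metric_space_Euclidean_space)

lemma mdist_Euclidean_space_metric [simp]:
  "mdist (Euclidean_space_metric n) x y = L2_set (\<lambda>i. x i - y i) {..<n}"
  by (simp add: Euclidean_space_metric_def Metric_space.mdist_metric Metric_space_Euclidean_space)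

section \<open>Topological fractal structures\<close>

primrec iterates :: "'a set \<Rightarrow> ('a \<Rightarrow> 'a) set \<Rightarrow> nat \<Rightarrow> ('a \<Rightarrow> 'a) set" where
  "iterates S F 0 = {\<lambda>x\<in>S. x}"
| "iterates S F (Suc n) = {compose S f g |f g. f \<in> F \<and> g \<in> iterates S F n}"

definition all_iterates :: "'a set \<Rightarrow> ('a \<Rightarrow> 'a) set \<Rightarrow> ('a \<Rightarrow> 'a) set" where
  "all_iterates S F = (\<Union>n. iterates S F n)"

definition topologically_contracting :: "'a topology \<Rightarrow> ('a \<Rightarrow> 'a) set \<Rightarrow> bool" where
  "topologically_contracting X F \<longleftrightarrow>
     (\<forall>\<U>. (\<forall>U\<in>\<U>. openin X U) \<and> \<Union>\<U> = topspace X \<longrightarrow>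
       (\<exists>n. \<forall>f\<in>iterates (topspace X) F n. \<exists>U\<in>\<U>. f ` topspace X \<subseteq> U))"

definition topological_fractal_structure :: "'a topology \<Rightarrow> ('a \<Rightarrow> 'a) set \<Rightarrow> bool" where
  "topological_fractal_structure X F \<longleftrightarrow>
     compact_space X \<and> Hausdorff_space X \<and>
     finite F \<and> F \<subseteq> topspace X \<rightarrow>\<^sub>E topspace X \<and> (\<forall>f\<in>F. continuous_map X X f) \<and>
     topologically_contracting X F \<and>
     topspace X = (\<Union>f\<in>F. f ` topspace X)"

section \<open>The Kameyama pseudometric\<close>

definition iterate_order :: "'a set \<Rightarrow> ('a \<Rightarrow> 'a) set \<Rightarrow> ('a \<Rightarrow> 'a) \<Rightarrow> enat" where
  "iterate_order S F f = Sup {enat n |n. f \<in> iterates S F n}"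

definition enat_power :: "real \<Rightarrow> enat \<Rightarrow> real" where
  "enat_power r k = (case k of enat n \<Rightarrow> r ^ n | \<infinity> \<Rightarrow> 0)"

definition Kameyama_chain :: "'a set \<Rightarrow> ('a \<Rightarrow> 'a) set \<Rightarrow> 'a \<Rightarrow> 'a \<Rightarrow> ('a \<Rightarrow> 'a) list \<Rightarrow> bool" where
  "Kameyama_chain S F x y fs \<longleftrightarrow>
     fs \<noteq> [] \<and> set fs \<subseteq> all_iterates S F \<and>
     x \<in> hd fs ` S \<and> y \<in> last fs ` S \<and>
     (\<forall>i. Suc i < length fs \<longrightarrow> (fs ! i) ` S \<inter> (fs ! Suc i) ` S \<noteq> {})"

text \<open>
  For points of \<open>S\<close> the one-element chain consisting of the identity shows that the infimum is over a
  non-empty set of non-negative numbers. The value 0 off \<open>S\<close> is a convention: the locale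
  \<open>Metric_space\<close> demands non-negativity and symmetry for all points of the type.
\<close>

definition Kameyama_pseudometric :: "'a set \<Rightarrow> ('a \<Rightarrow> 'a) set \<Rightarrow> real \<Rightarrow> 'a \<Rightarrow> 'a \<Rightarrow> real" where
  "Kameyama_pseudometric S F r x y =
     (if x \<in> S \<and> y \<in> S
      then INF fs \<in> {fs. Kameyama_chain S F x y fs}. \<Sum>f\<leftarrow>fs. enat_power r (iterate_order S F f)
      else 0)"

section \<open>The doubling property\<close>

text \<open>The diameter takes values in \<open>[0,\<infinity>]\<close>, with the value 0 for the empty set.\<close>

definition ediam :: "('a \<Rightarrow> 'a \<Rightarrow> real) \<Rightarrow> 'a set \<Rightarrow> ennreal" where
  "ediam d A = (SUP x\<in>A. SUP y\<in>A. ennreal (d x y))"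

definition doubling :: "'a set \<Rightarrow> ('a \<Rightarrow> 'a \<Rightarrow> real) \<Rightarrow> bool" where
  "doubling M d \<longleftrightarrow>
     (\<exists>N::nat. \<forall>S\<subseteq>M. \<exists>\<A>. finite \<A> \<and> card \<A> \<le> N \<and> S \<subseteq> \<Union>\<A> \<and>
        (\<forall>A\<in>\<A>. A \<subseteq> M \<and> ediam d A \<le> ediam d S / 2))"

end

theory Submission
  imports Defs
begin

text \<open>
  Conditions (2) and (3) each give a metric in which the space has zero \<open>k\<close>-dimensional content for
  some \<open>k\<close>. As the distance to a point is 1-Lipschitz, almost every sphere then has zero
  \<open>(k - 1)\<close>-dimensional content, and induction bounds the inductive dimension (Szpilrajn).

  Conversely, embed \<open>X\<close> in \<open>[0,1]\<^sup>N\<close> and choose a clopen \<open>K \<subseteq> Z\<close> with \<open>K\<close> and \<open>Y = X - K\<close> nonempty and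
  all pieces needed below uncountable. Points of \<open>K\<close> are coded by sequences over \<open>{0,1,2}\<close> whose
  set contains the whole Cantor set \<open>{0,1}\<^sup>\<omega>\<close>. Two of the maps prepend a letter \<open>0\<close> or \<open>1\<close> to the code;
  the third one maps the Cantor set onto the remaining pieces: the points of \<open>K\<close> whose code starts
  with \<open>2\<close>, and \<open>Y\<close>, by dyadic expansion of the coordinates. The fourth map is constant. With
  \<open>l\<^sup>N = 1/2\<close>, all words of length \<open>n\<close> contract a suitable Euclidean metric by a constant times \<open>l\<^sup>n\<close>,
  and a set of diameter about \<open>l\<^sup>n\<close> meets boundedly many cells of level \<open>n\<close>. Hence the Kameyama
  metric is doubling, and a high iterate of the system is a Euclidean fractal.
\<close>

section \<open>Dimension and content\<close>

text \<open>The obstacle is that K is an arbitrary uncountable compact zero-dimensional set,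
  possibly with isolated points, and not a Cantor set. Its codes must meet three demands at once:
  every binary sequence is a code, which gives the third map a Cantor set to start from; the tail of
  a code is a code, so that a point is the image of its tail under the map named by its first
  letter; a code that starts with 2 has a binary tail. A retraction onto the codes takes care of all
  other sequences. The maps look at codes only and all points of Y share one code, so each map
  collapses Y, and closeness after n steps is a matter of common prefixes. The ratio l is the N-th
  root of 1/2 because the bits of the N coordinates are interleaved: N more letters give one more
  bit of each coordinate, so a common prefix of length n fixes a point of Y up to a constant times
  \<open>l ^ n\<close>. Conversely, coordinates within \<open>l ^ n\<close> of each other leave
  boundedly many prefixes of length n. These two matching estimates give the doubling
  property.\<close>

definition null_content :: "('a \<Rightarrow> 'a \<Rightarrow> real) \<Rightarrow> nat \<Rightarrow> 'a set \<Rightarrow> bool" where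
  "null_content d k A \<longleftrightarrow>
     (\<forall>e>0. \<exists>I B r. finite (I::nat set) \<and> A \<subseteq> (\<Union>i\<in>I. B i) \<and>
        (\<forall>i\<in>I. 0 < r i \<and> (\<forall>x\<in>B i. \<forall>y\<in>B i. d x y \<le> r i)) \<and> (\<Sum>i\<in>I. r i ^ k) < (e::real))"

text \<open>
  The distance to \<open>a\<close> sends a covering set of diameter \<open>\<le> r\<close> into an interval of length \<open>r\<close>, so
  \<open>t \<mapsto> \<Sum> r\<^sup>k\<close>, summed over the covering sets that meet the sphere of radius \<open>t\<close>, has integral at most \<open>\<Sum> r\<^bsup>k+1\<^esup>\<close>.
  For covers with \<open>\<Sum> r\<^bsup>k+1\<^esup> < 4\<^bsup>-j\<^esup>\<close> the functions, weighted by \<open>2\<^sup>j\<close>, have an almost everywhere finite sum.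
\<close>

lemma (in Metric_space) null_content_sphere:
  assumes "A \<subseteq> M" "a \<in> M" "null_content d (Suc k) A" "0 < R"
  obtains r where "0 < r" "r < R" "null_content d k {x \<in> A. d a x = r}"
proof -
  define P where "P = (\<lambda>e I B r. finite (I::nat set) \<and> A \<subseteq> (\<Union>i\<in>I. B i) \<and>
        (\<forall>i\<in>I. 0 < r i \<and> (\<forall>x\<in>B i. \<forall>y\<in>B i. d x y \<le> r i)) \<and> (\<Sum>i\<in>I. r i ^ Suc k) < (e::real))"
  have "\<forall>e>0. \<exists>I B r. P e I B r" using assms(3) unfolding null_content_def P_def .
  then have "\<exists>I B r. P ((1/4) ^ j) I B r" for j :: nat
    by simp
  then have "\<forall>j::nat. \<exists>p. P ((1/4) ^ j) (fst p) (fst (snd p)) (snd (snd p))" by force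
  then obtain p where p: "\<And>j::nat. P ((1/4) ^ j) (fst (p j)) (fst (snd (p j))) (snd (snd (p j)))"
    by (rule choice [THEN exE]) blast
  define I where "I = (\<lambda>j. fst (p j))"
  define B where "B = (\<lambda>j. fst (snd (p j)))"
  define r where "r = (\<lambda>j. snd (snd (p j)))"
  have I: "\<And>j. finite (I j)" "\<And>j. A \<subseteq> (\<Union>i\<in>I j. B j i)"
     "\<And>j i. i \<in> I j \<Longrightarrow> 0 < r j i" "\<And>j i x y. i \<in> I j \<Longrightarrow> x \<in> B j i \<Longrightarrow> y \<in> B j i \<Longrightarrow> d x y \<le> r j i"
     "\<And>j. (\<Sum>i\<in>I j. r j i ^ Suc k) < (1/4::real) ^ j"
    using p unfolding P_def I_def B_def r_def by blast+
  \<comment> \<open>Left end of an interval of length \<open>r j i\<close> that contains the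
    distances from \<open>a\<close> to all points of \<open>A\<close> in
    \<open>B j i\<close>.\<close>
  define lo where "lo = (\<lambda>j i. Inf (d a ` (B j i \<inter> A)))"
  have lo: "d a x \<in> {lo j i .. lo j i + r j i}" if "i \<in> I j" "x \<in> B j i" "x \<in> A" for i j x
  proof -
    have "lo j i \<le> d a x"
      unfolding lo_def using that by (intro cInf_lower bdd_belowI[where m=0]) auto
    moreover have "d a x - r j i \<le> lo j i"
      unfolding lo_def
    proof (rule cInf_greatest)
      show "d a ` (B j i \<inter> A) \<noteq> {}" using that by auto
    next
      fix t assume "t \<in> d a ` (B j i \<inter> A)"
      then obtain y where y: "y \<in> B j i" "y \<in> A" "t = d a y" by auto
      have "d y x \<le> r j i" using I(4) that y by blast
      moreover have "d a x \<le> d a y + d y x" using assms that y triangle by blast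
      ultimately show "d a x - r j i \<le> t" using y by simp
    qed
    ultimately show ?thesis by simp
  qed
  define g where "g = (\<lambda>j t. \<Sum>i\<in>I j. ennreal (r j i ^ k) * indicator {lo j i .. lo j i + r j i} t)"
  have g_meas: "g j \<in> borel_measurable lborel" for j
    unfolding g_def by measurable
  have "(\<integral>\<^sup>+t. (\<Sum>j. 2 ^ j * g j t) \<partial>lborel) = (\<Sum>j. \<integral>\<^sup>+t. 2 ^ j * g j t \<partial>lborel)"
    using g_meas by (intro nn_integral_suminf) auto
  also have "\<dots> = (\<Sum>j. 2 ^ j * (\<integral>\<^sup>+t. g j t \<partial>lborel))"
    using g_meas by (simp add: nn_integral_cmult)
  also have "\<dots> = (\<Sum>j. 2 ^ j * (\<Sum>i\<in>I j. ennreal (r j i ^ k) * ennreal (r j i)))"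
  proof -
    have "(\<integral>\<^sup>+t. g j t \<partial>lborel) = (\<Sum>i\<in>I j. ennreal (r j i ^ k) * ennreal (r j i))" for j
      unfolding g_def using I(3) by (simp add: nn_integral_sum nn_integral_cmult less_imp_le cong: sum.cong)
    then show ?thesis by simp
  qed
  also have "\<dots> \<le> (\<Sum>j. ennreal ((1/2) ^ j))"
  proof (intro suminf_le)
    fix j
    have "(\<Sum>i\<in>I j. ennreal (r j i ^ k) * ennreal (r j i)) = (\<Sum>i\<in>I j. ennreal (r j i ^ Suc k))"
      using I(3) by (intro sum.cong) (auto simp: ennreal_mult'[symmetric] less_imp_le mult.commute)
    also have "\<dots> = ennreal (\<Sum>i\<in>I j. r j i ^ Suc k)"
      using I(3) by (intro sum_ennreal) (metis less_imp_le zero_less_power)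
    also have "\<dots> \<le> ennreal ((1/4) ^ j)"
      using I(5)[of j] by (intro ennreal_leI) auto
    finally have "2 ^ j * (\<Sum>i\<in>I j. ennreal (r j i ^ k) * ennreal (r j i)) \<le> 2 ^ j * ennreal ((1/4) ^ j)"
      by (rule mult_left_mono) simp
    also have "\<dots> = ennreal (2 ^ j * (1/4) ^ j)"
      by (simp add: ennreal_mult flip: ennreal_power ennreal_numeral)
    also have "(2 ^ j * (1/4) ^ j) = (1/2::real) ^ j"
      by (simp flip: power_mult_distrib)
    finally show "2 ^ j * (\<Sum>i\<in>I j. ennreal (r j i ^ k) * ennreal (r j i)) \<le> ennreal ((1/2) ^ j)" .
  qed auto
  also have "\<dots> = ennreal (\<Sum>j. (1/2) ^ j)"
    by (intro suminf_ennreal2) (auto simp: summable_geometric)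
  finally have fin: "(\<integral>\<^sup>+t. (\<Sum>j. 2 ^ j * g j t) \<partial>lborel) \<noteq> \<infinity>"
    by (auto simp: top_unique)
  have "AE t in lborel. (\<Sum>j. 2 ^ j * g j t) \<noteq> \<infinity>"
    using g_meas fin by (intro nn_integral_PInf_AE) auto
  then obtain N where N: "{t \<in> space lborel. \<not> (\<Sum>j. 2 ^ j * g j t) \<noteq> \<infinity>} \<subseteq> N" "emeasure lborel N = 0" "N \<in> sets lborel"
    by (auto elim: AE_E)
  have "\<not> {0<..<R} \<subseteq> N"
  proof
    assume "{0<..<R} \<subseteq> N"
    then have "emeasure lborel {0<..<R} \<le> 0" using N by (metis emeasure_mono)
    then show False using assms(4) by simp
  qed
  then obtain t where t': "t \<in> {0<..<R}" "t \<notin> N" by blast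
  then have t: "0 < t" "t < R" "(\<Sum>j. 2 ^ j * g j t) \<noteq> \<infinity>" using N(1) by auto
  show ?thesis
  proof (rule that[OF t(1,2)])
    show "null_content d k {x \<in> A. d a x = t}"
      unfolding null_content_def
    proof (intro allI impI)
      fix e :: real assume "0 < e"
      obtain c where c: "(\<Sum>j. 2 ^ j * g j t) = ennreal c" "0 \<le> c"
        using t(3) by (cases "(\<Sum>j. 2 ^ j * g j t)") auto
      \<comment> \<open>The weight turns the finite value \<open>c\<close> of the series into
        \<open>g j t \<le> c / 2 ^ j < e\<close>, and \<open>g j t\<close> bounds the contribution
        of those sets of cover \<open>j\<close> that can meet the sphere.\<close>
      obtain j where j: "c / e < 2 ^ j"
        using real_arch_pow[of 2 "c/e"] by auto
      have "2 ^ j * g j t = (\<Sum>i\<in>{j}. 2 ^ i * g i t)" by simp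
      also have "\<dots> \<le> ennreal c"
        unfolding c(1)[symmetric] by (rule sum_le_suminf) auto
      finally have 1: "2 ^ j * g j t \<le> ennreal c" .
      define J where "J = {i \<in> I j. t \<in> {lo j i .. lo j i + r j i}}"
      have gJ: "g j t = ennreal (\<Sum>i\<in>J. r j i ^ k)"
      proof -
        have "g j t = (\<Sum>i\<in>J. ennreal (r j i ^ k))"
          unfolding g_def J_def using I(1) by (intro sum.mono_neutral_cong_right) (auto simp: indicator_def)
        also have "\<dots> = ennreal (\<Sum>i\<in>J. r j i ^ k)"
          using I(3) by (intro sum_ennreal) (auto simp: J_def less_imp_le)
        finally show ?thesis .
      qed
      have nn: "0 \<le> (\<Sum>i\<in>J. r j i ^ k)" using I(3) by (intro sum_nonneg) (auto simp: J_def less_imp_le)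
      have "ennreal (2 ^ j * (\<Sum>i\<in>J. r j i ^ k)) \<le> ennreal c"
        using 1 nn unfolding gJ by (simp add: ennreal_mult flip: ennreal_power ennreal_numeral)
      then have "2 ^ j * (\<Sum>i\<in>J. r j i ^ k) \<le> c" using c(2) by (simp add: ennreal_le_iff)
      also have "c < 2 ^ j * e" using j \<open>0 < e\<close> by (simp add: field_simps)
      finally have "(\<Sum>i\<in>J. r j i ^ k) < e" by simp
      moreover have "{x \<in> A. d a x = t} \<subseteq> (\<Union>i\<in>J. B j i)"
        using I(2)[of j] lo by (auto simp: J_def) (metis UN_E atLeastAtMost_iff subsetD)
      ultimately show "\<exists>I B r. finite (I::nat set) \<and> {x \<in> A. d a x = t} \<subseteq> (\<Union>i\<in>I. B i) \<and>
        (\<forall>i\<in>I. 0 < r i \<and> (\<forall>x\<in>B i. \<forall>y\<in>B i. d x y \<le> r i)) \<and> (\<Sum>i\<in>I. r i ^ k) < e"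
        using I by (intro exI[of _ J] exI[of _ "B j"] exI[of _ "r j"]) (auto simp: J_def)
    qed
  qed
qed

text \<open>The relative frontier of a ball around \<open>a\<close> lies in a sphere around
  \<open>a\<close>. Below any given bound there is a radius for which the sphere has zero content in
  one dimension less, so such balls form a base as the inductive dimension requires it.\<close>

lemma (in Metric_space) null_content_imp_dim_le:
  assumes "A \<subseteq> M" "null_content d k A"
  shows "subtopology mtopology A dim_le (int k - 1)"
  using assms
proof (induction k arbitrary: A)
  case 0
  obtain I B r where I: "finite (I::nat set)" "A \<subseteq> (\<Union>i\<in>I. B i)" "(\<Sum>i\<in>I. r i ^ 0) < (1::real)"
    using 0(2) unfolding null_content_def by (metis zero_less_one)
  \<comment> \<open>Each term \<open>r i ^ 0\<close> is 1, so a sum below 1 has no terms. Zero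
    0-dimensional content thus means empty, that is dimension -1.\<close>
  then have "I = {}" by (simp add: card_gt_0_iff)
  then have "A = {}" using I by auto
  then show ?case by (simp add: dimension_le_eq_empty)
next
  case (Suc k)
  show ?case
  proof (rule dimension_le.intros)
    show "-1 \<le> int (Suc k) - 1" by simp
  next
    fix V a assume V: "openin (subtopology mtopology A) V" "a \<in> V"
    then obtain W where W: "openin mtopology W" "V = W \<inter> A" by (auto simp: openin_subtopology)
    have aM: "a \<in> A" "a \<in> M" using V W Suc.prems by auto
    obtain R where R: "0 < R" "mball a R \<subseteq> W" using W V by (auto simp: openin_mtopology)
    obtain r where r: "0 < r" "r < R" "null_content d k {x \<in> A. d a x = r}"
      using null_content_sphere[OF Suc.prems(1) aM(2) Suc.prems(2) R(1)] by blast
    let ?U = "A \<inter> mball a r"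
    have "subtopology mtopology A frontier_of ?U \<subseteq> {x \<in> A. d a x = r}"
    proof -
      have "subtopology mtopology A closure_of ?U \<subseteq> A \<inter> mcball a r"
        using Suc.prems(1) mball_subset_mcball
        by (intro closure_of_minimal) (auto simp: closedin_subtopology)
      moreover have "subtopology mtopology A interior_of ?U = ?U"
        by (intro interior_of_openin) (auto simp: openin_subtopology)
      ultimately show ?thesis using aM by (auto simp: frontier_of_def)
    qed
    moreover have "subtopology mtopology {x \<in> A. d a x = r} dim_le (int k - 1)"
      using Suc.prems r by (intro Suc.IH) auto
    ultimately have "subtopology mtopology (subtopology mtopology A frontier_of ?U) dim_le (int k - 1)"
      using dimension_le_subtopologies by blast
    moreover have "A \<inter> (subtopology mtopology A frontier_of ?U) = subtopology mtopology A frontier_of ?U"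
      using frontier_of_subset_topspace[of "subtopology mtopology A"] Suc.prems(1) by fastforce
    ultimately show "\<exists>U. a \<in> U \<and> U \<subseteq> V \<and> openin (subtopology mtopology A) U \<and>
       subtopology (subtopology mtopology A) (subtopology mtopology A frontier_of U) dim_le (int (Suc k) - 1 - 1)"
      using aM r R W mball_subset_concentric[of r R a]
      by (intro exI[of _ ?U]) (auto simp: openin_subtopology subtopology_subtopology)
  qed
qed

text \<open>Covers by sets of one common size suffice; both repeated halving and cubical grids
  produce such covers.\<close>

lemma null_contentI:
  assumes "\<And>e. e > 0 \<Longrightarrow> \<exists>\<A> r. finite \<A> \<and> A \<subseteq> \<Union>\<A> \<and> 0 < r \<and>
     (\<forall>B\<in>\<A>. \<forall>x\<in>B. \<forall>y\<in>B. d x y \<le> r) \<and> real (card \<A>) * r ^ k < e"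
  shows "null_content d k A"
  unfolding null_content_def
proof (intro allI impI)
  fix e :: real assume "0 < e"
  from assms[OF this] obtain \<A> r where A: "finite \<A>" "A \<subseteq> \<Union>\<A>" "0 < r"
    "\<forall>B\<in>\<A>. \<forall>x\<in>B. \<forall>y\<in>B. d x y \<le> r" "real (card \<A>) * r ^ k < e" by (elim exE conjE)
  obtain h where h: "bij_betw h {0..<card \<A>} \<A>" using ex_bij_betw_nat_finite[OF A(1)] by blast
  then have h': "\<A> = h ` {0..<card \<A>}" by (auto simp: bij_betw_def)
  show "\<exists>I B r. finite (I::nat set) \<and> A \<subseteq> (\<Union>i\<in>I. B i) \<and>
        (\<forall>i\<in>I. 0 < r i \<and> (\<forall>x\<in>B i. \<forall>y\<in>B i. d x y \<le> r i)) \<and> (\<Sum>i\<in>I. r i ^ k) < e"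
  proof (intro exI conjI)
    show "finite {0..<card \<A>}" by simp
    show "A \<subseteq> (\<Union>i\<in>{0..<card \<A>}. h i)" using A(2) h' by simp
    show "\<forall>i\<in>{0..<card \<A>}. 0 < r \<and> (\<forall>x\<in>h i. \<forall>y\<in>h i. d x y \<le> r)"
      using A(3,4) h' by blast
    show "(\<Sum>i\<in>{0..<card \<A>}. r ^ k) < e" using A(5) by simp
  qed
qed

section \<open>Doubling metric spaces have finite dimension\<close>

lemma ediam_leD: "ediam d A \<le> ennreal c \<Longrightarrow> 0 \<le> c \<Longrightarrow> x \<in> A \<Longrightarrow> y \<in> A \<Longrightarrow> d x y \<le> c"
proof -
  assume *: "ediam d A \<le> ennreal c" "0 \<le> c" "x \<in> A" "y \<in> A"
  have "ennreal (d x y) \<le> ediam d A" unfolding ediam_def using * by (auto intro: SUP_upper2)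
  then show "d x y \<le> c" using * by (metis ennreal_le_iff order_trans)
qed

lemma ediam_leI: "(\<And>x y. x \<in> A \<Longrightarrow> y \<in> A \<Longrightarrow> d x y \<le> c) \<Longrightarrow> ediam d A \<le> ennreal c"
  unfolding ediam_def by (intro SUP_least ennreal_leI)

lemma doubling_iterate:
  assumes N: "\<And>S. S \<subseteq> M \<Longrightarrow> \<exists>\<A>. finite \<A> \<and> card \<A> \<le> N \<and> S \<subseteq> \<Union>\<A> \<and> (\<forall>A\<in>\<A>. A \<subseteq> M \<and> ediam d A \<le> ediam d S / 2)"
    and bd: "\<And>x y. x \<in> M \<Longrightarrow> y \<in> M \<Longrightarrow> d x y \<le> 1"
  shows "\<exists>\<A>. finite \<A> \<and> card \<A> \<le> N ^ m \<and> M \<subseteq> \<Union>\<A> \<and> (\<forall>A\<in>\<A>. A \<subseteq> M \<and> ediam d A \<le> ennreal ((1/2) ^ m))"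
proof (induction m)
  case 0
  have "ediam d M \<le> ennreal ((1/2) ^ 0)" using bd by (intro ediam_leI) simp
  then show ?case by (intro exI[of _ "{M}"]) simp
next
  case (Suc m)
  then obtain \<A> where A: "finite \<A>" "card \<A> \<le> N ^ m" "M \<subseteq> \<Union>\<A>"
    and A': "\<forall>A\<in>\<A>. A \<subseteq> M \<and> ediam d A \<le> ennreal ((1/2) ^ m)" by (elim exE conjE)
  define Q where "Q = (\<lambda>S \<B>. finite \<B> \<and> card \<B> \<le> N \<and> S \<subseteq> \<Union>\<B> \<and> (\<forall>A\<in>\<B>. A \<subseteq> M \<and> ediam d A \<le> ediam d S / 2))"
  have "\<forall>S\<in>\<A>. \<exists>\<B>. Q S \<B>"
  proof
    fix S assume "S \<in> \<A>"
    then have "S \<subseteq> M" using A' by blast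
    then show "\<exists>\<B>. Q S \<B>" unfolding Q_def by (rule N)
  qed
  then obtain B where B: "\<forall>S\<in>\<A>. Q S (B S)" by (rule bchoice [THEN exE])
  have B1: "finite (B S)" "card (B S) \<le> N" "S \<subseteq> \<Union>(B S)" if "S \<in> \<A>" for S
    using bspec[OF B that] unfolding Q_def by blast+
  have B2: "T \<subseteq> M" "ediam d T \<le> ediam d S / 2" if "S \<in> \<A>" "T \<in> B S" for S T
    using bspec[OF B that(1)] that(2) unfolding Q_def by blast+
  have half: "ennreal ((1/2) ^ m) / 2 = ennreal ((1/2) ^ Suc m)"
  proof -
    have "ennreal ((1/2) ^ Suc m) = ennreal ((1/2) ^ m / 2)" by simp
    also have "\<dots> = ennreal ((1/2) ^ m) / ennreal 2" by (rule divide_ennreal[symmetric]) auto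
    finally show ?thesis by simp
  qed
  show ?case
  proof (intro exI conjI ballI)
    show "finite (\<Union>S\<in>\<A>. B S)" using A(1) B1(1) by simp
    have "card (\<Union>S\<in>\<A>. B S) \<le> (\<Sum>S\<in>\<A>. card (B S))" using A(1) by (rule card_UN_le)
    also have "\<dots> \<le> (\<Sum>S\<in>\<A>. N)" using B1(2) by (intro sum_mono)
    also have "\<dots> \<le> N ^ Suc m" using A(2) by simp
    finally show "card (\<Union>S\<in>\<A>. B S) \<le> N ^ Suc m" .
    show "M \<subseteq> \<Union> (\<Union>S\<in>\<A>. B S)"
    proof
      fix x assume "x \<in> M"
      then obtain S where S: "S \<in> \<A>" "x \<in> S" using A(3) by auto
      then have "x \<in> \<Union> (B S)" using B1(3)[OF S(1)] by (rule_tac subsetD)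
      then show "x \<in> \<Union> (\<Union>S\<in>\<A>. B S)" using S(1) by auto
    qed
    fix A' assume "A' \<in> (\<Union>S\<in>\<A>. B S)"
    then obtain S where S: "S \<in> \<A>" "A' \<in> B S" by (rule UN_E)
    then show "A' \<subseteq> M" by (rule B2)
    have "ediam d A' \<le> ediam d S / 2" using S by (rule B2)
    also have "\<dots> \<le> ennreal ((1/2) ^ m) / 2" using A' S(1) by (intro divide_right_mono_ennreal) simp
    finally show "ediam d A' \<le> ennreal ((1/2) ^ Suc m)" unfolding half .
  qed
qed

text \<open>The doubling constant \<open>N\<close> itself serves as exponent: \<open>N ^ m\<close>
  sets of diameter \<open>1 / 2 ^ m\<close> contribute \<open>(N / 2 ^ N) ^ m\<close>, which tends
  to 0 because \<open>N < 2 ^ N\<close>.\<close>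

lemma doubling_imp_dim_le:
  assumes "Metric_space M d" "doubling M d" "\<And>x y. x \<in> M \<Longrightarrow> y \<in> M \<Longrightarrow> d x y \<le> 1"
  shows "\<exists>n. Metric_space.mtopology M d dim_le n"
proof -
  interpret Metric_space M d by fact
  obtain N where N: "\<And>S. S \<subseteq> M \<Longrightarrow> \<exists>\<A>. finite \<A> \<and> card \<A> \<le> N \<and> S \<subseteq> \<Union>\<A> \<and> (\<forall>A\<in>\<A>. A \<subseteq> M \<and> ediam d A \<le> ediam d S / 2)"
    using assms(2) unfolding doubling_def by blast
  have "null_content d N M"
  proof (rule null_contentI)
    fix e :: real assume "0 < e"
    have "real N / 2 ^ N < 1" using of_nat_less_two_power[of N, where 'a=real] by simp
    then obtain m where m: "(real N / 2 ^ N) ^ m < e" using real_arch_pow_inv \<open>0 < e\<close> by blast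
    have "\<exists>\<A>. finite \<A> \<and> card \<A> \<le> N ^ m \<and> M \<subseteq> \<Union>\<A> \<and> (\<forall>A\<in>\<A>. A \<subseteq> M \<and> ediam d A \<le> ennreal ((1/2) ^ m))"
    proof (rule doubling_iterate)
      show "\<exists>\<A>. finite \<A> \<and> card \<A> \<le> N \<and> S \<subseteq> \<Union>\<A> \<and> (\<forall>A\<in>\<A>. A \<subseteq> M \<and> ediam d A \<le> ediam d S / 2)"
        if "S \<subseteq> M" for S
        by (rule N[OF that])
    qed (rule assms(3))
    then obtain \<A> where A: "finite \<A>" "card \<A> \<le> N ^ m" "M \<subseteq> \<Union>\<A>"
     "\<forall>A\<in>\<A>. A \<subseteq> M \<and> ediam d A \<le> ennreal ((1/2) ^ m)" by (elim exE conjE)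
    have eq: "((1/2) ^ m) ^ N = ((1/2::real) ^ N) ^ m" by (simp only: power_mult[symmetric] mult.commute)
    have "real (card \<A>) * ((1/2) ^ m) ^ N \<le> real (N ^ m) * ((1/2) ^ m) ^ N"
      by (rule mult_right_mono[OF of_nat_mono[OF A(2)]]) simp
    also have "\<dots> = (real N * (1/2) ^ N) ^ m"
      unfolding eq of_nat_power power_mult_distrib ..
    also have "\<dots> < e"
    proof -
      have "real N * (1/2) ^ N = real N / 2 ^ N" by (simp add: power_one_over)
      then show ?thesis using m by simp
    qed
    finally show "\<exists>\<A> r. finite \<A> \<and> M \<subseteq> \<Union>\<A> \<and> 0 < r \<and>
     (\<forall>B\<in>\<A>. \<forall>x\<in>B. \<forall>y\<in>B. d x y \<le> r) \<and> real (card \<A>) * r ^ N < e"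
    proof (intro exI conjI)
      show "\<forall>B\<in>\<A>. \<forall>x\<in>B. \<forall>y\<in>B. d x y \<le> (1/2) ^ m"
        by (intro ballI, rule ediam_leD) (use A(4) in auto)
    qed (use A m in simp_all)
  qed
  then show ?thesis using null_content_imp_dim_le[of M N] by auto
qed

section \<open>Bounded subsets of Euclidean space\<close>

lemma finite_dimensional_bounded_Euclidean:
  assumes bd: "\<And>x i. x \<in> L \<Longrightarrow> \<bar>x i\<bar> \<le> real B" and L: "L \<subseteq> topspace (Euclidean_space n)"
  shows "finite_dimensional (subtopology (mtopology_of (Euclidean_space_metric n)) L)"
proof -
  define d where "d = (\<lambda>x y. L2_set (\<lambda>i. x i - y i :: real) {..<n})"
  interpret Metric_space "topspace (Euclidean_space n)" d
    unfolding d_def by (rule Metric_space_Euclidean_space)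
  have "null_content d (Suc n) L"
  proof (rule null_contentI)
    fix e :: real assume "0 < e"
    \<comment> \<open>At most \<open>((2 * B + 1) * m) ^ n\<close> grid cells of side
      \<open>1 / m\<close> meet the cube of radius \<open>B\<close>, and each has diameter at most
      \<open>(n + 1) / m\<close>. In exponent \<open>n + 1\<close> this leaves \<open>C / m\<close>,
      with \<open>C\<close> collecting the factors free of \<open>m\<close>.\<close>
    define C where "C = (2 * real B + 1) ^ n * (real n + 1) ^ Suc n"
    obtain m' :: nat where m': "C / e < real m'" using reals_Archimedean2 by blast
    define m where "m = Suc m'"
    have m: "C / e < real m" "0 < m" using m' by (auto simp: m_def)
    define \<A> where "\<A> = (\<lambda>g. {x \<in> topspace (Euclidean_space n). \<forall>i<n. \<lfloor>x i * real m\<rfloor> = g i}) ` (PiE {..<n} (\<lambda>_. {- int (B * m)..int (B * m)}))"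
    have fin: "finite \<A>" unfolding \<A>_def by (intro finite_imageI finite_PiE) auto
    have "card \<A> \<le> card (PiE {..<n} (\<lambda>_. {- int (B * m)..int (B * m)}))"
      unfolding \<A>_def by (intro card_image_le finite_PiE) auto
    also have "\<dots> = (2 * (B * m) + 1) ^ n" by (simp add: card_PiE nat_add_distrib nat_mult_distrib)
    also have "\<dots> \<le> ((2 * B + 1) * m) ^ n" using m(2) by (intro power_mono) (auto simp: algebra_simps)
    finally have "real (card \<A>) \<le> real (((2 * B + 1) * m) ^ n)"
      by (rule of_nat_mono)
    then have "real (card \<A>) \<le> ((2 * real B + 1) * real m) ^ n" by (simp only: of_nat_power of_nat_mult of_nat_add of_nat_numeral of_nat_1)
    then have "real (card \<A>) * ((real n + 1) / real m) ^ Suc n \<le> ((2 * real B + 1) * real m) ^ n * ((real n + 1) / real m) ^ Suc n"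
      by (intro mult_right_mono) auto
    also have "\<dots> = C / real m"
      using m(2) by (simp add: C_def power_mult_distrib power_divide)
    also have "\<dots> < e" using m \<open>0 < e\<close> by (simp add: field_simps)
    finally have 1: "real (card \<A>) * ((real n + 1) / real m) ^ Suc n < e" .
    have 2: "L \<subseteq> \<Union>\<A>"
    proof
      fix x assume x: "x \<in> L"
      have "\<lfloor>x i * real m\<rfloor> \<in> {- int (B * m)..int (B * m)}" for i
      proof -
        have "\<bar>x i * real m\<bar> \<le> real B * real m" using bd[OF x, of i] by (simp add: abs_mult mult_right_mono)
        then have "- real (B * m) \<le> x i * real m" "x i * real m \<le> real (B * m)" by auto
        then show ?thesis by (auto simp: le_floor_iff floor_le_iff)
      qed
      then have "restrict (\<lambda>i. \<lfloor>x i * real m\<rfloor>) {..<n} \<in> PiE {..<n} (\<lambda>_. {- int (B * m)..int (B * m)})" by auto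
      then show "x \<in> \<Union>\<A>" unfolding \<A>_def using x L by (intro UN_I[of "restrict (\<lambda>i. \<lfloor>x i * real m\<rfloor>) {..<n}"] ) auto
    qed
    have 3: "d x y \<le> (real n + 1) / real m" if "A \<in> \<A>" "x \<in> A" "y \<in> A" for A x y
    proof -
      have "\<bar>x i - y i\<bar> \<le> 1 / real m" if "i < n" for i
      proof -
        have "\<lfloor>x i * real m\<rfloor> = \<lfloor>y i * real m\<rfloor>" using \<open>A \<in> \<A>\<close> \<open>x \<in> A\<close> \<open>y \<in> A\<close> that by (auto simp: \<A>_def)
        then have "\<bar>x i * real m - y i * real m\<bar> \<le> 1" by linarith
        then have "\<bar>x i - y i\<bar> * real m \<le> 1" by (simp add: left_diff_distrib[symmetric] abs_mult)
        then show ?thesis using m(2) by (simp add: pos_le_divide_eq)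
      qed
      then have "(\<Sum>i<n. \<bar>x i - y i\<bar>) \<le> (\<Sum>i<n. 1 / real m)" by (intro sum_mono) auto
      moreover have "d x y \<le> (\<Sum>i<n. \<bar>x i - y i\<bar>)" unfolding d_def by (rule L2_set_le_sum_abs)
      ultimately have "d x y \<le> real n / real m" by simp
      also have "\<dots> \<le> (real n + 1) / real m" by (intro divide_right_mono) auto
      finally show ?thesis .
    qed
    show "\<exists>\<A> r. finite \<A> \<and> L \<subseteq> \<Union>\<A> \<and> 0 < r \<and>
     (\<forall>B\<in>\<A>. \<forall>x\<in>B. \<forall>y\<in>B. d x y \<le> r) \<and> real (card \<A>) * r ^ Suc n < e"
    proof (intro exI conjI)
      show "\<forall>B\<in>\<A>. \<forall>x\<in>B. \<forall>y\<in>B. d x y \<le> (real n + 1) / real m" using 3 by blast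
    qed (use fin 1 2 m(2) in simp_all)
  qed
  then have "subtopology mtopology L dim_le (int (Suc n) - 1)" using L by (intro null_content_imp_dim_le)
  moreover have "mtopology_of (Euclidean_space_metric n) = mtopology"
    unfolding Euclidean_space_metric_def d_def[symmetric] by (rule mtopology_of)
  ultimately show ?thesis unfolding finite_dimensional_def by auto
qed

lemma finite_dimensional_compactin_Euclidean:
  assumes "compactin (mtopology_of (Euclidean_space_metric n)) L"
  shows "finite_dimensional (subtopology (mtopology_of (Euclidean_space_metric n)) L)"
proof -
  define d where "d = (\<lambda>x y. L2_set (\<lambda>i. x i - y i :: real) {..<n})"
  interpret Metric_space "topspace (Euclidean_space n)" d
    unfolding d_def by (rule Metric_space_Euclidean_space)
  have "mtopology_of (Euclidean_space_metric n) = mtopology"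
    unfolding Euclidean_space_metric_def d_def[symmetric] by (rule mtopology_of)
  then have "compactin mtopology L" using assms by simp
  then have L: "L \<subseteq> topspace (Euclidean_space n)" "mbounded L"
    using compactin_subset_topspace compactin_imp_mbounded by fastforce+
  then obtain a K where K: "L \<subseteq> mcball a K" unfolding mbounded_def by blast
  define b where "b = (\<Sum>i<n. \<bar>a i\<bar>) + \<bar>K\<bar>"
  have "\<bar>x i\<bar> \<le> real (nat \<lceil>b\<rceil>)" if "x \<in> L" for x i
  proof (cases "i < n")
    case True
    have "\<bar>a i - x i\<bar> \<le> d a x"
      unfolding d_def using True member_le_L2_set[of "{..<n}" i "\<lambda>i. \<bar>a i - x i\<bar>"] by (simp add: L2_set_def)
    also have "\<dots> \<le> \<bar>K\<bar>" using K that by (fastforce simp: in_mcball)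
    finally have "\<bar>x i\<bar> \<le> \<bar>a i\<bar> + \<bar>K\<bar>" by linarith
    also have "\<dots> \<le> b" unfolding b_def using True by (intro add_mono member_le_sum) auto
    finally show ?thesis by linarith
  next
    case False
    then have "x i = 0" using that L(1) by (auto simp: topspace_Euclidean_space)
    then show ?thesis by simp
  qed
  then show ?thesis using L(1) by (rule finite_dimensional_bounded_Euclidean)
qed

section \<open>Injections into Euclidean space\<close>

text \<open>
  Covering dimension less than \<open>n\<close>, for open covers of \<open>B\<close> by sets open in the ambient space.
\<close>

definition shrinkable_to_order :: "nat \<Rightarrow> 'a::metric_space set \<Rightarrow> bool" where
  "shrinkable_to_order n B \<longleftrightarrow>
     (\<forall>I U. finite (I::nat set) \<longrightarrow> (\<forall>i\<in>I. open (U i)) \<longrightarrow> B \<subseteq> (\<Union>i\<in>I. U i) \<longrightarrow>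
       (\<exists>V. (\<forall>i\<in>I. open (V i) \<and> V i \<subseteq> U i) \<and> B \<subseteq> (\<Union>i\<in>I. V i) \<and> (\<forall>x\<in>B. card {i \<in> I. x \<in> V i} \<le> n)))"

lemma shrinkable_to_orderD:
  assumes "shrinkable_to_order n B" "finite (I::nat set)" "\<forall>i\<in>I. open (U i)" "B \<subseteq> (\<Union>i\<in>I. U i)"
  shows "\<exists>V. (\<forall>i\<in>I. open (V i)) \<and> (\<forall>i\<in>I. V i \<subseteq> U i) \<and> B \<subseteq> (\<Union>i\<in>I. V i) \<and> (\<forall>x\<in>B. card {i \<in> I. x \<in> V i} \<le> n)"
  using assms(1)[unfolded shrinkable_to_order_def, rule_format, of I U] assms(2-4) by (simp add: ball_conj_distrib)

lemma shrinkable_to_order_empty: "shrinkable_to_order n {}"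
  unfolding shrinkable_to_order_def by (intro allI impI, rule_tac x=U in exI) simp

text \<open>The cover is shrunk on one closed set at a time: replacing \<open>U i\<close> by
  \<open>(U i - A) \<union> V i\<close> changes it inside \<open>A\<close> only. The second
  shrinking, for \<open>B\<close>, stays within the new sets, so at points of \<open>A - B\<close>
  the bound obtained for \<open>A\<close> survives.\<close>

lemma shrinkable_to_order_Un:
  assumes "closed A" "closed B" "shrinkable_to_order n A" "shrinkable_to_order n B"
  shows "shrinkable_to_order n (A \<union> B)"
  unfolding shrinkable_to_order_def
proof (intro allI impI)
  fix I :: "nat set" and U :: "nat \<Rightarrow> 'a set"
  assume I: "finite I" "\<forall>i\<in>I. open (U i)" "A \<union> B \<subseteq> (\<Union>i\<in>I. U i)"
  then have "A \<subseteq> (\<Union>i\<in>I. U i)" by simp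
  note shrinkable_to_orderD[OF assms(3) I(1,2) this]
  then obtain V where V_all: "\<forall>i\<in>I. open (V i)" "\<forall>i\<in>I. V i \<subseteq> U i" "A \<subseteq> (\<Union>i\<in>I. V i)"
    "\<forall>x\<in>A. card {i \<in> I. x \<in> V i} \<le> n"
    by (elim exE conjE)
  have V: "\<And>i. i \<in> I \<Longrightarrow> open (V i)" "\<And>i. i \<in> I \<Longrightarrow> V i \<subseteq> U i" "A \<subseteq> (\<Union>i\<in>I. V i)"
    "\<And>x. x \<in> A \<Longrightarrow> card {i \<in> I. x \<in> V i} \<le> n"
    by (fact bspec[OF V_all(1)] bspec[OF V_all(2)] V_all(3) bspec[OF V_all(4)])+
  define U' where "U' = (\<lambda>i. (U i - A) \<union> V i)"
  have U': "open (U' i)" "U' i \<subseteq> U i" if "i \<in> I" for i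
  proof -
    show "open (U' i)" unfolding U'_def using V(1) I(2) assms(1) that by (intro open_Un open_Diff) auto
    show "U' i \<subseteq> U i" unfolding U'_def using V(2) that by auto
  qed
  have "A \<union> B \<subseteq> (\<Union>i\<in>I. U' i)"
  proof
    fix x assume x: "x \<in> A \<union> B"
    then obtain i where "i \<in> I" "x \<in> U i" using I(3) by auto
    moreover have "\<exists>i\<in>I. x \<in> V i" if "x \<in> A" using V(3) that by auto
    ultimately show "x \<in> (\<Union>i\<in>I. U' i)" unfolding U'_def by auto
  qed
  then have U'c: "A \<subseteq> (\<Union>i\<in>I. U' i)" "B \<subseteq> (\<Union>i\<in>I. U' i)" by simp_all
  have "\<forall>i\<in>I. open (U' i)" using U'(1) by (rule ballI)
  note shrinkable_to_orderD[OF assms(4) I(1) this U'c(2)]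
  then obtain W where W_all: "\<forall>i\<in>I. open (W i)" "\<forall>i\<in>I. W i \<subseteq> U' i" "B \<subseteq> (\<Union>i\<in>I. W i)"
    "\<forall>x\<in>B. card {i \<in> I. x \<in> W i} \<le> n"
    by (elim exE conjE)
  have W: "\<And>i. i \<in> I \<Longrightarrow> open (W i)" "\<And>i. i \<in> I \<Longrightarrow> W i \<subseteq> U' i" "B \<subseteq> (\<Union>i\<in>I. W i)"
    "\<And>x. x \<in> B \<Longrightarrow> card {i \<in> I. x \<in> W i} \<le> n"
    by (fact bspec[OF W_all(1)] bspec[OF W_all(2)] W_all(3) bspec[OF W_all(4)])+
  define T where "T = (\<lambda>i. (U' i - B) \<union> W i)"
  show "\<exists>V. (\<forall>i\<in>I. open (V i) \<and> V i \<subseteq> U i) \<and> A \<union> B \<subseteq> (\<Union>i\<in>I. V i) \<and> (\<forall>x\<in>A \<union> B. card {i \<in> I. x \<in> V i} \<le> n)"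
  proof (intro exI[of _ T] conjI ballI)
    fix i assume i: "i \<in> I"
    show "open (T i)" unfolding T_def using U' W assms(2) i by (intro open_Un open_Diff) auto
    show "T i \<subseteq> U i" unfolding T_def using U' W i by blast
  next
    show "A \<union> B \<subseteq> (\<Union>i\<in>I. T i)"
    proof
      fix x assume x: "x \<in> A \<union> B"
      show "x \<in> (\<Union>i\<in>I. T i)"
      proof (cases "x \<in> B")
        case True
        then show ?thesis using W(3) unfolding T_def by auto
      next
        case False
        then show ?thesis using x U'c(1) unfolding T_def by auto
      qed
    qed
  next
    fix x assume x: "x \<in> A \<union> B"
    show "card {i \<in> I. x \<in> T i} \<le> n"
    proof (cases "x \<in> B")
      case True
      then have "{i \<in> I. x \<in> T i} = {i \<in> I. x \<in> W i}" unfolding T_def by auto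
      then show ?thesis using W(4) True by simp
    next
      case False
      then have "x \<in> A" using x by simp
      have "{i \<in> I. x \<in> T i} \<subseteq> {i \<in> I. x \<in> V i}"
        unfolding T_def using W(2) False \<open>x \<in> A\<close> unfolding U'_def by auto
      then have "card {i \<in> I. x \<in> T i} \<le> card {i \<in> I. x \<in> V i}" using I(1) by (intro card_mono) auto
      then show ?thesis using V(4)[OF \<open>x \<in> A\<close>] by simp
    qed
  qed
qed

lemma shrinkable_to_order_UN:
  assumes "finite J" "\<And>j. j \<in> J \<Longrightarrow> closed (F j)" "\<And>j. j \<in> J \<Longrightarrow> shrinkable_to_order n (F j)"
  shows "shrinkable_to_order n (\<Union>j\<in>J. F j)"
  using assms
proof (induction J rule: finite_induct)
  case (insert j J)
  then show ?case by (simp add: shrinkable_to_order_Un closed_UN)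
qed (simp add: shrinkable_to_order_empty)

lemma bchoice3:
  assumes "\<And>x. x \<in> B \<Longrightarrow> \<exists>a b c. P x a b c"
  shows "\<exists>a b c. \<forall>x\<in>B. P x (a x) (b x) (c x)"
  using assms by metis

text \<open>
  Cover \<open>B\<close> by finitely many small basic sets. Their frontiers form a set with a refinement of order
  \<open>n\<close>, which is expanded to open sets; off the frontiers the basic sets can be made disjoint, which
  raises the order by one.
\<close>

lemma shrinkable_to_order_step:
  fixes B :: "'a::metric_space set"
  assumes B: "compact B"
    and base: "\<And>x U. x \<in> B \<Longrightarrow> open U \<Longrightarrow> x \<in> U \<Longrightarrow>
      \<exists>G. openin (top_of_set B) G \<and> x \<in> G \<and> G \<subseteq> U \<and> shrinkable_to_order n (top_of_set B frontier_of G)"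
  shows "shrinkable_to_order (Suc n) B"
  unfolding shrinkable_to_order_def
proof (intro allI impI)
  fix I :: "nat set" and U :: "nat \<Rightarrow> 'a set"
  assume I: "finite I" "\<forall>i\<in>I. open (U i)" "B \<subseteq> (\<Union>i\<in>I. U i)"
  define P where "P = (\<lambda>x i G T. i \<in> I \<and> open T \<and> G = B \<inter> T \<and> x \<in> G \<and> G \<subseteq> U i \<and>
    shrinkable_to_order n (top_of_set B frontier_of G))"
  have "\<exists>i G T. P x i G T" if x: "x \<in> B" for x
  proof -
    obtain i where i: "i \<in> I" "x \<in> U i" using I(3) x by auto
    then obtain G where G: "openin (top_of_set B) G" "x \<in> G" "G \<subseteq> U i" "shrinkable_to_order n (top_of_set B frontier_of G)"
      using base[OF x, of "U i"] I(2) by auto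
    then obtain T where "open T" "G = B \<inter> T" by (auto simp: openin_open)
    then show ?thesis unfolding P_def using i G by auto
  qed
  then obtain ix Gx Tx where ixP: "\<forall>x\<in>B. P x (ix x) (Gx x) (Tx x)"
    using bchoice3[of B P] by auto
  then have x: "\<And>x. x \<in> B \<Longrightarrow> ix x \<in> I" "\<And>x. x \<in> B \<Longrightarrow> open (Tx x)"
    "\<And>x. x \<in> B \<Longrightarrow> Gx x = B \<inter> Tx x" "\<And>x. x \<in> B \<Longrightarrow> x \<in> Gx x" "\<And>x. x \<in> B \<Longrightarrow> Gx x \<subseteq> U (ix x)"
    "\<And>x. x \<in> B \<Longrightarrow> shrinkable_to_order n (top_of_set B frontier_of (Gx x))"
    unfolding P_def by blast+
  have "B \<subseteq> (\<Union>y\<in>B. Tx y)" using x(3,4) by fastforce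
  then obtain X where X: "X \<subseteq> B" "finite X" "B \<subseteq> (\<Union>y\<in>X. Tx y)"
    using compactE_image[OF B, of B Tx] x(2) by metis
  obtain h where h: "bij_betw h {0..<card X} X" using ex_bij_betw_nat_finite[OF X(2)] by blast
  define m where "m = card X"
  have hX: "X = h ` {0..<m}" using h by (simp add: bij_betw_def m_def)
  define G where "G = (\<lambda>j. Gx (h j))"
  define \<iota> where "\<iota> = (\<lambda>j. ix (h j))"
  have hB: "h j \<in> B" if "j < m" for j using that hX X(1) by auto
  have G: "openin (top_of_set B) (G j)" "G j \<subseteq> U (\<iota> j)" "\<iota> j \<in> I"
       "shrinkable_to_order n (top_of_set B frontier_of (G j))" if "j < m" for j
    using x hB[OF that] unfolding G_def \<iota>_def by (auto simp: openin_open)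
  have Gcov: "\<exists>j<m. y \<in> G j" if yB: "y \<in> B" for y
  proof -
    obtain j where "j < m" "y \<in> Tx (h j)" using X(3) yB hX by auto
    then show ?thesis using x(3)[OF hB] yB unfolding G_def by auto
  qed
  define B' where "B' = (\<Union>j\<in>{..<m}. top_of_set B frontier_of (G j))"
  have frc: "closed (top_of_set B frontier_of (G j))" for j
    using B compact_imp_closed closedin_closed_trans closedin_frontier_of by blast
  have B'B: "B' \<subseteq> B" unfolding B'_def using frontier_of_subset_topspace[of "top_of_set B"] by fastforce
  have B'cl: "closed B'" unfolding B'_def using frc by auto
  have B'comp: "compact B'" using B B'B B'cl by (metis compact_Int_closed inf.absorb_iff2)
  have ord: "shrinkable_to_order n B'"
    unfolding B'_def using frc G(4) by (intro shrinkable_to_order_UN) auto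
  have "B' \<subseteq> (\<Union>i\<in>I. U i)" using B'B I(3) by (rule order_trans)
  note shrinkable_to_orderD[OF ord I(1,2) this]
  then obtain V' where V'_all: "\<forall>i\<in>I. open (V' i)" "\<forall>i\<in>I. V' i \<subseteq> U i" "B' \<subseteq> (\<Union>i\<in>I. V' i)"
    "\<forall>x\<in>B'. card {i \<in> I. x \<in> V' i} \<le> n"
    by (elim exE conjE)
  have V': "\<And>i. i \<in> I \<Longrightarrow> open (V' i)" "\<And>i. i \<in> I \<Longrightarrow> V' i \<subseteq> U i" "B' \<subseteq> (\<Union>i\<in>I. V' i)"
    "\<And>x. x \<in> B' \<Longrightarrow> card {i \<in> I. x \<in> V' i} \<le> n"
    by (fact bspec[OF V'_all(1)] bspec[OF V'_all(2)] V'_all(3) bspec[OF V'_all(4)])+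
  \<comment> \<open>Expands the trace of \<open>V' i\<close> on \<open>B'\<close> to an open set:
    the points nearer to \<open>B'\<close> than to the rest \<open>B' - V' i\<close>. An empty rest
    is a separate case since \<open>infdist\<close> to the empty set is 0.\<close>
  define E where "E = (\<lambda>i. {x. B' \<subseteq> V' i \<or> infdist x B' < infdist x (B' - V' i)})"
  have Eopen: "open (E i)" for i
  proof (cases "B' \<subseteq> V' i")
    case False
    have "open {x. infdist x B' < infdist x (B' - V' i)}"
      by (intro open_Collect_less continuous_intros)
    then show ?thesis using False by (simp add: E_def)
  qed (simp add: E_def)
  \<comment> \<open>For empty \<open>B'\<close> every \<open>E i\<close> is the whole space and no
    nearest point of \<open>B'\<close> exists to bound the order.\<close>
  define V'' where "V'' = (\<lambda>i. if B' = {} then {} else E i \<inter> U i)"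
  have V''1: "B' \<subseteq> (\<Union>i\<in>I. V'' i)"
  proof
    fix x assume x: "x \<in> B'"
    then obtain i where i: "i \<in> I" "x \<in> V' i" using V'(3) by auto
    have "x \<in> E i"
    proof (cases "B' \<subseteq> V' i")
      case False
      have "closed (B' - V' i)" using B'cl V'(1)[OF i(1)] by (rule closed_Diff)
      moreover have "B' - V' i \<noteq> {}" "x \<notin> B' - V' i" using False i by auto
      ultimately have "0 < infdist x (B' - V' i)" by (rule infdist_pos_not_in_closed)
      then show ?thesis using x by (simp add: E_def)
    qed (simp add: E_def)
    then show "x \<in> (\<Union>i\<in>I. V'' i)" using x i V'(2) unfolding V''_def by auto
  qed
  have V''2: "card {i \<in> I. x \<in> V'' i} \<le> n" for x
  proof (cases "B' = {}")
    case False
    \<comment> \<open>The nearest point \<open>b\<close> of the compact \<open>B'\<close> controls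
      the order at \<open>x\<close>: if \<open>b\<close> were outside \<open>V' i\<close>, the two
      distances in \<open>E i\<close> could not be strictly ordered.\<close>
    obtain b where b: "b \<in> B'" "\<forall>y\<in>B'. dist x b \<le> dist x y"
      using continuous_attains_inf[OF B'comp False, of "dist x"]
        continuous_on_dist[OF continuous_on_const[of B' x] continuous_on_id] by auto
    then have "infdist x B' = dist x b"
      using False by (intro antisym infdist_le) (auto simp: infdist_notempty intro!: cINF_greatest)
    note b = b(1) this
    have "{i \<in> I. x \<in> V'' i} \<subseteq> {i \<in> I. b \<in> V' i}"
    proof
      fix i assume i: "i \<in> {i \<in> I. x \<in> V'' i}"
      have "b \<in> V' i"
      proof (rule ccontr)
        assume nb: "b \<notin> V' i"
        then have "infdist x (B' - V' i) \<le> dist x b" using b by (intro infdist_le) auto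
        moreover have "x \<in> E i" using i False by (auto simp: V''_def)
        ultimately show False using b nb unfolding E_def by auto
      qed
      then show "i \<in> {i \<in> I. b \<in> V' i}" using i by simp
    qed
    then have "card {i \<in> I. x \<in> V'' i} \<le> card {i \<in> I. b \<in> V' i}" using I(1) by (intro card_mono) auto
    then show ?thesis using V'(4)[OF b(1)] by simp
  qed (simp add: V''_def)
  define cl where "cl = (\<lambda>j. top_of_set B closure_of (G j))"
  \<comment> \<open>Subtracting the closures of all earlier sets keeps \<open>W j\<close> open in
    \<open>B\<close> and makes the family disjoint. What is lost from \<open>B\<close> lies on
    frontiers, hence in \<open>B'\<close>.\<close>
  define W where "W = (\<lambda>j. G j - (\<Union>l\<in>{..<j}. cl l))"
  have Gcl: "G j \<subseteq> cl j" if "j < m" for j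
    unfolding cl_def using G(1)[OF that] by (intro closure_of_subset openin_subset)
  have "\<exists>T. open T \<and> W j = B \<inter> T" if "j < m" for j
  proof -
    have "openin (top_of_set B) (W j)" unfolding W_def cl_def using G(1)[OF that]
      by (intro openin_diff closedin_Union) auto
    then show ?thesis by (simp add: openin_open)
  qed
  then obtain Q where Q: "\<And>j. j < m \<Longrightarrow> open (Q j)" "\<And>j. j < m \<Longrightarrow> W j = B \<inter> Q j" by metis
  have Wdisj: "x \<notin> W l" if "x \<in> W j" "l < j" "j < m" for x j l
    using that Gcl[of l] unfolding W_def by auto
  define V where "V = (\<lambda>i. V'' i \<union> (U i \<inter> (\<Union>j\<in>{j. j < m \<and> \<iota> j = i}. Q j)))"
  show "\<exists>V. (\<forall>i\<in>I. open (V i) \<and> V i \<subseteq> U i) \<and> B \<subseteq> (\<Union>i\<in>I. V i) \<and> (\<forall>x\<in>B. card {i \<in> I. x \<in> V i} \<le> Suc n)"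
  proof (intro exI[of _ V] conjI ballI)
    fix i assume i: "i \<in> I"
    show "open (V i)" unfolding V_def V''_def using Eopen I(2) i Q(1) by (auto intro!: open_Un open_Int open_UN)
    show "V i \<subseteq> U i" unfolding V_def V''_def by auto
  next
    show "B \<subseteq> (\<Union>i\<in>I. V i)"
    proof
      fix x assume x: "x \<in> B"
      show "x \<in> (\<Union>i\<in>I. V i)"
      proof (cases "x \<in> B'")
        case True
        then show ?thesis using V''1 by (auto simp: V_def)
      next
        case False
        define j where "j = (LEAST j. j < m \<and> x \<in> G j)"
        have j: "j < m" "x \<in> G j" using LeastI_ex[OF Gcov[OF x, unfolded Bex_def], folded j_def] by auto
        have "x \<notin> cl l" if "l < j" for l
        proof
          assume "x \<in> cl l"
          have "l < m" using that j by simp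
          have "x \<notin> G l" using not_less_Least[of l "\<lambda>j. j < m \<and> x \<in> G j"] that \<open>l < m\<close> by (auto simp: j_def)
          moreover have "top_of_set B interior_of (G l) = G l"
            using G(1)[OF \<open>l < m\<close>] by (rule interior_of_openin)
          ultimately have "x \<in> top_of_set B frontier_of (G l)"
            using \<open>x \<in> cl l\<close> by (auto simp: frontier_of_def cl_def)
          then show False using False \<open>l < m\<close> unfolding B'_def by auto
        qed
        then have "x \<in> W j" unfolding W_def using j by auto
        then have "x \<in> Q j" using Q(2) j by auto
        then have "x \<in> V (\<iota> j)" using j G(2)[OF j(1)] unfolding V_def by auto
        then show ?thesis using G(3)[OF j(1)] by auto
      qed
    qed
  next
    fix x assume x: "x \<in> B"
    define J where "J = {j. j < m \<and> x \<in> W j}"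
    have "{i \<in> I. x \<in> V i} \<subseteq> {i \<in> I. x \<in> V'' i} \<union> \<iota> ` J"
      using x Q(2) unfolding V_def J_def by auto
    then have "card {i \<in> I. x \<in> V i} \<le> card ({i \<in> I. x \<in> V'' i} \<union> \<iota> ` J)"
      using I(1) by (intro card_mono) (auto simp: J_def)
    also have "\<dots> \<le> card {i \<in> I. x \<in> V'' i} + card (\<iota> ` J)" by (rule card_Un_le)
    also have "card (\<iota> ` J) \<le> card J" by (rule card_image_le) (simp add: J_def)
    also have "card J \<le> 1"
    proof -
      have "j = l" if "j \<in> J" "l \<in> J" for j l
        using that Wdisj[of x j l] Wdisj[of x l j] by (auto simp: J_def) (metis linorder_neqE_nat)
      then show ?thesis by (simp add: card_le_Suc0_iff_eq J_def)
    qed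
    finally show "card {i \<in> I. x \<in> V i} \<le> Suc n" using V''2[of x] by simp
  qed
qed

text \<open>Order \<open>n\<close> corresponds to dimension \<open>n - 1\<close>, so the induction
  starts with dimension -1, the empty space. In the step the frontiers have dimension one less and
  are compact again.\<close>

lemma dim_le_imp_shrinkable_to_order:
  fixes B :: "'a::metric_space set"
  assumes "compact B" "top_of_set B dim_le (int n - 1)"
  shows "shrinkable_to_order n B"
  using assms
proof (induction n arbitrary: B)
  case 0
  then have "topspace (top_of_set B) = {}" by (metis dimension_le_eq_empty diff_0 of_nat_0 topspace_discrete_topology)
  then show ?case by (simp add: shrinkable_to_order_empty)
next
  case (Suc n)
  show ?case
  proof (rule shrinkable_to_order_step[OF Suc.prems(1)])
    fix x U assume x: "x \<in> B" "open U" "x \<in> U"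
    have "openin (top_of_set B) (B \<inter> U)" "x \<in> B \<inter> U" using x by auto
    then obtain G where G: "x \<in> G" "G \<subseteq> B \<inter> U" "openin (top_of_set B) G"
      "subtopology (top_of_set B) (top_of_set B frontier_of G) dim_le (int (Suc n) - 1 - 1)"
      using Suc.prems(2) unfolding dimension_le.simps[of _ "int (Suc n) - 1"] by metis
    let ?F = "top_of_set B frontier_of G"
    have "?F \<subseteq> B" using frontier_of_subset_topspace[of "top_of_set B"] by fastforce
    then have "top_of_set ?F dim_le (int n - 1)" using G(4) by (simp add: subtopology_subtopology inf.absorb2)
    moreover have "compact ?F"
      using Suc.prems(1) closedin_compact closedin_frontier_of by blast
    ultimately have "shrinkable_to_order n ?F" by (rule Suc.IH[rotated])
    then show "\<exists>G. openin (top_of_set B) G \<and> x \<in> G \<and> G \<subseteq> U \<and> shrinkable_to_order n (top_of_set B frontier_of G)"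
      using G by auto
  qed
qed

text \<open>Take a partition of unity \<open>\<phi>\<close> subordinate to a shrunken cover and a
  threshold \<open>t c\<close> for each colour. A point is sorted by the set of indices at which
  \<open>\<phi>\<close> lies above the band of radius \<open>\<tau>/4\<close> around
  \<open>t c\<close>, and colour \<open>c\<close> misses it only if some value lies in that band.
  The bands are disjoint, so different missed colours use different indices, and only
  \<open>n\<close> indices have a positive value.\<close>

lemma colored_closed_families:
  fixes S :: "'a::metric_space set"
  assumes S: "compact S" and n: "shrinkable_to_order n S" and e: "0 < e"
  shows "\<exists>\<W>. (\<forall>c<2*n+1. finite (\<W> c) \<and> (\<forall>W\<in>\<W> c. closed W \<and> W \<subseteq> S \<and> (\<forall>x\<in>W. \<forall>y\<in>W. dist x y < e)) \<and>
            (\<forall>W\<in>\<W> c. \<forall>W'\<in>\<W> c. W \<noteq> W' \<longrightarrow> W \<inter> W' = {})) \<and>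
          (\<forall>x\<in>S. card {c. c < 2*n+1 \<and> x \<notin> \<Union>(\<W> c)} \<le> n)"
proof -
  obtain X where X: "X \<subseteq> S" "finite X" "S \<subseteq> (\<Union>y\<in>X. ball y (e/2))"
    using compactE_image[OF S, of S "\<lambda>y. ball y (e/2)"] e by force
  obtain h where h: "bij_betw h {0..<card X} X" using ex_bij_betw_nat_finite[OF X(2)] by blast
  define I where "I = {0..<card X}"
  define U where "U = (\<lambda>i. ball (h i) (e/2))"
  have fI: "finite I" by (simp add: I_def)
  have Uop: "\<forall>i\<in>I. open (U i)" by (simp add: U_def)
  have Ucov: "S \<subseteq> (\<Union>i\<in>I. U i)"
  proof -
    have "X = h ` I" using h by (simp add: bij_betw_def I_def)
    then show ?thesis using X(3) by (simp add: U_def)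
  qed
  note shrinkable_to_orderD[OF n fI Uop Ucov]
  then obtain V where V: "\<forall>i\<in>I. open (V i)" "\<forall>i\<in>I. V i \<subseteq> U i" "S \<subseteq> (\<Union>i\<in>I. V i)"
     "\<forall>x\<in>S. card {i \<in> I. x \<in> V i} \<le> n" by (elim exE conjE)
  define \<psi> where "\<psi> = (\<lambda>i x. if S \<subseteq> V i then 1 else infdist x (S - V i))"
  have \<psi>0: "0 \<le> \<psi> i x" for i x by (simp add: \<psi>_def infdist_nonneg)
  have \<psi>V: "x \<in> V i" if "x \<in> S" "0 < \<psi> i x" for i x
  proof (rule ccontr)
    assume "x \<notin> V i"
    then have "\<psi> i x = 0" using that(1) by (auto simp: \<psi>_def)
    then show False using that(2) by simp
  qed
  have V\<psi>: "0 < \<psi> i x" if "i \<in> I" "x \<in> V i" for i x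
  proof (cases "S \<subseteq> V i")
    case False
    have "closed (S - V i)" using S V(1) that(1) by (intro closed_Diff compact_imp_closed) auto
    then have "0 < infdist x (S - V i)" using False that(2) by (intro infdist_pos_not_in_closed) auto
    then show ?thesis using False by (simp add: \<psi>_def)
  qed (simp add: \<psi>_def)
  define \<Sigma> where "\<Sigma> = (\<lambda>x. \<Sum>i\<in>I. \<psi> i x)"
  have \<Sigma>: "0 < \<Sigma> x" if "x \<in> S" for x
  proof -
    obtain i where "i \<in> I" "x \<in> V i" using V(3) \<open>x \<in> S\<close> by auto
    then show ?thesis unfolding \<Sigma>_def using \<psi>0 V\<psi> fI by (intro sum_pos2) auto
  qed
  define \<phi> where "\<phi> = (\<lambda>i x. \<psi> i x / \<Sigma> x)"
  have cont_\<psi>: "continuous_on S (\<psi> i)" for i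
    unfolding \<psi>_def by (cases "S \<subseteq> V i") (auto intro!: continuous_intros)
  have cont: "continuous_on S (\<phi> i)" for i
    unfolding \<phi>_def \<Sigma>_def using \<Sigma> cont_\<psi> unfolding \<Sigma>_def
    by (intro continuous_intros) fastforce+
  define m where "m = card I"
  have big: "\<exists>i\<in>I. 1 / real m \<le> \<phi> i x" if x: "x \<in> S" for x
  proof (rule ccontr)
    assume "\<not> ?thesis"
    then have *: "\<And>i. i \<in> I \<Longrightarrow> \<phi> i x < 1 / real m" by auto
    have "I \<noteq> {}" using V(3) x by auto
    then have "(\<Sum>i\<in>I. \<phi> i x) < (\<Sum>i\<in>I. 1 / real m)" using fI * by (intro sum_strict_mono) auto
    also have "\<dots> \<le> 1" by (simp add: m_def)
    finally have "(\<Sum>i\<in>I. \<phi> i x) < 1" .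
    moreover have "(\<Sum>i\<in>I. \<phi> i x) = 1"
      unfolding \<phi>_def using \<Sigma>[OF x] by (simp add: \<Sigma>_def flip: sum_divide_distrib)
    ultimately show False by simp
  qed
  define N where "N = 2*n+1"
  \<comment> \<open>Small enough that all \<open>2 * n + 1\<close> bands lie below
    \<open>1 / m\<close>. The largest of the \<open>m\<close> values of \<open>\<phi>\<close> is at
    least \<open>1 / m\<close>, so the set of indices above a band is never empty.\<close>
  define \<tau> where "\<tau> = 1 / (real (N + 1) * real (m + 1))"
  have \<tau>: "0 < \<tau>" by (simp add: \<tau>_def)
  define t where "t = (\<lambda>c::nat. real (c + 1) * \<tau>)"
  have t0: "0 < t c - \<tau>/4" for c
  proof -
    have "\<tau> \<le> real (c + 1) * \<tau>" using \<tau> by simp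
    then show ?thesis using \<tau> unfolding t_def by linarith
  qed
  have t1: "t c + \<tau>/4 < 1 / real m" if "c < N" "0 < m" for c
  proof -
    have "real (c + 1) \<le> real N" using that(1) by linarith
    then have "t c + \<tau>/4 \<le> real N * \<tau> + \<tau>/4" unfolding t_def using \<tau> by (intro add_right_mono mult_right_mono) auto
    also have "\<dots> < real (N + 1) * \<tau>" using \<tau> by (simp add: algebra_simps)
    also have "\<dots> = 1 / real (m + 1)" unfolding \<tau>_def by (simp del: of_nat_add)
    also have "\<dots> \<le> 1 / real m" using that(2) by (simp add: frac_le)
    finally show ?thesis .
  qed
  have tdiff: "c = c'" if "\<bar>v - t c\<bar> < \<tau>/4" "\<bar>v - t c'\<bar> < \<tau>/4" for c c' v
  proof (rule ccontr)
    assume "c \<noteq> c'"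
    then have "1 \<le> \<bar>real c - real c'\<bar>" by linarith
    then have "\<tau> \<le> \<bar>real c - real c'\<bar> * \<tau>" using \<tau> by simp
    also have "\<dots> = \<bar>(real c - real c') * \<tau>\<bar>" using \<tau> by (simp add: abs_mult)
    also have "(real c - real c') * \<tau> = t c - t c'" by (simp add: t_def algebra_simps)
    finally show False using that \<tau> by linarith
  qed
  define Wf where "Wf = (\<lambda>c \<sigma>. {x\<in>S. (\<forall>i\<in>\<sigma>. t c + \<tau>/4 \<le> \<phi> i x) \<and> (\<forall>i\<in>I - \<sigma>. \<phi> i x \<le> t c - \<tau>/4)})"
  define \<W> where "\<W> = (\<lambda>c. Wf c ` (Pow I - {{}}))"
  have Wclosed: "closed (Wf c \<sigma>)" for c \<sigma>
  proof -
    have "Wf c \<sigma> = S \<inter> (\<Inter>i\<in>\<sigma>. {x\<in>S. t c + \<tau>/4 \<le> \<phi> i x}) \<inter> (\<Inter>i\<in>I-\<sigma>. {x\<in>S. \<phi> i x \<le> t c - \<tau>/4})"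
      unfolding Wf_def by auto
    moreover have "closed {x\<in>S. t c + \<tau>/4 \<le> \<phi> i x}" for i
    proof -
      have "closed (S \<inter> \<phi> i -` {t c + \<tau>/4..})"
        using cont compact_imp_closed[OF S] by (intro continuous_closed_preimage) auto
      moreover have "S \<inter> \<phi> i -` {t c + \<tau>/4..} = {x\<in>S. t c + \<tau>/4 \<le> \<phi> i x}" by auto
      ultimately show ?thesis by simp
    qed
    moreover have "closed {x\<in>S. \<phi> i x \<le> t c - \<tau>/4}" for i
    proof -
      have "closed (S \<inter> \<phi> i -` {..t c - \<tau>/4})"
        using cont compact_imp_closed[OF S] by (intro continuous_closed_preimage) auto
      moreover have "S \<inter> \<phi> i -` {..t c - \<tau>/4} = {x\<in>S. \<phi> i x \<le> t c - \<tau>/4}" by auto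
      ultimately show ?thesis by simp
    qed
    ultimately show ?thesis using compact_imp_closed[OF S] by (simp add: closed_Int closed_INT)
  qed
  have \<phi>V: "x \<in> V i" if "x \<in> S" "0 < \<phi> i x" for i x
    using \<psi>V[OF that(1)] \<Sigma>[OF that(1)] that(2) by (auto simp: \<phi>_def zero_less_divide_iff)
  have Wdiam: "dist x y < e" if "\<sigma> \<subseteq> I" and ne: "\<sigma> \<noteq> {}" and "x \<in> Wf c \<sigma>" "y \<in> Wf c \<sigma>" for c \<sigma> x y
  proof -
    obtain i where i: "i \<in> \<sigma>" using ne by auto
    have "z \<in> V i" if "z \<in> Wf c \<sigma>" for z
    proof -
      have "z \<in> S" "t c + \<tau>/4 \<le> \<phi> i z" using that i by (simp_all add: Wf_def)
      then show ?thesis using t0[of c] \<tau> by (intro \<phi>V) linarith+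
    qed
    then have "x \<in> V i" "y \<in> V i" using that(3,4) by auto
    then have "x \<in> U i" "y \<in> U i" using V(2) i that(1) by auto
    then show ?thesis unfolding U_def using dist_triangle_half_r[of "h i" x e y] by (auto simp: dist_commute)
  qed
  have Wdisj: "Wf c \<sigma> \<inter> Wf c \<sigma>' = {}" if "\<sigma> \<subseteq> I" "\<sigma>' \<subseteq> I" "\<sigma> \<noteq> \<sigma>'" for c \<sigma> \<sigma>'
  proof (rule ccontr)
    assume "Wf c \<sigma> \<inter> Wf c \<sigma>' \<noteq> {}"
    then obtain x where x: "x \<in> Wf c \<sigma>" "x \<in> Wf c \<sigma>'" by auto
    have "s = {i \<in> I. t c < \<phi> i x}" if s: "s \<subseteq> I" "x \<in> Wf c s" for s
    proof -
      have "t c < \<phi> i x" if "i \<in> s" for i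
      proof -
        have "t c + \<tau>/4 \<le> \<phi> i x" using s(2) that by (simp add: Wf_def)
        then show ?thesis using \<tau> by linarith
      qed
      moreover have "\<not> t c < \<phi> i x" if "i \<in> I - s" for i
      proof -
        have "\<phi> i x \<le> t c - \<tau>/4" using s(2) that by (simp add: Wf_def)
        then show ?thesis using \<tau> by linarith
      qed
      ultimately show ?thesis using s(1) by auto
    qed
    from this[OF that(1) x(1)] this[OF that(2) x(2)] show False using that(3) by simp
  qed
  show ?thesis
  proof (intro exI[of _ \<W>] conjI allI impI ballI)
    fix c show "finite (\<W> c)" unfolding \<W>_def using fI by simp
  next
    fix c W assume "W \<in> \<W> c"
    then obtain \<sigma> where \<sigma>: "\<sigma> \<subseteq> I" "\<sigma> \<noteq> {}" "W = Wf c \<sigma>" unfolding \<W>_def by auto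
    show "closed W" "W \<subseteq> S" using \<sigma>(3) Wclosed by (simp_all add: Wf_def)
    show "dist x y < e" if "x \<in> W" "y \<in> W" for x y using Wdiam \<sigma> that by simp
    fix W' assume "W' \<in> \<W> c" "W \<noteq> W'"
    then obtain \<sigma>' where \<sigma>': "\<sigma>' \<subseteq> I" "W' = Wf c \<sigma>'" unfolding \<W>_def by auto
    then show "W \<inter> W' = {}" using \<sigma> \<open>W \<noteq> W'\<close> Wdisj[of \<sigma> \<sigma>' c] by auto
  next
    fix x assume x: "x \<in> S"
    define Bad where "Bad = {c. c < 2*n+1 \<and> x \<notin> \<Union>(\<W> c)}"
    have m0: "0 < m" using big[OF x] fI by (auto simp: m_def card_gt_0_iff)
    have "\<exists>i. i \<in> I \<and> x \<in> V i \<and> \<bar>\<phi> i x - t c\<bar> < \<tau>/4" if c: "c \<in> Bad" for c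
    proof -
      define \<sigma> where "\<sigma> = {i \<in> I. t c + \<tau>/4 \<le> \<phi> i x}"
      obtain i where i: "i \<in> I" "1 / real m \<le> \<phi> i x" using big[OF x] by auto
      have "i \<in> \<sigma>" using i t1[of c] m0 c by (auto simp: \<sigma>_def Bad_def N_def)
      then have "Wf c \<sigma> \<in> \<W> c" unfolding \<W>_def by (auto simp: \<sigma>_def)
      then have "x \<notin> Wf c \<sigma>" using c by (auto simp: Bad_def)
      then obtain j where j: "j \<in> I - \<sigma>" "t c - \<tau>/4 < \<phi> j x" using x unfolding Wf_def \<sigma>_def by fastforce
      then have "\<phi> j x < t c + \<tau>/4" by (auto simp: \<sigma>_def)
      moreover have "x \<in> V j" using \<phi>V[OF x, of j] j t0[of c] by simp
      moreover have "\<bar>\<phi> j x - t c\<bar> < \<tau>/4" using j(2) \<open>\<phi> j x < t c + \<tau>/4\<close> by linarith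
      ultimately show ?thesis using j by (intro exI[of _ j]) auto
    qed
    then obtain ic where ic: "\<forall>c\<in>Bad. ic c \<in> I \<and> x \<in> V (ic c) \<and> \<bar>\<phi> (ic c) x - t c\<bar> < \<tau>/4"
      using bchoice[of Bad "\<lambda>c i. i \<in> I \<and> x \<in> V i \<and> \<bar>\<phi> i x - t c\<bar> < \<tau>/4"] by auto
    have "inj_on ic Bad"
    proof (rule inj_onI)
      fix c c' assume "c \<in> Bad" "c' \<in> Bad" "ic c = ic c'"
      then show "c = c'" using ic tdiff[of "\<phi> (ic c) x" c c'] by auto
    qed
    then have "card Bad \<le> card {i \<in> I. x \<in> V i}"
      using ic fI by (intro card_inj_on_le[of ic]) auto
    also have "\<dots> \<le> n" using V(4) x by simp
    finally show "card {c. c < 2*n+1 \<and> x \<notin> \<Union>(\<W> c)} \<le> n" by (simp add: Bad_def)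
  qed
qed

lemma exists_inj_close:
  fixes a :: "'b \<Rightarrow> real"
  assumes "finite A" "0 < e"
  shows "\<exists>v. inj_on v A \<and> (\<forall>w\<in>A. \<bar>v w - a w\<bar> < e)"
  using assms(1)
proof (induction A rule: finite_induct)
  case (insert w A)
  then obtain v where v: "inj_on v A" "\<forall>w\<in>A. \<bar>v w - a w\<bar> < e" by auto
  have "infinite {a w - e <..< a w + e}" using assms(2) by (simp add: infinite_Ioo)
  then have "infinite ({a w - e <..< a w + e} - v ` A)" using insert.hyps(1) by (intro Diff_infinite_finite) auto
  then have "{a w - e <..< a w + e} - v ` A \<noteq> {}" by (metis finite.emptyI)
  then obtain r where r: "r \<in> {a w - e <..< a w + e} - v ` A" by blast
  have "inj_on (v(w := r)) (insert w A)"
  proof -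
    have "(v(w := r)) ` A = v ` A" using insert.hyps(2) by auto
    moreover have "inj_on (v(w := r)) A" using v(1) r by (intro inj_on_fun_updI) auto
    ultimately show ?thesis using r insert.hyps(2) by (subst inj_on_insert) auto
  qed
  moreover have "\<forall>w'\<in>insert w A. \<bar>(v(w := r)) w' - a w'\<bar> < e" using v(2) r by (auto simp: abs_less_iff)
  ultimately show ?case by blast
qed simp

text \<open>Assign distinct constants close to \<open>f\<close> to the finitely many disjoint sets.
  The difference of constant and \<open>f\<close> is continuous on their closed union and bounded by
  \<open>e\<close>; a Tietze extension with the same bound is the correction to add to
  \<open>f\<close>.\<close>

lemma separate_closed_family:
  fixes S :: "'a::metric_space set" and f :: "'a \<Rightarrow> real"
  assumes S: "compact S" and f: "continuous_on S f" and e: "0 < e"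
    and W: "finite \<W>" "\<And>W. W \<in> \<W> \<Longrightarrow> closed W" "\<And>W. W \<in> \<W> \<Longrightarrow> W \<subseteq> S"
    and disj: "\<And>W W'. W \<in> \<W> \<Longrightarrow> W' \<in> \<W> \<Longrightarrow> W \<noteq> W' \<Longrightarrow> W \<inter> W' = {}"
    and small: "\<And>W x y. W \<in> \<W> \<Longrightarrow> x \<in> W \<Longrightarrow> y \<in> W \<Longrightarrow> \<bar>f x - f y\<bar> < e/2"
  shows "\<exists>g d. continuous_on S g \<and> (\<forall>x\<in>S. \<bar>g x - f x\<bar> \<le> e) \<and> 0 < d \<and>
    (\<forall>W\<in>\<W>. \<forall>W'\<in>\<W>. W \<noteq> W' \<longrightarrow> (\<forall>x\<in>W. \<forall>y\<in>W'. d \<le> \<bar>g x - g y\<bar>))"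
proof -
  define a where "a = (\<lambda>W. f (SOME x. x \<in> W))"
  obtain v where v: "inj_on v \<W>" "\<forall>W\<in>\<W>. \<bar>v W - a W\<bar> < e/2"
    using exists_inj_close[OF W(1), of "e/2" a] e by auto
  have va: "\<bar>v W - f x\<bar> \<le> e" if "W \<in> \<W>" "x \<in> W" for W x
  proof -
    have "(SOME x. x \<in> W) \<in> W" using that(2) by (rule someI)
    then have "\<bar>a W - f x\<bar> < e/2" unfolding a_def using small that by blast
    moreover have "\<bar>v W - a W\<bar> < e/2" using v(2) that(1) by simp
    ultimately show ?thesis by linarith
  qed
  define T where "T = (\<Union>W\<in>\<W>. W)"
  define h where "h = (\<lambda>x. v (THE W. W \<in> \<W> \<and> x \<in> W) - f x)"
  have h: "h x = v W - f x" if "W \<in> \<W>" "x \<in> W" for W x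
  proof -
    have "(THE W. W \<in> \<W> \<and> x \<in> W) = W"
      using that disj by (intro the_equality) auto
    then show ?thesis by (simp add: h_def)
  qed
  have "continuous_on T h"
    unfolding T_def
  proof (rule continuous_on_closed_Union)
    fix W assume Wi: "W \<in> \<W>"
    have "continuous_on W (\<lambda>x. v W - f x)"
      using continuous_on_subset[OF f W(3)[OF Wi]] by (intro continuous_intros)
    moreover have "continuous_on W h = continuous_on W (\<lambda>x. v W - f x)"
      by (rule continuous_on_cong) (simp_all add: h[OF Wi])
    ultimately show "continuous_on W h" by simp
  qed (use W in auto)
  moreover have TS: "T \<subseteq> S" unfolding T_def using W(3) by auto
  ultimately have "continuous_map (subtopology (top_of_set S) T) euclideanreal h"
    by (simp add: subtopology_subtopology inf.absorb2)
  moreover have "closedin (top_of_set S) T"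
  proof -
    have "closed T" unfolding T_def using W by auto
    then show ?thesis using TS by (simp add: closed_subset)
  qed
  moreover have "normal_space (top_of_set S)"
    by (intro metrizable_imp_normal_space metrizable_space_subtopology metrizable_space_euclidean)
  moreover have "h ` T \<subseteq> {-e..e}"
  proof
    fix r assume "r \<in> h ` T"
    then obtain W x where "W \<in> \<W>" "x \<in> W" "r = h x" by (auto simp: T_def)
    then show "r \<in> {-e..e}" using h va[of W x] by (auto simp: abs_le_iff)
  qed
  moreover have "- e \<le> e" using e by simp
  ultimately obtain H where H: "continuous_map (top_of_set S) euclideanreal H" "\<And>x. x \<in> T \<Longrightarrow> H x = h x"
    "H ` topspace (top_of_set S) \<subseteq> {-e..e}"
    using Tietze_extension_closed_real_interval[of "top_of_set S" T h "-e" e] by metis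
  define g where "g = (\<lambda>x. f x + H x)"
  have gW: "g x = v W" if "W \<in> \<W>" "x \<in> W" for W x
  proof -
    have "x \<in> T" using that by (auto simp: T_def)
    then show ?thesis unfolding g_def using H(2) h[OF that] by simp
  qed
  \<comment> \<open>The element 1 makes \<open>Min D\<close> meaningful and positive when the family
    has at most one member.\<close>
  define D where "D = insert 1 ((\<lambda>(W,W'). \<bar>v W - v W'\<bar>) ` {(W,W') \<in> \<W> \<times> \<W>. W \<noteq> W'})"
  have fD: "finite D" unfolding D_def using W(1)
    by (intro finite.insertI finite_imageI finite_subset[OF _ finite_cartesian_product[OF W(1) W(1)]]) auto
  have D0: "0 < r" if rD: "r \<in> D" for r
  proof (cases "r = 1")
    case False
    then obtain W W' where "W \<in> \<W>" "W' \<in> \<W>" "W \<noteq> W'" "r = \<bar>v W - v W'\<bar>"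
      using rD by (auto simp: D_def)
    then show ?thesis using inj_onD[OF v(1), of W W'] by auto
  qed simp
  show ?thesis
  proof (intro exI conjI ballI impI)
    show "continuous_on S g" unfolding g_def using f H(1) by (auto intro: continuous_intros)
    show "0 < Min D" using fD D0 by (subst Min_gr_iff) (auto simp: D_def)
    show "\<bar>g x - f x\<bar> \<le> e" if "x \<in> S" for x
      using H(3) that unfolding g_def by (auto simp: abs_le_iff image_subset_iff)
    fix W W' x y assume *: "W \<in> \<W>" "W' \<in> \<W>" "W \<noteq> W'" "x \<in> W" "y \<in> W'"
    then have "g x = v W" "g y = v W'" by (simp_all only: gW)
    then have "\<bar>g x - g y\<bar> = (\<lambda>(W,W'). \<bar>v W - v W'\<bar>) (W,W')" by simp
    moreover have "(W,W') \<in> {(W,W') \<in> \<W> \<times> \<W>. W \<noteq> W'}" using * by simp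
    ultimately have "\<bar>g x - g y\<bar> \<in> D" unfolding D_def by (intro insertI2 image_eqI)
    then show "Min D \<le> \<bar>g x - g y\<bar>" using fD by simp
  qed
qed

lemma finite_choice_min:
  assumes "\<And>c. c < (N::nat) \<Longrightarrow> \<exists>d>0::real. P c d" and mono: "\<And>c d d'. P c d \<Longrightarrow> 0 < d' \<Longrightarrow> d' \<le> d \<Longrightarrow> P c d'"
  shows "\<exists>d>0. \<forall>c<N. P c d"
  using assms(1)
proof (induction N)
  case 0
  show ?case by (auto intro: exI[of _ 1])
next
  case (Suc N)
  then obtain d where d: "d > 0" "\<forall>c<N. P c d" by auto
  obtain d' where d': "d' > 0" "P N d'" using Suc.prems by auto
  have "P c (min d d')" if "c < Suc N" for c
    using mono[of c d "min d d'"] mono[of c d' "min d d'"] d d' that by (cases "c = N") auto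
  then show ?case using d d' by (intro exI[of _ "min d d'"]) auto
qed

text \<open>
  Pontryagin--Noebeling by colours: the cover is turned into \<open>2 n + 1\<close> separated closed families such
  that each point is missed by at most \<open>n\<close> of them; two points are then covered by a common family.
\<close>

lemma eps_map_perturbation:
  fixes S :: "'a::metric_space set" and f :: "nat \<Rightarrow> 'a \<Rightarrow> real"
  assumes S: "compact S" and n: "shrinkable_to_order n S" and f: "\<forall>c<2*n+1. continuous_on S (f c)" and e: "0 < e"
  shows "\<exists>g. (\<forall>c<2*n+1. continuous_on S (g c) \<and> (\<forall>x\<in>S. \<bar>g c x - f c x\<bar> \<le> e)) \<and>
    (\<exists>d>0. \<forall>x\<in>S. \<forall>y\<in>S. e \<le> dist x y \<longrightarrow> (\<exists>c<2*n+1. d \<le> \<bar>g c x - g c y\<bar>))"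
proof -
  define N where "N = 2*n+1"
  have "\<exists>d>0. \<forall>c<N. \<forall>x\<in>S. \<forall>y\<in>S. dist x y < d \<longrightarrow> \<bar>f c x - f c y\<bar> < e/2"
  proof (rule finite_choice_min)
    fix c assume "c < N"
    then have "uniformly_continuous_on S (f c)" using f S compact_uniformly_continuous by (auto simp: N_def)
    then show "\<exists>d>0. \<forall>x\<in>S. \<forall>y\<in>S. dist x y < d \<longrightarrow> \<bar>f c x - f c y\<bar> < e/2"
      unfolding uniformly_continuous_on_def dist_real_def using e by (metis half_gt_zero dist_commute)
  qed auto
  then obtain d0 where d0: "0 < d0" "\<And>c x y. c < N \<Longrightarrow> x \<in> S \<Longrightarrow> y \<in> S \<Longrightarrow> dist x y < d0 \<Longrightarrow> \<bar>f c x - f c y\<bar> < e/2"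
    by auto
  have "0 < min d0 e" using d0(1) e by simp
  from colored_closed_families[OF S n this] obtain \<W> where
    W1: "\<forall>c<2*n+1. finite (\<W> c) \<and> (\<forall>W\<in>\<W> c. closed W \<and> W \<subseteq> S \<and> (\<forall>x\<in>W. \<forall>y\<in>W. dist x y < min d0 e)) \<and>
            (\<forall>W\<in>\<W> c. \<forall>W'\<in>\<W> c. W \<noteq> W' \<longrightarrow> W \<inter> W' = {})" and
    W2: "\<forall>x\<in>S. card {c. c < 2*n+1 \<and> x \<notin> \<Union>(\<W> c)} \<le> n" by (elim exE conjE)
  define P where "P = (\<lambda>c g d. continuous_on S g \<and> (\<forall>x\<in>S. \<bar>g x - f c x\<bar> \<le> e) \<and> 0 < d \<and>
    (\<forall>W\<in>\<W> c. \<forall>W'\<in>\<W> c. W \<noteq> W' \<longrightarrow> (\<forall>x\<in>W. \<forall>y\<in>W'. d \<le> \<bar>g x - g y\<bar>)))"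
  have "\<forall>c<N. \<exists>g. \<exists>d>0. P c g d"
  proof (intro allI impI)
    fix c assume c: "c < N"
    have Wc: "finite (\<W> c)" "\<And>W. W \<in> \<W> c \<Longrightarrow> closed W" "\<And>W. W \<in> \<W> c \<Longrightarrow> W \<subseteq> S"
      "\<And>W x y. W \<in> \<W> c \<Longrightarrow> x \<in> W \<Longrightarrow> y \<in> W \<Longrightarrow> dist x y < min d0 e"
      "\<And>W W'. W \<in> \<W> c \<Longrightarrow> W' \<in> \<W> c \<Longrightarrow> W \<noteq> W' \<Longrightarrow> W \<inter> W' = {}"
      using W1[rule_format, of c] c unfolding N_def by simp_all
    have "\<exists>g d. P c g d"
      unfolding P_def
    proof (rule separate_closed_family[OF S _ e Wc(1,2,3,5)])
      show "continuous_on S (f c)" using f c by (simp add: N_def)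
      show "\<bar>f c x - f c y\<bar> < e/2" if "W \<in> \<W> c" "x \<in> W" "y \<in> W" for W x y
        using Wc(3)[OF that(1)] Wc(4)[OF that] that(2,3) by (intro d0(2)[OF c]) auto
    qed
    then show "\<exists>g. \<exists>d>0. P c g d" by (auto simp: P_def)
  qed
  then obtain g where g: "\<And>c. c < N \<Longrightarrow> \<exists>d>0. P c (g c) d" by metis
  have "\<exists>d>0. \<forall>c<N. P c (g c) d"
  proof (rule finite_choice_min)
    fix c d d' assume *: "P c (g c) d" "0 < d'" "d' \<le> d"
    then show "P c (g c) d'" unfolding P_def by (meson order_trans)
  qed (rule g)
  then obtain d where d: "0 < d" "\<And>c. c < N \<Longrightarrow> P c (g c) d" by auto
  show ?thesis
  proof (intro exI[of _ g] conjI allI impI exI[of _ d] ballI)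
    fix c assume "c < 2*n+1"
    then have "P c (g c) d" using d by (simp add: N_def)
    then show "continuous_on S (g c)" "\<And>x. x \<in> S \<Longrightarrow> \<bar>g c x - f c x\<bar> \<le> e" by (auto simp: P_def)
  next
    show "0 < d" by fact
  next
    fix x y assume xy: "x \<in> S" "y \<in> S" "e \<le> dist x y"
    define Bx where "Bx = (\<lambda>x. {c. c < 2*n+1 \<and> x \<notin> \<Union>(\<W> c)})"
    have "card (Bx x \<union> Bx y) \<le> card (Bx x) + card (Bx y)" by (rule card_Un_le)
    also have "\<dots> \<le> 2*n" using bspec[OF W2 xy(1)] bspec[OF W2 xy(2)] unfolding Bx_def by linarith
    finally have "card (Bx x \<union> Bx y) < card {..<2*n+1}" by simp
    then have "\<not> {..<2*n+1} \<subseteq> Bx x \<union> Bx y" using card_mono[of "Bx x \<union> Bx y" "{..<2*n+1}"] by (force simp: Bx_def)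
    then obtain c where c: "c < 2*n+1" "x \<in> \<Union>(\<W> c)" "y \<in> \<Union>(\<W> c)" by (auto simp: Bx_def)
    then obtain W W' where W: "W \<in> \<W> c" "W' \<in> \<W> c" "x \<in> W" "y \<in> W'" by auto
    have "W \<noteq> W'"
    proof
      assume "W = W'"
      then have "dist x y < min d0 e" using W1[rule_format, OF c(1)] W by simp
      then show False using xy(3) by simp
    qed
    then have "d \<le> \<bar>g c x - g c y\<bar>" using d(2)[of c] c(1) W unfolding P_def N_def by simp
    then show "\<exists>c<2*n+1. d \<le> \<bar>g c x - g c y\<bar>" using c(1) by auto
  qed
qed

text \<open>An explicit substitute for a Baire category argument: successive perturbations, each
  separating points that are further apart than the current scale, with later changes too small to
  undo the separation.\<close>

lemma shrinkable_to_order_imp_injection: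
  fixes S :: "'a::metric_space set"
  assumes S: "compact S" and n: "shrinkable_to_order n S"
  shows "\<exists>h :: nat \<Rightarrow> 'a \<Rightarrow> real. (\<forall>c<2*n+1. continuous_on S (h c)) \<and>
     (\<forall>x\<in>S. \<forall>y\<in>S. (\<forall>c<2*n+1. h c x = h c y) \<longrightarrow> x = y)"
proof -
  define N where "N = 2*n+1"
  define P where "P = (\<lambda>s :: (nat \<Rightarrow> 'a \<Rightarrow> real) \<times> real. (\<forall>c<N. continuous_on S (fst s c)) \<and> 0 < snd s)"
  \<comment> \<open>A state is a map together with the perturbation allowed next. Since the
    allowances at least halve, later changes sum to at most twice the next one, for both points
    together four times; hence the gap 8 survives in the limit.\<close>
  define Q where "Q = (\<lambda>(s :: (nat \<Rightarrow> 'a \<Rightarrow> real) \<times> real) t. snd t \<le> snd s / 2 \<and>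
     (\<forall>c<N. \<forall>x\<in>S. \<bar>fst t c x - fst s c x\<bar> \<le> snd s) \<and>
     (\<forall>x\<in>S. \<forall>y\<in>S. snd s \<le> dist x y \<longrightarrow> (\<exists>c<N. 8 * snd t \<le> \<bar>fst t c x - fst t c y\<bar>)))"
  have "\<exists>s. \<forall>k. P (s k) \<and> Q (s k) (s (Suc k))"
  proof (rule dependent_nat_choice)
    show "\<exists>x. P x" by (rule exI[of _ "(\<lambda>_ _. 0, 1)"]) (simp add: P_def)
  next
    fix s :: "(nat \<Rightarrow> 'a \<Rightarrow> real) \<times> real" and k :: nat assume s: "P s"
    then have f: "\<forall>c<2*n+1. continuous_on S (fst s c)" "0 < snd s" by (auto simp: P_def N_def)
    obtain g d where g: "\<forall>c<2*n+1. continuous_on S (g c) \<and> (\<forall>x\<in>S. \<bar>g c x - fst s c x\<bar> \<le> snd s)"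
      "0 < d" "\<forall>x\<in>S. \<forall>y\<in>S. snd s \<le> dist x y \<longrightarrow> (\<exists>c<2*n+1. d \<le> \<bar>g c x - g c y\<bar>)"
      using eps_map_perturbation[OF S n f] by auto
    have "Q s (g, min (snd s / 2) (d / 8))"
      unfolding Q_def fst_conv snd_conv
    proof (intro conjI allI impI ballI)
      fix x y assume "x \<in> S" "y \<in> S" "snd s \<le> dist x y"
      then obtain c where c: "c < 2*n+1" "d \<le> \<bar>g c x - g c y\<bar>" using g(3) by auto
      have "8 * min (snd s / 2) (d / 8) \<le> d" by simp
      then show "\<exists>c<N. 8 * min (snd s / 2) (d / 8) \<le> \<bar>g c x - g c y\<bar>"
        using c by (intro exI[of _ c]) (auto simp: N_def)
    qed (use g(1) in \<open>auto simp: N_def\<close>)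
    then show "\<exists>t. P t \<and> Q s t"
      using g f(2) by (intro exI[of _ "(g, min (snd s / 2) (d / 8))"]) (auto simp: P_def N_def)
  qed
  then obtain s where s: "\<And>k. P (s k)" "\<And>k. Q (s k) (s (Suc k))" by auto
  define F where "F = (\<lambda>k. fst (s k))"
  define e where "e = (\<lambda>k. snd (s k))"
  have e0: "0 < e k" and Fc: "c < N \<Longrightarrow> continuous_on S (F k c)" for k c
    using s(1)[of k] by (auto simp: P_def F_def e_def)
  have e2: "e (Suc k) \<le> e k / 2" and FS: "c < N \<Longrightarrow> x \<in> S \<Longrightarrow> \<bar>F (Suc k) c x - F k c x\<bar> \<le> e k"
    and sep: "x \<in> S \<Longrightarrow> y \<in> S \<Longrightarrow> e k \<le> dist x y \<Longrightarrow> \<exists>c<N. 8 * e (Suc k) \<le> \<bar>F (Suc k) c x - F (Suc k) c y\<bar>" for k c x y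
    using s(2)[of k] by (auto simp: Q_def F_def e_def)
  have eb: "e k \<le> e 0 * (1/2) ^ k" for k
  proof (induction k)
    case (Suc k)
    then show ?case using e2[of k] by simp
  qed simp
  have e_lim: "e \<longlonglongrightarrow> 0"
  proof (rule tendsto_sandwich[of "\<lambda>_. 0"])
    show "(\<lambda>k. e 0 * (1/2) ^ k) \<longlonglongrightarrow> 0" by (intro tendsto_mult_right_zero LIMSEQ_power_zero) auto
  qed (use e0 eb in \<open>auto simp: less_imp_le\<close>)
  have Fd: "\<bar>F (k + j) c x - F k c x\<bar> \<le> 2 * e k - 2 * e (k + j)" if "c < N" "x \<in> S" for c x k j
  proof (induction j)
    case (Suc j)
    show ?case using Suc FS[OF that, of "k + j"] e2[of "k + j"] by simp
  qed simp
  have "convergent (\<lambda>k. F k c x)" if c: "c < N" "x \<in> S" for c x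
  proof (rule Cauchy_convergent, rule metric_CauchyI)
    fix r :: real assume "0 < r"
    then obtain M where M: "e M < r / 4" using order_tendstoD(2)[OF e_lim, of "r/4"]
      by (auto simp: eventually_sequentially)
    have "dist (F m c x) (F k c x) < r" if "m \<ge> M" "k \<ge> M" for m k
    proof -
      have "\<bar>F m c x - F M c x\<bar> \<le> 2 * e M" "\<bar>F k c x - F M c x\<bar> \<le> 2 * e M"
        using Fd[OF c, of M "m - M"] Fd[OF c, of M "k - M"] that e0[of m] e0[of k] by auto
      then show ?thesis using M by (simp add: dist_real_def)
    qed
    then show "\<exists>M. \<forall>m\<ge>M. \<forall>k\<ge>M. dist (F m c x) (F k c x) < r" by blast
  qed
  define h where "h = (\<lambda>c x. lim (\<lambda>k. F k c x))"
  have lim: "(\<lambda>k. F k c x) \<longlonglongrightarrow> h c x" if "c < N" "x \<in> S" for c x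
    unfolding h_def using \<open>\<And>c x. c < N \<Longrightarrow> x \<in> S \<Longrightarrow> convergent (\<lambda>k. F k c x)\<close>[OF that] by (simp add: convergent_LIMSEQ_iff)
  have hF: "\<bar>h c x - F k c x\<bar> \<le> 2 * e k" if c: "c < N" "x \<in> S" for c x k
  proof (rule LIMSEQ_le_const2)
    show "(\<lambda>m. \<bar>F m c x - F k c x\<bar>) \<longlonglongrightarrow> \<bar>h c x - F k c x\<bar>" by (intro tendsto_intros lim that)
    have "\<bar>F m c x - F k c x\<bar> \<le> 2 * e k" if "m \<ge> k" for m
      using Fd[OF c, of k "m - k"] that e0[of m] by auto
    then show "\<exists>M. \<forall>m\<ge>M. \<bar>F m c x - F k c x\<bar> \<le> 2 * e k" by blast
  qed
  show ?thesis
  proof (intro exI[of _ h] conjI allI impI ballI)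
    fix c assume "c < 2*n+1"
    then have c: "c < N" by (simp add: N_def)
    have "uniform_limit S (\<lambda>k. F k c) (h c) sequentially"
    proof (rule uniform_limitI)
      fix r :: real assume "0 < r"
      then have "\<forall>\<^sub>F k in sequentially. e k < r / 2" using order_tendstoD(2)[OF e_lim, of "r/2"] by simp
      then show "\<forall>\<^sub>F k in sequentially. \<forall>x\<in>S. dist (F k c x) (h c x) < r"
      proof eventually_elim
        case (elim k)
        show ?case
        proof
          fix x assume "x \<in> S"
          then show "dist (F k c x) (h c x) < r" using hF[OF c, of x k] elim by (simp add: dist_real_def abs_minus_commute)
        qed
      qed
    qed
    moreover have "\<forall>\<^sub>F k in sequentially. continuous_on S (F k c)" using Fc[OF c] by simp
    ultimately show "continuous_on S (h c)" by (intro uniform_limit_theorem) auto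
  next
    fix x y assume xy: "x \<in> S" "y \<in> S" "\<forall>c<2*n+1. h c x = h c y"
    show "x = y"
    proof (rule ccontr)
      assume "x \<noteq> y"
      then have "0 < dist x y" by simp
      from order_tendstoD(2)[OF e_lim this] obtain k where "e k < dist x y"
        by (auto simp: eventually_sequentially)
      then obtain c where c: "c < N" "8 * e (Suc k) \<le> \<bar>F (Suc k) c x - F (Suc k) c y\<bar>" using sep[OF xy(1,2), of k] by auto
      have "h c x = h c y" using xy(3) c(1) by (simp add: N_def)
      then show False using c(2) hF[OF c(1) xy(1), of "Suc k"] hF[OF c(1) xy(2), of "Suc k"] e0[of "Suc k"] by linarith
    qed
  qed
qed

section \<open>Passage from an abstract space to a metric type\<close>

lemma compact_metrizable_imp_homeomorphic_compact:
  assumes "compact_space X" "metrizable_space X"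
  shows "\<exists>S :: (nat \<Rightarrow> real) set. compact S \<and> X homeomorphic_space top_of_set S"
proof -
  obtain M d where Md: "Metric_space M d" "X = Metric_space.mtopology M d"
    using assms(2) unfolding metrizable_space_def by auto
  interpret Metric_space M d by fact
  show ?thesis
  proof (cases "M = {}")
    case True
    have "topspace X = M" unfolding Md(2) by (rule topspace_mtopology)
    then have "X = trivial_topology" using True by simp
    then show ?thesis
      by (intro exI[of _ "{}"]) (simp add: homeomorphic_empty_space_eq subtopology_trivial_iff)
  next
    case False
    have "mtotally_bounded M"
      using assms(1) unfolding Md(2) compact_space_eq_mcomplete_mtotally_bounded by (rule conjunct2)
    then have "\<exists>K. finite K \<and> K \<subseteq> M \<and> M \<subseteq> (\<Union>x\<in>K. mball x (1 / real (Suc n)))" for n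
      unfolding mtotally_bounded_def by simp
    then obtain K where K: "\<And>n. finite (K n)" "\<And>n. K n \<subseteq> M" "\<And>n. M \<subseteq> (\<Union>x\<in>K n. mball x (1 / real (Suc n)))"
      by metis
    define D where "D = (\<Union>n. K n)"
    have cD: "countable D" unfolding D_def using K(1) by (auto intro: countable_finite)
    have "D \<noteq> {}" using False K(3)[of 0] unfolding D_def by auto
    define a where "a = from_nat_into D"
    have aM: "a n \<in> M" for n
      using from_nat_into[OF \<open>D \<noteq> {}\<close>, of n] K(2) unfolding a_def D_def by auto
    have aD: "\<exists>n. a n = x" if "x \<in> D" for x
      using from_nat_into_surj[OF cD that] by (simp add: a_def)
    \<comment> \<open>Distances to a countable dense sequence separate points. The copy of
      \<open>X\<close> in \<open>nat \<Rightarrow> real\<close> makes the preceding results, stated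
      for sets in a metric type, applicable.\<close>
    define f where "f = (\<lambda>x n. d (a n) x)"
    have "continuous_map X euclideanreal (\<lambda>x. f x n)" for n
    proof -
      have "continuous_map X euclideanreal (\<lambda>x. mdist (metric (M,d)) (a n) x)"
        using aM Md(2) by (intro continuous_map_mdist) auto
      then show ?thesis by (simp add: f_def)
    qed
    then have "continuous_map X (product_topology (\<lambda>_. euclidean) UNIV) f"
      unfolding continuous_map_componentwise_UNIV by simp
    then have cf: "continuous_map X euclidean f" by (simp add: euclidean_product_topology)
    have inj: "inj_on f (topspace X)"
    proof (rule inj_onI, rule ccontr)
      fix x y assume xy: "x \<in> topspace X" "y \<in> topspace X" "f x = f y" "x \<noteq> y"
      then have M: "x \<in> M" "y \<in> M" using Md(2) by auto
      then have "0 < d x y" using xy(4) by simp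
      then obtain n where n: "1 / real (Suc n) < d x y / 2" using nat_approx_posE[of "d x y / 2"] by auto
      then obtain z where z: "z \<in> K n" "x \<in> mball z (1 / real (Suc n))" using K(3)[of n] M(1) by auto
      then have "z \<in> D" by (auto simp: D_def)
      then obtain k where k: "a k = z" using aD by auto
      then have "d z x = d z y" using fun_cong[OF xy(3), of k] by (simp add: f_def)
      moreover have "d z x < d x y / 2" using z n by auto
      moreover have "d x y \<le> d z x + d z y" using M z K(2) triangle''[of x z y] by auto
      ultimately show False by simp
    qed
    define S where "S = f ` topspace X"
    have "continuous_map X (top_of_set S) f"
      using cf by (simp add: S_def continuous_map_in_subtopology)
    then have "homeomorphic_map X (top_of_set S) f"
      using assms(1) inj by (intro continuous_imp_homeomorphic_map) (auto simp: S_def Hausdorff_space_subtopology)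
    moreover have "compact S"
      using image_compactin[OF _ cf, of "topspace X"] assms(1) by (simp add: S_def compact_space_def)
    ultimately show ?thesis using homeomorphic_map_imp_homeomorphic_space by blast
  qed
qed

theorem finite_dimensional_injection:
  assumes X: "compact_space X" "metrizable_space X" and dim: "finite_dimensional X"
  obtains N :: nat and h :: "nat \<Rightarrow> 'a \<Rightarrow> real" where "0 < N" "\<And>c. c < N \<Longrightarrow> continuous_map X euclideanreal (h c)"
     "\<And>x y. x \<in> topspace X \<Longrightarrow> y \<in> topspace X \<Longrightarrow> (\<And>c. c < N \<Longrightarrow> h c x = h c y) \<Longrightarrow> x = y"
proof -
  obtain S :: "(nat \<Rightarrow> real) set" where S: "compact S" "X homeomorphic_space top_of_set S"
    using compact_metrizable_imp_homeomorphic_compact[OF X] by blast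
  obtain k where k: "X dim_le k" using dim by (auto simp: finite_dimensional_def)
  have "X dim_le (int (nat (k + 1)) - 1)"
    using dimension_le_mono[OF k] dimension_le_bound[OF k] by simp
  then have "top_of_set S dim_le (int (nat (k + 1)) - 1)"
    using homeomorphic_space_dimension_le[OF S(2)] by simp
  then have "shrinkable_to_order (nat (k+1)) S" using S(1) by (intro dim_le_imp_shrinkable_to_order)
  from shrinkable_to_order_imp_injection[OF S(1) this] obtain g :: "nat \<Rightarrow> (nat \<Rightarrow> real) \<Rightarrow> real"
    where g: "\<forall>c<2*nat (k+1)+1. continuous_on S (g c)"
     "\<forall>x\<in>S. \<forall>y\<in>S. (\<forall>c<2*nat (k+1)+1. g c x = g c y) \<longrightarrow> x = y" by (elim exE conjE)
  obtain f where f: "homeomorphic_map X (top_of_set S) f" using S(2) homeomorphic_space by blast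
  have fc: "continuous_map X (top_of_set S) f" and fi: "inj_on f (topspace X)" and fS: "f ` topspace X = S"
    using f homeomorphic_imp_continuous_map homeomorphic_imp_injective_map homeomorphic_imp_surjective_map by fastforce+
  show thesis
  proof (rule that[of "2*nat (k+1)+1" "\<lambda>c x. g c (f x)"])
    fix c assume "c < 2*nat (k+1)+1"
    then have "continuous_map (top_of_set S) euclideanreal (g c)" using g(1) by simp
    from continuous_map_compose[OF fc this]
    show "continuous_map X euclideanreal (\<lambda>x. g c (f x))" by (simp add: o_def)
  next
    fix x y assume xy: "x \<in> topspace X" "y \<in> topspace X" "\<And>c. c < 2*nat (k+1)+1 \<Longrightarrow> g c (f x) = g c (f y)"
    then have "f x = f y" using g(2)[rule_format, of "f x" "f y"] fS by blast
    then show "x = y" using fi xy by (auto dest: inj_onD)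
  qed simp
qed

section \<open>Coding a clopen zero-dimensional set\<close>

lemma compact_metrizable_imp_second_countable:
  assumes "compact_space X" "metrizable_space X"
  shows "second_countable X"
proof -
  obtain S :: "(nat \<Rightarrow> real) set" where S: "compact S" "X homeomorphic_space top_of_set S"
    using compact_metrizable_imp_homeomorphic_compact[OF assms] by blast
  obtain B :: "(nat \<Rightarrow> real) set set" where B: "countable B" "topological_basis B"
    using ex_countable_basis by blast
  have "second_countable (euclidean :: (nat \<Rightarrow> real) topology)"
    unfolding second_countable_def
  proof (intro exI[of _ B] conjI ballI allI impI)
    fix U and x :: "nat \<Rightarrow> real" assume "openin euclidean U \<and> x \<in> U"
    then show "\<exists>V\<in>B. x \<in> V \<and> V \<subseteq> U" using B(2) by (metis open_openin topological_basisE)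
  qed (use B in \<open>auto simp: topological_basis_open\<close>)
  then show ?thesis
    using homeomorphic_space_second_countability[OF S(2)] second_countable_subtopology by blast
qed

text \<open>A set clopen in \<open>Z\<close> need not be closed in \<open>X\<close>. It is when
  chosen inside a closed subset \<open>C\<close> of \<open>X\<close> that lies in \<open>Z\<close>,
  because then its trace on \<open>C\<close> is the whole set.\<close>

lemma clopen_base_of_open_subspace:
  assumes X: "compact_space X" "Hausdorff_space X" and Z: "openin X Z" "subtopology X Z dim_le 0"
    and V: "openin X V" "z \<in> V" "z \<in> Z"
  shows "\<exists>U. openin X U \<and> closedin X U \<and> z \<in> U \<and> U \<subseteq> V \<inter> Z"
proof -
  have "neighbourhood_base_of (closedin X) X"
    using X by (simp add: neighbourhood_base_of_closedin compact_Hausdorff_imp_regular_space)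
  moreover have "openin X (V \<inter> Z)" "z \<in> V \<inter> Z" "z \<in> topspace X" using V Z openin_subset by auto
  ultimately obtain W C where W: "openin X W" "closedin X C" "z \<in> W" "W \<subseteq> C" "C \<subseteq> V \<inter> Z"
    unfolding neighbourhood_base_of_def neighbourhood_base_at_def by metis
  have "W \<subseteq> Z" using W by auto
  have "openin (subtopology X Z) W" using W \<open>W \<subseteq> Z\<close> by (simp add: openin_subset_topspace_eq openin_subtopology) (metis inf.absorb1)
  moreover have "neighbourhood_base_of (\<lambda>U. closedin (subtopology X Z) U \<and> openin (subtopology X Z) U) (subtopology X Z)"
    using Z(2) dimension_le_0_neighbourhood_base_of_clopen by blast
  moreover have "z \<in> topspace (subtopology X Z)" using V \<open>z \<in> topspace X\<close> by simp
  ultimately obtain U where U: "closedin (subtopology X Z) U" "openin (subtopology X Z) U" "z \<in> U" "U \<subseteq> W"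
    using W(3) unfolding neighbourhood_base_of_def neighbourhood_base_at_def by (metis subsetD)
  have "openin X U" using U(2) Z(1) by (rule openin_trans_full)
  moreover have "closedin X U"
  proof -
    obtain F where F: "closedin X F" "U = F \<inter> Z" using U(1) by (auto simp: closedin_subtopology)
    then have "U = F \<inter> C" using U(4) W by auto
    then show ?thesis using F(1) W(2) by auto
  qed
  moreover have "U \<subseteq> V \<inter> Z" using U(4) W by auto
  ultimately show ?thesis using U(3) by blast
qed

text \<open>The exceptional points are covered by those sets of a countable base that meet
  \<open>A\<close> in a countable set.\<close>

lemma uncountable_condensation_points:
  assumes "second_countable X" "A \<subseteq> topspace X" "uncountable A"
  shows "uncountable {p \<in> A. \<forall>V. openin X V \<longrightarrow> p \<in> V \<longrightarrow> uncountable (V \<inter> A)}"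
proof -
  obtain \<B> where B: "countable \<B>" "\<And>U x. openin X U \<Longrightarrow> x \<in> U \<Longrightarrow> \<exists>V \<in> \<B>. x \<in> V \<and> V \<subseteq> U"
    using assms(1) unfolding second_countable_def by auto
  define E where "E = (\<Union>V\<in>{V\<in>\<B>. countable (V \<inter> A)}. V \<inter> A)"
  have "countable E" unfolding E_def using B(1) by (intro countable_UN) auto
  then have "uncountable (A - E)" using assms(3) uncountable_minus_countable by blast
  moreover have "A - E \<subseteq> {p \<in> A. \<forall>V. openin X V \<longrightarrow> p \<in> V \<longrightarrow> uncountable (V \<inter> A)}"
  proof safe
    fix p V assume p: "p \<in> A" "p \<notin> E" "openin X V" "p \<in> V" "countable (V \<inter> A)"
    obtain V' where V': "V' \<in> \<B>" "p \<in> V'" "V' \<subseteq> V" using B(2) p by blast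
    have "countable (V' \<inter> A)" using p(5) V'(3) by (meson Int_mono countable_subset order_refl)
    then have "p \<in> E" unfolding E_def using V' p by auto
    then show False using p by simp
  qed
  ultimately show ?thesis using countable_subset by blast
qed

definition uncountable_clopen :: "'a topology \<Rightarrow> 'a set \<Rightarrow> bool" where
  "uncountable_clopen X A \<longleftrightarrow> openin X A \<and> closedin X A \<and> uncountable A"

lemma uncountable_obtain3:
  assumes "uncountable P"
  obtains p q s where "p \<in> P" "q \<in> P" "s \<in> P" "p \<noteq> q" "p \<noteq> s" "q \<noteq> s"
proof -
  have "infinite P" using assms countable_finite by blast
  then obtain T where "T \<subseteq> P" "finite T" "card T = 3" using infinite_arbitrarily_large by blast
  then show thesis using that by (auto simp: card_3_iff)
qed

text \<open>Three condensation points \<open>p\<close>, \<open>q\<close>, \<open>s\<close> lie in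
  disjoint clopen pieces, all uncountable. The first two pieces are cut down to an uncountable half
  on one side of \<open>B\<close>; the remainder still contains the third and is the room for points
  that exit.\<close>

lemma uncountable_clopen_split:
  assumes X: "compact_space X" "Hausdorff_space X" "second_countable X" and Z: "openin X Z" "subtopology X Z dim_le 0"
    and A: "uncountable_clopen X A" "A \<subseteq> Z" and B: "openin X B" "closedin X B"
  shows "\<exists>A0 A1. A0 \<subseteq> A \<and> A1 \<subseteq> A \<and> A0 \<inter> A1 = {} \<and> uncountable_clopen X A0 \<and> uncountable_clopen X A1 \<and>
     uncountable_clopen X (A - A0 - A1) \<and> (A0 \<subseteq> B \<or> A0 \<inter> B = {}) \<and> (A1 \<subseteq> B \<or> A1 \<inter> B = {})"
proof -
  have A': "openin X A" "closedin X A" "uncountable A" "A \<subseteq> topspace X"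
    using A(1) openin_subset by (auto simp: uncountable_clopen_def)
  define P where "P = {p \<in> A. \<forall>V. openin X V \<longrightarrow> p \<in> V \<longrightarrow> uncountable (V \<inter> A)}"
  have "uncountable P" unfolding P_def using X(3) A' by (intro uncountable_condensation_points)
  then obtain p q s where pqs: "p \<in> P" "q \<in> P" "s \<in> P" "p \<noteq> q" "p \<noteq> s" "q \<noteq> s" by (rule uncountable_obtain3)
  then have inA: "p \<in> A" "q \<in> A" "s \<in> A" by (auto simp: P_def)
  have fin: "closedin X T" if "finite T" "T \<subseteq> A" for T
    using X(2) that A'(4) by (meson closedin_Hausdorff_finite order_trans)
  have "openin X (A - {q,s})" using A'(1) fin inA by (intro openin_diff) auto
  moreover have "p \<in> A - {q,s}" "p \<in> Z" using pqs inA A(2) by auto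
  ultimately obtain C where C: "openin X C" "closedin X C" "p \<in> C" "C \<subseteq> (A - {q,s}) \<inter> Z"
    using clopen_base_of_open_subspace[OF X(1,2) Z] by blast
  have "openin X (A - C - {s})" using A'(1) fin inA C(2) by (intro openin_diff) auto
  moreover have "q \<in> A - C - {s}" "q \<in> Z" using pqs inA A(2) C(4) by auto
  ultimately obtain E where E: "openin X E" "closedin X E" "q \<in> E" "E \<subseteq> (A - C - {s}) \<inter> Z"
    using clopen_base_of_open_subspace[OF X(1,2) Z] by blast
  have unc: "uncountable (V \<inter> A)" if "x \<in> P" "openin X V" "x \<in> V" for x V using that by (auto simp: P_def)
  have "C \<inter> A = C" "E \<inter> A = E" "(A - C - E) \<inter> A = A - C - E" using C E by auto
  then have u: "uncountable C" "uncountable E" "uncountable (A - C - E)"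
  proof -
    show "uncountable C" using unc[OF pqs(1) C(1,3)] \<open>C \<inter> A = C\<close> by simp
    show "uncountable E" using unc[OF pqs(2) E(1,3)] \<open>E \<inter> A = E\<close> by simp
    have "openin X (A - C - E)" using A'(1) C(2) E(2) by (intro openin_diff)
    moreover have "s \<in> A - C - E" using inA C(4) E(4) by auto
    ultimately show "uncountable (A - C - E)" using unc[OF pqs(3)] \<open>(A - C - E) \<inter> A = A - C - E\<close> by metis
  qed
  have half: "\<exists>C'. C' \<subseteq> C \<and> uncountable_clopen X C' \<and> (C' \<subseteq> B \<or> C' \<inter> B = {})"
    if "openin X C" "closedin X C" "uncountable C" for C
  proof (cases "countable (C \<inter> B)")
    case True
    have "C = (C \<inter> B) \<union> (C - B)" by auto
    then have "uncountable (C - B)" using True that(3) by (metis countable_Un)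
    then show ?thesis using that B by (intro exI[of _ "C - B"]) (auto simp: uncountable_clopen_def)
  next
    case False
    then show ?thesis using that B by (intro exI[of _ "C \<inter> B"]) (auto simp: uncountable_clopen_def)
  qed
  obtain A0 where A0: "A0 \<subseteq> C" "uncountable_clopen X A0" "A0 \<subseteq> B \<or> A0 \<inter> B = {}" using half[OF C(1,2) u(1)] by blast
  obtain A1 where A1: "A1 \<subseteq> E" "uncountable_clopen X A1" "A1 \<subseteq> B \<or> A1 \<inter> B = {}" using half[OF E(1,2) u(2)] by blast
  have "A - C - E \<subseteq> A - A0 - A1" using A0 A1 by auto
  then have "uncountable (A - A0 - A1)" using u(3) countable_subset by blast
  then have "uncountable_clopen X (A - A0 - A1)"
    using A' A0(2) A1(2) by (auto simp: uncountable_clopen_def)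
  moreover have "A0 \<subseteq> A" "A1 \<subseteq> A" "A0 \<inter> A1 = {}" using A0(1) A1(1) C(4) E(4) by auto
  ultimately show ?thesis using A0 A1 by blast
qed

text \<open>One clopen set is chosen for each pair of basic open sets that can be separated, so
  countably many suffice. The enumeration through \<open>prod_decode\<close> repeats each of them
  beyond every index; a code records membership in \<open>B j\<close> only from some index on, so a
  single occurrence would not do.\<close>

lemma separating_clopen_sequence:
  assumes X: "compact_space X" "Hausdorff_space X" "second_countable X" and Z: "openin X Z" "subtopology X Z dim_le 0"
  shows "\<exists>B :: nat \<Rightarrow> 'a set. (\<forall>n. openin X (B n) \<and> closedin X (B n)) \<and> (\<forall>m. \<exists>n\<ge>m. B n = topspace X) \<and>
    (\<forall>x\<in>Z. \<forall>y\<in>topspace X. x \<noteq> y \<longrightarrow> (\<forall>m. \<exists>n\<ge>m. x \<in> B n \<and> y \<notin> B n))"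
proof -
  obtain \<B> where B: "countable \<B>" "\<And>U x. openin X U \<Longrightarrow> x \<in> U \<Longrightarrow> \<exists>V \<in> \<B>. x \<in> V \<and> V \<subseteq> U"
    using X(3) unfolding second_countable_def by auto
  define Q where "Q = (\<lambda>p U. openin X U \<and> closedin X U \<and> fst p \<subseteq> U \<and> U \<inter> snd p = {})"
  define g where "g = (\<lambda>p. SOME U. Q p U)"
  define \<C> where "\<C> = insert (topspace X) (g ` {p \<in> \<B> \<times> \<B>. \<exists>U. Q p U})"
  have g: "Q p (g p)" if "\<exists>U. Q p U" for p unfolding g_def using that by (rule someI_ex)
  have cC: "countable \<C>" unfolding \<C>_def using B(1) by auto
  have "\<C> \<noteq> {}" by (simp add: \<C>_def)
  define e where "e = from_nat_into \<C>"
  have eC: "e n \<in> \<C>" for n using from_nat_into[OF \<open>\<C> \<noteq> {}\<close>] by (simp add: e_def)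
  have es: "\<exists>n. e n = C" if "C \<in> \<C>" for C using from_nat_into_surj[OF cC that] by (simp add: e_def)
  have clop: "openin X C \<and> closedin X C" if "C \<in> \<C>" for C
    using that g by (auto simp: \<C>_def Q_def)
  have rep: "\<exists>n\<ge>m. e (fst (prod_decode n)) = C" if C: "C \<in> \<C>" for C m
  proof -
    obtain k where k: "e k = C" using es[OF C] by auto
    have "m \<le> prod_encode (k, m)" by (rule le_prod_encode_2)
    then show ?thesis using k by (intro exI[of _ "prod_encode (k, m)"]) simp
  qed
  show ?thesis
  proof (intro exI[of _ "\<lambda>n. e (fst (prod_decode n))"] conjI allI ballI impI)
    show "openin X (e (fst (prod_decode n)))" "closedin X (e (fst (prod_decode n)))" for n
      using clop eC by auto
    show "\<exists>n\<ge>m. e (fst (prod_decode n)) = topspace X" for m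
      by (rule rep) (simp add: \<C>_def)
    fix x y m assume xy: "x \<in> Z" "y \<in> topspace X" "x \<noteq> y"
    have xt: "x \<in> topspace X" using xy(1) openin_subset[OF Z(1)] by auto
    have "openin X (topspace X - {y})" using X(2) xy(2) by (meson closedin_Hausdorff_sing_eq openin_diff openin_topspace)
    then obtain U where U: "openin X U" "closedin X U" "x \<in> U" "U \<subseteq> (topspace X - {y}) \<inter> Z"
      using clopen_base_of_open_subspace[OF X(1,2) Z, of "topspace X - {y}" x] xy xt by auto
    obtain V where V: "V \<in> \<B>" "x \<in> V" "V \<subseteq> U" using B(2)[OF U(1,3)] by auto
    have "openin X (topspace X - U)" "y \<in> topspace X - U" using U xy(2) by auto
    then obtain W where W: "W \<in> \<B>" "y \<in> W" "W \<subseteq> topspace X - U" using B(2) by blast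
    have ex: "\<exists>U. Q (V,W) U" using U V W unfolding Q_def by (intro exI[of _ U]) auto
    then have "g (V,W) \<in> \<C>" using V W unfolding \<C>_def by auto
    then obtain n where "n \<ge> m" "e (fst (prod_decode n)) = g (V,W)" using rep by blast
    moreover have "x \<in> g (V,W)" "y \<notin> g (V,W)" using g[OF ex] V(2) W(2) by (auto simp: Q_def)
    ultimately show "\<exists>n\<ge>m. x \<in> e (fst (prod_decode n)) \<and> y \<notin> e (fst (prod_decode n))" by auto
  qed
qed

lemma position_cases: "n < d \<or> n = d \<or> n = Suc d \<or> (\<exists>t. n = d + 2 + t)" for n d :: nat
proof (cases "d + 2 \<le> n")
  case True
  then show ?thesis using le_Suc_ex by blast
qed linarith

section \<open>A binary tree of clopen sets with exits\<close>

locale clopen_tree =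
  fixes X :: "'a topology" and K :: "'a set" and B :: "nat \<Rightarrow> 'a set"
  assumes compact: "compact_space X"
    and K: "uncountable_clopen X K"
    and split: "\<And>A n. uncountable_clopen X A \<Longrightarrow> A \<subseteq> K \<Longrightarrow>
      \<exists>A0 A1. A0 \<subseteq> A \<and> A1 \<subseteq> A \<and> A0 \<inter> A1 = {} \<and> uncountable_clopen X A0 \<and> uncountable_clopen X A1 \<and>
        uncountable_clopen X (A - A0 - A1) \<and> (A0 \<subseteq> B n \<or> A0 \<inter> B n = {}) \<and> (A1 \<subseteq> B n \<or> A1 \<inter> B n = {})"
    and B: "\<And>n. openin X (B n)" "\<And>n. closedin X (B n)"
    and B_topspace: "\<And>m. \<exists>n\<ge>m. B n = topspace X"
    and B_sep: "\<And>x y m. x \<in> K \<Longrightarrow> y \<in> K \<Longrightarrow> x \<noteq> y \<Longrightarrow> \<exists>n\<ge>m. x \<in> B n \<and> y \<notin> B n"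
begin

definition good :: "'a set \<Rightarrow> bool" where
  "good A \<longleftrightarrow> uncountable_clopen X A \<and> A \<subseteq> K"

definition parts :: "'a set \<Rightarrow> nat \<Rightarrow> 'a set \<times> 'a set" where
  "parts A n = (SOME p. fst p \<subseteq> A \<and> snd p \<subseteq> A \<and> fst p \<inter> snd p = {} \<and> good (fst p) \<and> good (snd p) \<and>
     good (A - fst p - snd p) \<and> (fst p \<subseteq> B n \<or> fst p \<inter> B n = {}) \<and> (snd p \<subseteq> B n \<or> snd p \<inter> B n = {}))"

lemma parts:
  assumes "good A"
  shows "fst (parts A n) \<subseteq> A" "snd (parts A n) \<subseteq> A" "fst (parts A n) \<inter> snd (parts A n) = {}"
    "good (fst (parts A n))" "good (snd (parts A n))" "good (A - fst (parts A n) - snd (parts A n))"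
    "fst (parts A n) \<subseteq> B n \<or> fst (parts A n) \<inter> B n = {}" "snd (parts A n) \<subseteq> B n \<or> snd (parts A n) \<inter> B n = {}"
proof -
  obtain A0 A1 where "A0 \<subseteq> A \<and> A1 \<subseteq> A \<and> A0 \<inter> A1 = {} \<and> uncountable_clopen X A0 \<and> uncountable_clopen X A1 \<and>
        uncountable_clopen X (A - A0 - A1) \<and> (A0 \<subseteq> B n \<or> A0 \<inter> B n = {}) \<and> (A1 \<subseteq> B n \<or> A1 \<inter> B n = {})"
    using split[of A n] assms unfolding good_def by (elim conjE exE impE) auto
  then have "\<exists>p. fst p \<subseteq> A \<and> snd p \<subseteq> A \<and> fst p \<inter> snd p = {} \<and> good (fst p) \<and> good (snd p) \<and>
     good (A - fst p - snd p) \<and> (fst p \<subseteq> B n \<or> fst p \<inter> B n = {}) \<and> (snd p \<subseteq> B n \<or> snd p \<inter> B n = {})"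
    using assms by (intro exI[of _ "(A0,A1)"]) (auto simp: good_def)
  from someI_ex[OF this] show "fst (parts A n) \<subseteq> A" "snd (parts A n) \<subseteq> A" "fst (parts A n) \<inter> snd (parts A n) = {}"
    "good (fst (parts A n))" "good (snd (parts A n))" "good (A - fst (parts A n) - snd (parts A n))"
    "fst (parts A n) \<subseteq> B n \<or> fst (parts A n) \<inter> B n = {}" "snd (parts A n) \<subseteq> B n \<or> snd (parts A n) \<inter> B n = {}"
    unfolding parts_def by blast+
qed

text \<open>Level \<open>n\<close> is split with respect to \<open>B n\<close>, so a node of level
  \<open>n + 1\<close> never crosses \<open>B n\<close>. Any nonzero letter selects the second part;
  uniqueness therefore needs letters below 2.\<close>

primrec node :: "'a set \<Rightarrow> (nat \<Rightarrow> nat) \<Rightarrow> nat \<Rightarrow> 'a set" where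
  "node A y 0 = A"
| "node A y (Suc n) = (if y n = 0 then fst (parts (node A y n) n) else snd (parts (node A y n) n))"

lemma node_good: "good A \<Longrightarrow> good (node A y n)"
  by (induction n) (simp_all add: parts)

lemma node_cong: "(\<And>k. k < n \<Longrightarrow> y k = y' k) \<Longrightarrow> node A y n = node A y' n"
  by (induction n) simp_all

lemma node_Suc_subset: "good A \<Longrightarrow> node A y (Suc n) \<subseteq> node A y n"
  using parts(1,2)[OF node_good] by simp

lemma node_antimono: "good A \<Longrightarrow> m \<le> n \<Longrightarrow> node A y n \<subseteq> node A y m"
  using lift_Suc_antimono_le[of "node A y"] node_Suc_subset by blast

lemma node_unique:
  assumes "good A" "x \<in> node A y n" "x \<in> node A y' n" "\<And>k. k < n \<Longrightarrow> y k < 2" "\<And>k. k < n \<Longrightarrow> y' k < 2" "k < n"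
  shows "y k = y' k"
  using assms(2-)
proof (induction n arbitrary: k)
  case (Suc n)
  have IH: "y k = y' k" if "k < n" for k
    using Suc.IH[OF _ _ _ _ that] Suc.prems node_Suc_subset[OF assms(1)] by (meson less_Suc_eq subsetD)
  then have eq: "node A y n = node A y' n" by (rule node_cong)
  have "y n < 2" "y' n < 2" using Suc.prems by auto
  moreover have "(y n = 0) = (y' n = 0)"
    using Suc.prems(1,2) parts(3)[OF node_good[OF assms(1)], of y n n] eq by (auto split: if_splits)
  ultimately have "y n = y' n" by linarith
  then show ?case using IH Suc.prems(5) less_Suc_eq by auto
qed simp

text \<open>A branch is chosen afresh for every \<open>n\<close>; \<open>node_unique\<close> makes
  the choices coherent. The value 2 marks points outside all nodes of level \<open>n + 1\<close>,
  including points outside \<open>A\<close>.\<close>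

definition address :: "'a set \<Rightarrow> 'a \<Rightarrow> nat \<Rightarrow> nat" where
  "address A x n = (if \<exists>y. (\<forall>k\<le>n. y k < 2) \<and> x \<in> node A y (Suc n)
     then (SOME y. (\<forall>k\<le>n. y k < (2::nat)) \<and> x \<in> node A y (Suc n)) n else 2)"

lemma address_node:
  assumes "good A" "x \<in> node A y n" "\<And>k. k < n \<Longrightarrow> y k < 2" "k < n"
  shows "address A x k = y k"
proof -
  define P where "P = (\<lambda>y. (\<forall>j\<le>k. y j < (2::nat)) \<and> x \<in> node A y (Suc k))"
  have "P y" unfolding P_def using assms node_antimono[OF assms(1), of "Suc k" n y] by auto
  then have "P (SOME y. P y)" by (rule someI[of P])
  then have "(SOME y. P y) k = y k"
    using node_unique[OF assms(1), of x "SOME y. P y" "Suc k" y k] \<open>P y\<close> unfolding P_def by auto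
  then show ?thesis using \<open>P y\<close> unfolding address_def P_def[symmetric] by auto
qed

lemma address_lt2:
  assumes "good A" "address A x n < 2"
  shows "x \<in> node A (address A x) (Suc n)" "\<And>k. k \<le> n \<Longrightarrow> address A x k < 2"
proof -
  obtain y where y: "\<forall>k\<le>n. y k < 2" "x \<in> node A y (Suc n)"
    using assms(2) unfolding address_def by (auto split: if_splits)
  have eq: "address A x k = y k" if "k < Suc n" for k
    using address_node[OF assms(1) y(2) _ that] y(1) by auto
  then show "x \<in> node A (address A x) (Suc n)" using y(2) node_cong[of "Suc n" "address A x" y A] by simp
  show "address A x k < 2" if "k \<le> n" for k using eq[of k] y(1) that by auto
qed

lemma address_le: "good A \<Longrightarrow> address A x n \<le> 2"
proof (cases "\<exists>y. (\<forall>k\<le>n. y k < 2) \<and> x \<in> node A y (Suc n)")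
  case True
  assume "good A"
  from True obtain y where "\<forall>k\<le>n. y k < 2" "x \<in> node A y (Suc n)" by auto
  then show ?thesis using address_node[OF \<open>good A\<close>, of x y "Suc n" n] by auto
next
  case False
  then have "address A x n = 2" unfolding address_def by (rule if_not_P)
  then show ?thesis by simp
qed

lemma address_exit: "good A \<Longrightarrow> address A x m = 2 \<Longrightarrow> m \<le> n \<Longrightarrow> address A x n = 2"
  using address_lt2(2)[of A x n m] address_le[of A x n] by force

lemma address_cylinder:
  assumes "good A" "\<And>k. k < n \<Longrightarrow> y k < 2"
  shows "{x \<in> A. \<forall>k<n. address A x k = y k} = node A y n"
proof safe
  fix x assume x: "x \<in> A" "\<forall>k<n. address A x k = y k"
  show "x \<in> node A y n"
  proof (cases n)
    case (Suc m)
    then have "x \<in> node A (address A x) (Suc m)" using x assms(2) by (intro address_lt2(1)[OF assms(1)]) auto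
    then show ?thesis using node_cong[of n "address A x" y A] x Suc by simp
  qed (use x in simp)
next
  fix x assume x: "x \<in> node A y n"
  then show "x \<in> A" using node_antimono[OF assms(1), of 0 n y] by auto
  show "address A x k = y k" if "k < n" for k using address_node[OF assms(1) x assms(2) that] .
qed

lemma address_surj:
  assumes A: "good A" and y: "\<And>n. y n < 2"
  shows "\<exists>x\<in>A. address A x = y"
proof -
  have "(\<Inter>n. node A y n) \<noteq> {}"
  proof (rule compact_space_imp_nest[OF compact])
    fix n
    have "good (node A y n)" using A by (rule node_good)
    then show "closedin X (node A y n)" "node A y n \<noteq> {}" by (auto simp: good_def uncountable_clopen_def)
  next
    show "decseq (node A y)" using node_antimono[OF A] by (simp add: antimono_def)
  qed
  then obtain x where x: "\<And>n. x \<in> node A y n" by auto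
  have "address A x n = y n" for n using address_node[OF A x[of "Suc n"]] y by auto
  then show ?thesis using x[of 0] by auto
qed

text \<open>A binary address decides membership in every \<open>B n\<close>, and these sets separate
  the points of \<open>K\<close>.\<close>

lemma address_inj:
  assumes A: "good A" and x: "x \<in> A" "x' \<in> A" "\<And>n. address A x n < 2" "address A x = address A x'"
  shows "x = x'"
proof (rule ccontr)
  assume "x \<noteq> x'"
  then obtain n where n: "x \<in> B n" "x' \<notin> B n" using B_sep[of x x' 0] x A by (auto simp: good_def)
  have "x \<in> node A (address A x) (Suc n)" using address_lt2(1)[OF A x(3)] .
  moreover have "x' \<in> node A (address A x) (Suc n)" using address_lt2(1)[OF A, of x' n] x(3,4) by simp
  moreover have "node A (address A x) (Suc n) \<subseteq> B n \<or> node A (address A x) (Suc n) \<inter> B n = {}"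
    using parts(7,8)[OF node_good[OF A]] by simp
  ultimately show False using n by blast
qed

text \<open>These points form the third piece of the split at the node of \<open>w\<close>, which
  was kept uncountable and clopen so that a second tree can be grown in it.\<close>

lemma exit_good:
  assumes A: "good A" and w: "\<And>k. k < n \<Longrightarrow> w k < 2"
  shows "good {x \<in> A. (\<forall>k<n. address A x k = w k) \<and> address A x n = 2}"
proof -
  let ?N = "node A w n"
  have cyl: "x \<in> ?N \<longleftrightarrow> x \<in> A \<and> (\<forall>k<n. address A x k = w k)" for x
    using address_cylinder[of A n w, OF A w] by auto
  have "address A x n = 2 \<longleftrightarrow> x \<notin> fst (parts ?N n) \<and> x \<notin> snd (parts ?N n)" if x: "x \<in> ?N" for x
  proof -
    have *: "address A x n = i" if i: "i < 2" "x \<in> node A (w(n := i)) (Suc n)" for i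
    proof -
      have "(w(n := i)) k < 2" if "k < Suc n" for k using i w that by (auto simp: less_Suc_eq)
      then show ?thesis using address_node[OF A i(2), of n] by simp
    qed
    have eq: "node A (w(n := i)) n = ?N" for i by (rule node_cong) simp
    have 1: "address A x n = 0" if "x \<in> fst (parts ?N n)" using *[of 0] that eq[of 0] by simp
    have 2: "address A x n = 1" if "x \<in> snd (parts ?N n)" using *[of 1] that eq[of 1] by simp
    have 3: "x \<in> fst (parts ?N n) \<or> x \<in> snd (parts ?N n)" if "address A x n < 2"
    proof -
      have "x \<in> node A (address A x) (Suc n)" using A that by (rule address_lt2(1))
      moreover have "node A (address A x) n = ?N" using x cyl by (intro node_cong) auto
      ultimately show ?thesis by (auto split: if_splits)
    qed
    show ?thesis using 1 2 3 address_le[OF A, of x n] by fastforce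
  qed
  then have "{x \<in> A. (\<forall>k<n. address A x k = w k) \<and> address A x n = 2} = ?N - fst (parts ?N n) - snd (parts ?N n)"
    using cyl by auto
  then show ?thesis using parts(6)[OF node_good[OF A]] by simp
qed

text \<open>If the prefix is binary the set is a node. Otherwise everything after the first 2 is
  again 2, so the set is an exit piece.\<close>

lemma address_locally_constant:
  assumes A: "good A" and x0: "x0 \<in> A"
  shows "openin X {x \<in> A. \<forall>k<n. address A x k = address A x0 k}"
proof (cases "\<forall>k<n. address A x0 k < 2")
  case True
  then have "{x \<in> A. \<forall>k<n. address A x k = address A x0 k} = node A (address A x0) n"
    using A by (intro address_cylinder) auto
  then show ?thesis using node_good[OF A] by (simp add: good_def uncountable_clopen_def)
next
  case False
  then have ex: "\<exists>k. k < n \<and> address A x0 k = 2" using address_le[OF A, of x0] by (metis le_less)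
  define m where "m = (LEAST k. k < n \<and> address A x0 k = 2)"
  have m: "m < n" "address A x0 m = 2" using LeastI_ex[OF ex] by (auto simp: m_def)
  have lt: "address A x0 k < 2" if "k < m" for k
    using not_less_Least[of k "\<lambda>k. k < n \<and> address A x0 k = 2"] that m address_le[OF A, of x0 k] by (force simp: m_def)
  have "{x \<in> A. \<forall>k<n. address A x k = address A x0 k} = {x \<in> A. (\<forall>k<m. address A x k = address A x0 k) \<and> address A x m = 2}"
  proof safe
    fix x k assume "x \<in> A" "\<forall>k<m. address A x k = address A x0 k" "address A x m = 2" "k < n"
    then show "address A x k = address A x0 k"
      using address_exit[OF A, of x m k] address_exit[OF A, of x0 m k] m by (cases "k < m") auto
  qed (use m in auto)
  then show ?thesis using exit_good[OF A, of m "address A x0", OF lt] by (simp add: good_def uncountable_clopen_def)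
qed

section \<open>Exit depth, exit classes and codes\<close>

definition exits :: "'a \<Rightarrow> bool" where "exits x \<longleftrightarrow> (\<exists>j. address K x j = 2)"

definition depth :: "'a \<Rightarrow> nat" where "depth x = (LEAST j. address K x j = 2)"

definition exit_class :: "'a \<Rightarrow> 'a set" where
  "exit_class x = {x' \<in> K. address K x' = address K x}"

text \<open>
  The binary tree of clopen sets leaves room: at each node an uncountable clopen piece exits, and its
  points get address \<open>2\<close>. A point exiting at depth \<open>k\<close> after the word \<open>w\<close> is coded by \<open>w 2 0 z\<close>, where
  \<open>z\<close> carries at position \<open>2\<^bsup>k+1\<^esup> j\<close> the address in a second tree built in its exit class and at
  position \<open>2\<^sup>k (2 j + 1)\<close>, once the point has exited the second tree, its membership in \<open>B j\<close>.
  Every \<open>z\<close> supported on multiples of \<open>2\<^bsup>k+1\<^esup>\<close> occurs, and every \<open>z\<close> that occurs is supported on multiples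
  of \<open>2\<^sup>k\<close>; so dropping the first letter of a code is again a code.
\<close>

definition tail_code :: "'a \<Rightarrow> nat \<Rightarrow> nat" where
  "tail_code x t = (let r = address (exit_class x) x; k = depth x; j = t div 2 ^ Suc k in
     if 2 ^ Suc k dvd t then (if r j < 2 then r j else 0)
     else if 2 ^ k dvd t \<and> r j = 2 \<and> x \<in> B j then 1 else 0)"

definition code :: "'a \<Rightarrow> nat \<Rightarrow> nat" where
  "code x n = (if \<forall>j\<le>n. address K x j < 2 then address K x n
     else if n = depth x then 2 else if n = Suc (depth x) then 0 else tail_code x (n - depth x - 2))"

lemma good_K: "good K"
  using K by (simp add: good_def)

lemma depth:
  assumes "exits x"
  shows "address K x (depth x) = 2" "k < depth x \<Longrightarrow> address K x k < 2" "depth x \<le> k \<Longrightarrow> address K x k = 2"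
proof -
  show 2: "address K x (depth x) = 2" using assms unfolding exits_def depth_def by (rule LeastI_ex)
  show "address K x k = 2" if "depth x \<le> k" using address_exit[OF good_K 2 that] .
  show "address K x k < 2" if "k < depth x"
    using not_less_Least[of k "\<lambda>j. address K x j = 2"] that address_le[OF good_K, of x k] by (force simp: depth_def)
qed

lemma exits_cong: "address K x = address K x' \<Longrightarrow> exits x = exits x' \<and> depth x = depth x' \<and> exit_class x = exit_class x'"
  by (simp add: exits_def depth_def exit_class_def)

lemma exit_class_eq:
  assumes "exits x"
  shows "exit_class x = {x' \<in> K. (\<forall>k<depth x. address K x' k = address K x k) \<and> address K x' (depth x) = 2}"
proof safe
  fix x' assume "x' \<in> exit_class x"
  then have x': "x' \<in> K" "address K x' = address K x" by (auto simp: exit_class_def)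
  then show "x' \<in> K" "address K x' (depth x) = 2" "\<And>k. address K x' k = address K x k" using depth(1)[OF assms] by auto
next
  fix x' assume x': "x' \<in> K" "\<forall>k<depth x. address K x' k = address K x k" "address K x' (depth x) = 2"
  have "address K x' k = address K x k" for k
    using x'(2) address_exit[OF good_K x'(3)] depth(3)[OF assms] by (cases "k < depth x") auto
  then have "address K x' = address K x" by auto
  then show "x' \<in> exit_class x" using x'(1) by (simp add: exit_class_def)
qed

lemma exit_class_good: "exits x \<Longrightarrow> good (exit_class x)"
  unfolding exit_class_eq using depth(2) by (intro exit_good[OF good_K])

lemma exit_class_mem: "x' \<in> exit_class x \<Longrightarrow> x' \<in> K \<and> exits x' = exits x \<and> depth x' = depth x \<and> exit_class x' = exit_class x"
  using exits_cong[of x' x] by (auto simp: exit_class_def)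

lemma code_no_exit: "\<not> exits x \<Longrightarrow> code x = address K x"
proof -
  assume "\<not> exits x"
  then have "address K x j < 2" for j using address_le[OF good_K, of x j] unfolding exits_def by (metis le_neq_implies_less)
  then show ?thesis by (auto simp: code_def)
qed

lemma code_exit:
  assumes "exits x"
  shows "k < depth x \<Longrightarrow> code x k = address K x k" "code x (depth x) = 2" "code x (Suc (depth x)) = 0"
    "code x (depth x + 2 + t) = tail_code x t"
proof -
  show "code x k = address K x k" if "k < depth x"
    using depth(2)[OF assms] that by (auto simp: code_def)
  have no: "\<not> (\<forall>j\<le>n. address K x j < 2)" if "depth x \<le> n" for n
    using depth(1)[OF assms] that by (auto intro!: exI[of _ "depth x"])
  show "code x (depth x) = 2" "code x (Suc (depth x)) = 0" "code x (depth x + 2 + t) = tail_code x t"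
    using no by (simp_all add: code_def del: not_all)
qed

lemma tail_code_lt2: "tail_code x t < 2"
  by (simp add: tail_code_def Let_def)

lemma tail_code_main: "address (exit_class x) x j < 2 \<Longrightarrow> tail_code x (2 ^ Suc (depth x) * j) = address (exit_class x) x j"
  by (simp add: tail_code_def Let_def)

lemma tail_code_side: "tail_code x (2 ^ depth x * (2 * j + 1)) = (if address (exit_class x) x j = 2 \<and> x \<in> B j then 1 else 0)"
proof -
  have "\<not> 2 ^ Suc (depth x) dvd (2 ^ depth x * (2 * j + 1) :: nat)"
    by (simp only: power_Suc2 nat_mult_dvd_cancel_disj) simp
  moreover have "2 ^ depth x * (2 * j + 1) div 2 ^ Suc (depth x) = (2 * j + 1) div (2::nat)"
    unfolding power_Suc2 by (rule div_mult_mult1) simp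
  ultimately show ?thesis by (simp add: tail_code_def Let_def)
qed

lemma tail_code_zero: "\<not> 2 ^ depth x dvd t \<Longrightarrow> tail_code x t = 0"
proof -
  assume *: "\<not> 2 ^ depth x dvd t"
  then have "\<not> 2 ^ Suc (depth x) dvd t" by (metis dvd_trans le_imp_power_dvd le_SucI order_refl)
  then show ?thesis using * by (simp add: tail_code_def Let_def)
qed

lemma code_lt2_iff: "exits x \<Longrightarrow> code x k = 2 \<longleftrightarrow> k = depth x"
proof -
  assume ex: "exits x"
  consider "k < depth x" | "k = depth x" | "k = Suc (depth x)" | t where "k = depth x + 2 + t"
    using position_cases by blast
  then show ?thesis
  proof cases
    case 1
    then show ?thesis using code_exit(1)[OF ex 1] depth(2)[OF ex 1] by simp
  next
    case (4 t)
    then show ?thesis using code_exit(4)[OF ex, of t] tail_code_lt2[of x t] by simp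
  qed (use code_exit[OF ex] in auto)
qed

lemma code_le: "code x n \<le> 2"
  using address_le[OF good_K, of x n] tail_code_lt2[of x "n - depth x - 2"] by (auto simp: code_def)

text \<open>The position of the only letter 2 gives the depth, hence the address and the exit class.
  Inside the class, a point that stays in the second tree is recovered from its main positions, and
  two points that leave it are distinguished at a side position, as some \<open>B j\<close> with
  arbitrarily large \<open>j\<close> separates them.\<close>

lemma code_inj: "inj_on code K"
proof (rule inj_onI)
  fix x x' assume x: "x \<in> K" "x' \<in> K" "code x = code x'"
  have iff: "exits x \<longleftrightarrow> (\<exists>k. code x k = 2)" for x
    using code_no_exit[of x] code_lt2_iff[of x] unfolding exits_def by metis
  have ex: "exits x = exits x'" using iff x(3) by simp
  show "x = x'"
  proof (cases "exits x")
    case False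
    then have "address K x = address K x'" using code_no_exit ex x(3) by metis
    moreover have "address K x n < 2" for n
      using False address_le[OF good_K, of x n] unfolding exits_def by (metis le_neq_implies_less)
    ultimately show ?thesis using address_inj[OF good_K x(1,2)] by blast
  next
    case True
    then have ex': "exits x'" using ex by simp
    have d: "depth x = depth x'" using code_lt2_iff[OF True] code_lt2_iff[OF ex'] x(3) by metis
    have "address K x k = address K x' k" for k
    proof (cases "k < depth x")
      case k: True
      then show ?thesis using code_exit(1)[OF True] code_exit(1)[OF ex'] d x(3) by metis
    next
      case False
      then show ?thesis using depth(3)[OF True] depth(3)[OF ex'] d by simp
    qed
    then have aeq: "address K x = address K x'" by auto
    define D where "D = exit_class x"
    have D: "exit_class x' = D" "good D" "x \<in> D" "x' \<in> D"
      using exits_cong[OF aeq] exit_class_good[OF True] x aeq by (auto simp: D_def exit_class_def)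
    have t: "tail_code x t = tail_code x' t" for t
      using code_exit(4)[OF True, of t] code_exit(4)[OF ex', of t] d x(3) by simp
    have side: "(address D x j = 2 \<and> x \<in> B j) = (address D x' j = 2 \<and> x' \<in> B j)" for j
    proof -
      have "(if address D x j = 2 \<and> x \<in> B j then 1 else 0) = (if address D x' j = 2 \<and> x' \<in> B j then 1 else (0::nat))"
        using t[of "2 ^ depth x * (2 * j + 1)"] tail_code_side[of x j] tail_code_side[of x' j, folded d]
        unfolding D(1) D_def[symmetric] by simp
      then show ?thesis by (auto split: if_splits)
    qed
    have inB: "z \<in> B j" if "B j = topspace X" "z \<in> D" for z j
      using that D(2) K openin_subset[of X K] by (auto simp: good_def uncountable_clopen_def)
    have exiff: "(\<exists>m. \<forall>j\<ge>m. address D z j = 2) \<or> (\<forall>j. address D z j < 2)" for z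
    proof (cases "\<exists>m. address D z m = 2")
      case True
      then obtain m where "address D z m = 2" by auto
      then have "\<forall>j\<ge>m. address D z j = 2" using address_exit[OF D(2)] by blast
      then show ?thesis by blast
    next
      case False
      then show ?thesis using address_le[OF D(2), of z] by (metis le_neq_implies_less)
    qed
    \<comment> \<open>Leaving the second tree is visible in the code: infinitely many
      \<open>B j\<close> are the whole space, and after the exit such a \<open>j\<close> puts the
      letter 1 at its side position.\<close>
    have sym: "\<exists>m. \<forall>j\<ge>m. address D z' j = 2"
      if ex: "\<exists>m. \<forall>j\<ge>m. address D z j = 2" and zD: "z \<in> D"
        and side': "\<And>j. (address D z j = 2 \<and> z \<in> B j) = (address D z' j = 2 \<and> z' \<in> B j)" for z z'
    proof -
      obtain m where m: "\<forall>j\<ge>m. address D z j = 2" using ex by auto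
      obtain j where j: "j \<ge> m" "B j = topspace X" using B_topspace by blast
      then have "address D z' j = 2" using side'[of j] m inB[OF j(2) zD] by auto
      then show ?thesis using address_exit[OF D(2)] by blast
    qed
    show ?thesis
    proof (cases "\<forall>j. address D x j < 2")
      case nx: True
      have nx': "\<forall>j. address D x' j < 2"
      proof (rule ccontr)
        assume "\<not> ?thesis"
        then have "\<exists>m. \<forall>j\<ge>m. address D x' j = 2" using exiff[of x'] by auto
        then have "\<exists>m. \<forall>j\<ge>m. address D x j = 2" by (rule sym[OF _ D(4) side[symmetric]])
        then obtain m where "address D x m = 2" by auto
        then show False using spec[OF nx, of m] by simp
      qed
      have "address D x j = address D x' j" for j
        using t[of "2 ^ Suc (depth x) * j"] tail_code_main[of x j] tail_code_main[of x' j, folded d]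
          spec[OF nx, of j] spec[OF nx', of j] unfolding D(1) D_def[symmetric] by simp
      then have "address D x = address D x'" by auto
      then show ?thesis using address_inj[OF D(2-4)] nx by blast
    next
      case False
      then have ex: "\<exists>m. \<forall>j\<ge>m. address D x j = 2" using exiff[of x] by (elim disjE) simp_all
      then obtain m where m: "\<forall>j\<ge>m. address D x j = 2" by (elim exE)
      have "\<exists>m. \<forall>j\<ge>m. address D x' j = 2" by (rule sym[OF ex D(3) side])
      then obtain m' where m': "\<forall>j\<ge>m'. address D x' j = 2" by (elim exE)
      show ?thesis
      proof (rule ccontr)
        assume "x \<noteq> x'"
        then obtain j where j: "j \<ge> max m m'" "x \<in> B j" "x' \<notin> B j" using B_sep[OF x(1,2)] by blast
        have "address D x j = 2" "address D x' j = 2" using j(1) spec[OF m, of j] spec[OF m', of j] by auto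
        then show False using side[of j] j(2,3) by simp
      qed
    qed
  qed
qed

text \<open>A prefix of the code depends on finitely many letters of two addresses and on membership
  in finitely many clopen sets \<open>B j\<close>.\<close>

lemma code_prefix_continuous:
  assumes x: "x \<in> K"
  shows "\<exists>U. openin X U \<and> x \<in> U \<and> U \<subseteq> K \<and> (\<forall>y\<in>U. \<forall>k<n. code y k = code x k)"
proof (cases "exits x")
  case False
  define U where "U = {y \<in> K. \<forall>k<n. address K y k = address K x k}"
  have "openin X U" unfolding U_def by (rule address_locally_constant[OF good_K x])
  moreover have "code y k = code x k" if "y \<in> U" "k < n" for y k
  proof -
    have "address K x j < 2" for j
      using False address_le[OF good_K, of x j] unfolding exits_def by (metis le_neq_implies_less)
    moreover have "address K y j = address K x j" if "j \<le> k" for j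
      using \<open>y \<in> U\<close> \<open>k < n\<close> that by (simp add: U_def)
    ultimately show ?thesis by (simp add: code_def)
  qed
  moreover have "x \<in> U" "U \<subseteq> K" using x by (auto simp: U_def)
  ultimately show ?thesis by (intro exI[of _ U] conjI ballI allI impI)
next
  case True
  define D where "D = exit_class x"
  have D: "good D" "x \<in> D" using exit_class_good[OF True] x by (auto simp: D_def exit_class_def)
  define G where "G = (\<lambda>j. if x \<in> B j then B j else topspace X - B j)"
  define U where "U = {y \<in> D. \<forall>k<n. address D y k = address D x k} \<inter> (\<Inter>j\<in>{..<n}. G j)"
  have xX: "x \<in> topspace X" using x openin_subset[of X K] K by (auto simp: uncountable_clopen_def)
  have G: "openin X (G j)" for j using B by (auto simp: G_def)
  have "openin X U"
  \<comment> \<open>The intersection over no index is the whole type, which need not be open in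
    \<open>X\<close>.\<close>
  proof (cases "n = 0")
    case True
    then show ?thesis unfolding U_def using address_locally_constant[OF D, of n] by simp
  next
    case False
    then have "openin X (\<Inter>(G ` {..<n}))" using G by (intro openin_Inter) auto
    then show ?thesis unfolding U_def using address_locally_constant[OF D, of n] by (rule openin_Int[rotated])
  qed
  moreover have "x \<in> U" using D(2) xX by (auto simp: U_def G_def)
  moreover have "U \<subseteq> K" using D(1) by (auto simp: U_def good_def)
  moreover have "code y k = code x k" if y: "y \<in> U" and k: "k < n" for y k
  proof -
    have yD: "y \<in> exit_class x" using y by (auto simp: U_def D_def)
    have ey: "exits y" "depth y = depth x" "exit_class y = D" "address K y = address K x"
      using exit_class_mem[OF yD] True yD by (auto simp: D_def exit_class_def)
    have B: "(y \<in> B j) = (x \<in> B j)" if "j < n" for j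
      using y that by (auto simp: U_def G_def split: if_splits)
    have a: "address D y j = address D x j" if "j < n" for j using y that by (simp add: U_def)
    have t: "tail_code y t = tail_code x t" if "t < n" for t
    proof -
      have "t div 2 ^ Suc (depth x) < n" using that by (meson div_le_dividend le_less_trans)
      then show ?thesis using a B by (simp add: tail_code_def Let_def ey D_def[symmetric])
    qed
    have tt: "tail_code y (k - depth x - 2) = tail_code x (k - depth x - 2)" using k by (intro t) simp
    show ?thesis by (simp only: code_def ey tt)
  qed
  ultimately show ?thesis by (intro exI[of _ U] conjI ballI allI impI)
qed

text \<open>Compactness: the points of \<open>K\<close> whose code agrees with \<open>c\<close> on
  \<open>n\<close> letters form a decreasing sequence of nonempty closed sets. Closedness is what a
  prefix-preserving retraction onto the codes requires.\<close>

lemma code_image_closed: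
  assumes "\<And>n. \<exists>x\<in>K. \<forall>k<n. code x k = c k"
  shows "c \<in> code ` K"
proof -
  define C where "C = (\<lambda>n. {x \<in> K. \<forall>k<n. code x k = c k})"
  have "(\<Inter>n. C n) \<noteq> {}"
  proof (rule compact_space_imp_nest[OF compact])
    fix n
    show "C n \<noteq> {}" using assms[of n] by (auto simp: C_def)
    have "openin X (K - C n)"
    proof (subst openin_subopen, intro ballI)
      fix x assume x: "x \<in> K - C n"
      then obtain U where U: "openin X U" "x \<in> U" "U \<subseteq> K" "\<forall>y\<in>U. \<forall>k<n. code y k = code x k"
        using code_prefix_continuous[of x n] by auto
      moreover have "U \<subseteq> K - C n"
      proof
        fix y assume y: "y \<in> U"
        obtain k where "k < n" "code x k \<noteq> c k" using x by (auto simp: C_def)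
        moreover have "code y k = code x k" using U(4) y \<open>k < n\<close> by blast
        ultimately show "y \<in> K - C n" using y U(3) by (auto simp: C_def)
      qed
      ultimately show "\<exists>T. openin X T \<and> x \<in> T \<and> T \<subseteq> K - C n" by blast
    qed
    moreover have "C n = K - (K - C n)" by (auto simp: C_def)
    moreover have "closedin X K" using K by (simp add: uncountable_clopen_def)
    ultimately show "closedin X (C n)" by (metis closedin_diff)
  next
    show "decseq C" by (auto simp: antimono_def C_def)
  qed
  then obtain x where x: "\<And>n. x \<in> C n" by auto
  have "code x k = c k" for k
  proof -
    have "x \<in> {x \<in> K. \<forall>j<Suc k. code x j = c j}" using x[of "Suc k"] unfolding C_def .
    then show ?thesis by simp
  qed
  then have "code x = c" by auto
  then show ?thesis using x[of 0] by (auto simp: C_def)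
qed

lemma binary_code:
  assumes "\<And>n. c n < (2::nat)"
  shows "c \<in> code ` K"
proof -
  obtain x where x: "x \<in> K" "address K x = c" using address_surj[OF good_K, of c] assms by auto
  have "\<not> exits x" unfolding exits_def x(2) using assms by (metis less_irrefl)
  then have "code x = c" using code_no_exit x(2) by simp
  then show ?thesis using x(1) by auto
qed

text \<open>The witness is a point of the exit class that never leaves the second tree. Its main
  positions can be prescribed by surjectivity of addresses, and its side positions are 0.\<close>

lemma sparse_tail_code:
  assumes w: "\<And>j. j < k \<Longrightarrow> c j < 2" and c: "c k = 2" "c (Suc k) = 0" "\<And>t. c (k + 2 + t) < 2"
    and sparse: "\<And>t. \<not> 2 ^ Suc k dvd t \<Longrightarrow> c (k + 2 + t) = 0"
  shows "c \<in> code ` K"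
proof -
  have "good {x \<in> K. (\<forall>j<k. address K x j = c j) \<and> address K x k = 2}" (is "good ?D")
    using w by (intro exit_good[OF good_K])
  have D_ex: "exits x \<and> depth x = k \<and> exit_class x = ?D" if "x \<in> ?D" for x
  proof -
    have ex: "exits x" using that by (auto simp: exits_def)
    have "depth x = k" unfolding depth_def
    proof (rule Least_equality)
      show "address K x k = 2" using that by simp
      show "k \<le> y" if y: "address K x y = 2" for y
      proof (rule ccontr)
        assume "\<not> k \<le> y"
        then have "address K x y < 2" using \<open>x \<in> ?D\<close> w[of y] by auto
        then show False using y by simp
      qed
    qed
    then show ?thesis using ex that exit_class_eq[OF ex] by auto
  qed
  obtain x where x: "x \<in> ?D" "address ?D x = (\<lambda>j. c (k + 2 + 2 ^ Suc k * j))"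
    using address_surj[OF \<open>good ?D\<close>, of "\<lambda>j. c (k + 2 + 2 ^ Suc k * j)"] c(3) by auto
  have ex: "exits x" "depth x = k" "exit_class x = ?D" using D_ex[OF x(1)] by auto
  have t: "tail_code x t = c (k + 2 + t)" for t
  proof (cases "2 ^ Suc k dvd t")
    case True
    then show ?thesis using c(3)[of t] by (simp add: tail_code_def Let_def ex x(2))
  next
    case False
    have "address (exit_class x) x j \<noteq> 2" for j using c(3)[of "2 ^ Suc k * j"] by (simp add: ex x(2))
    then have "tail_code x t = 0" using False by (simp add: tail_code_def Let_def ex(2))
    then show ?thesis using sparse[OF False] by simp
  qed
  have "code x n = c n" for n
  proof -
    consider "n < k" | "n = k" | "n = Suc k" | t where "n = k + 2 + t"
      using position_cases by blast
    then show ?thesis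
    proof cases
      case 1
      then show ?thesis using code_exit(1)[OF ex(1), of n] ex(2) x(1) by auto
    next
      case (4 t)
      then show ?thesis using code_exit(4)[OF ex(1), of t] ex(2) t by simp
    qed (use code_exit[OF ex(1)] ex(2) c in auto)
  qed
  then have "code x = c" by auto
  then show ?thesis using x(1) by auto
qed

end

text \<open>
  Prepending a letter to \<open>w 2 0 z\<close> increases \<open>k\<close>; zeroing \<open>z\<close> off the multiples of \<open>2\<^bsup>k+1\<^esup>\<close> beforehand
  brings the result back to where codes live.
\<close>

definition thin :: "(nat \<Rightarrow> nat) \<Rightarrow> nat \<Rightarrow> nat" where
  "thin c n = (if \<exists>k. c k = 2 \<and> (\<forall>j<k. c j \<noteq> 2) \<and> k + 2 \<le> n \<and> \<not> 2 ^ Suc k dvd (n - (k + 2)) then 0 else c n)"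

lemma thin_binary: "(\<And>n. c n < 2) \<Longrightarrow> thin c = c"
proof -
  assume "\<And>n. c n < 2"
  then have "c k \<noteq> 2" for k by (metis less_irrefl)
  then show ?thesis by (intro ext) (auto simp: thin_def)
qed

text \<open>Dropping a letter lowers the exit depth from \<open>k + 1\<close> to \<open>k\<close>.
  The support on multiples of \<open>2 ^ (k + 1)\<close>, which holds at the old depth, is just what
  \<open>sparse_tail_code\<close> asks for at the new one and what \<open>thin\<close> leaves
  unchanged.\<close>

lemma (in clopen_tree) code_tail:
  assumes c: "c \<in> code ` K" and c0: "c 0 < 2"
  shows "(\<lambda>n. c (Suc n)) \<in> code ` K" "thin (\<lambda>n. c (Suc n)) = (\<lambda>n. c (Suc n))"
proof -
  obtain x where x: "x \<in> K" "c = code x" using c by auto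
  have "(\<lambda>n. c (Suc n)) \<in> code ` K \<and> thin (\<lambda>n. c (Suc n)) = (\<lambda>n. c (Suc n))"
  proof (cases "exits x")
    case False
    then have "c = address K x" using code_no_exit x by simp
    then have "c n < 2" for n
      using False address_le[OF good_K, of x n] unfolding exits_def by (metis le_neq_implies_less)
    then show ?thesis using binary_code[of "\<lambda>n. c (Suc n)"] thin_binary[of "\<lambda>n. c (Suc n)"] by auto
  next
    case True
    have "depth x \<noteq> 0" using code_exit(2)[OF True] c0 x(2) by (metis less_irrefl)
    then obtain k where k: "depth x = Suc k" by (cases "depth x") auto
    have t: "c (Suc (k + 2 + t)) = tail_code x t" for t using code_exit(4)[OF True, of t] k x(2) by simp
    have z: "c (Suc (k + 2 + t)) = 0" if "\<not> 2 ^ Suc k dvd t" for t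
      using t tail_code_zero[of x t] k that by simp
    have eq2: "c (Suc j) = 2 \<longleftrightarrow> j = k" for j using code_lt2_iff[OF True, of "Suc j"] k x(2) by auto
    have "(\<lambda>n. c (Suc n)) \<in> code ` K"
    proof (rule sparse_tail_code)
      show "c (Suc j) < 2" if "j < k" for j
        using code_exit(1)[OF True, of "Suc j"] depth(2)[OF True, of "Suc j"] k that x(2) by simp
      show "c (Suc k) = 2" using eq2 by simp
      show "c (Suc (Suc k)) = 0" using code_exit(3)[OF True] k x(2) by simp
      show "c (Suc (k + 2 + t)) < 2" for t using t[of t] tail_code_lt2[of x t] by simp
    qed (rule z)
    moreover have "thin (\<lambda>n. c (Suc n)) n = c (Suc n)" for n
    proof (cases "k + 2 \<le> n \<and> \<not> 2 ^ Suc k dvd (n - (k + 2))")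
      case True
      then obtain t where "n = k + 2 + t" "\<not> 2 ^ Suc k dvd t" by (metis le_add_diff_inverse)
      then have "c (Suc n) = 0" using z[of t] by simp
      then show ?thesis by (simp add: thin_def)
    next
      case False
      then show ?thesis using eq2 by (auto simp: thin_def)
    qed
    ultimately show ?thesis by auto
  qed
  then show "(\<lambda>n. c (Suc n)) \<in> code ` K" "thin (\<lambda>n. c (Suc n)) = (\<lambda>n. c (Suc n))" by auto
qed

text \<open>Such a point exits at depth 0, so its code is 2 followed by a binary sequence with first
  bit 0. The third map can therefore reach it from the Cantor set.\<close>

lemma (in clopen_tree) code_start2:
  assumes c: "c \<in> code ` K" and c0: "c 0 = 2"
  shows "c 1 = 0" "c (n + 2) < 2"
proof -
  obtain x where x: "x \<in> K" "c = code x" using c by auto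
  have ex: "exits x" using c0 x(2) code_no_exit[of x] unfolding exits_def by metis
  then have d: "depth x = 0" using code_lt2_iff[OF ex, of 0] c0 x(2) by simp
  show "c 1 = 0" "c (n + 2) < 2"
    using code_exit(3,4)[OF ex] d x(2) tail_code_lt2[of x n] by (simp_all add: add.commute[of n])
qed

theorem coding_exists:
  fixes X :: "'a topology"
  assumes X: "compact_space X" "metrizable_space X" and Z: "openin X Z" "uncountable Z" "subtopology X Z dim_le 0"
  obtains K and \<kappa> :: "'a \<Rightarrow> nat \<Rightarrow> nat" where
    "openin X K" "closedin X K" "topspace X - K \<noteq> {}"
    "\<And>x n. x \<in> K \<Longrightarrow> \<exists>U. openin X U \<and> x \<in> U \<and> U \<subseteq> K \<and> (\<forall>y\<in>U. \<forall>k<n. \<kappa> y k = \<kappa> x k)"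
    "inj_on \<kappa> K" "\<And>x n. \<kappa> x n \<le> 2"
    "\<And>c. (\<And>n. c n < 2) \<Longrightarrow> c \<in> \<kappa> ` K"
    "\<And>c. c \<in> \<kappa> ` K \<Longrightarrow> c 0 < 2 \<Longrightarrow> (\<lambda>n. c (Suc n)) \<in> \<kappa> ` K"
    "\<And>c. c \<in> \<kappa> ` K \<Longrightarrow> c 0 < 2 \<Longrightarrow> thin (\<lambda>n. c (Suc n)) = (\<lambda>n. c (Suc n))"
    "\<And>c n. c \<in> \<kappa> ` K \<Longrightarrow> c 0 = 2 \<Longrightarrow> c 1 = 0"
    "\<And>c n. c \<in> \<kappa> ` K \<Longrightarrow> c 0 = 2 \<Longrightarrow> c (n + 2) < 2"
    "\<And>c. (\<And>n. \<exists>x\<in>K. \<forall>k<n. \<kappa> x k = c k) \<Longrightarrow> c \<in> \<kappa> ` K"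
    "(\<lambda>n. if n = 0 then 2 else 0) \<in> \<kappa> ` K"
proof -
  have H: "Hausdorff_space X" using X(2) by (rule metrizable_imp_Hausdorff_space)
  have sc: "second_countable X" using X by (rule compact_metrizable_imp_second_countable)
  note XX = X(1) H sc Z(1) Z(3)
  have ZX: "Z \<subseteq> topspace X" using Z(1) by (rule openin_subset)
  have "uncountable {p \<in> Z. \<forall>V. openin X V \<longrightarrow> p \<in> V \<longrightarrow> uncountable (V \<inter> Z)}"
    using sc ZX Z(2) by (rule uncountable_condensation_points)
  then obtain p where p: "p \<in> Z" "\<And>V. openin X V \<Longrightarrow> p \<in> V \<Longrightarrow> uncountable (V \<inter> Z)"
    by (metis (no_types, lifting) countable_empty empty_Collect_eq)
  obtain A where A: "openin X A" "closedin X A" "p \<in> A" "A \<subseteq> Z"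
    using clopen_base_of_open_subspace[OF X(1) H Z(1,3) Z(1) p(1) p(1)] by auto
  have "uncountable_clopen X A"
    using A p(2)[OF A(1,3)] by (simp add: uncountable_clopen_def inf.absorb1)
  obtain B :: "nat \<Rightarrow> 'a set" where B: "\<forall>n. openin X (B n) \<and> closedin X (B n)" "\<forall>m. \<exists>n\<ge>m. B n = topspace X"
    "\<forall>x\<in>Z. \<forall>y\<in>topspace X. x \<noteq> y \<longrightarrow> (\<forall>m. \<exists>n\<ge>m. x \<in> B n \<and> y \<notin> B n)"
    using separating_clopen_sequence[OF XX] by (elim exE conjE)
  \<comment> \<open>Splitting with respect to the whole space serves only to get two disjoint
    uncountable pieces: one becomes \<open>K\<close>, the other keeps the complement of
    \<open>K\<close> nonempty.\<close>
  have "openin X (topspace X)" "closedin X (topspace X)" by auto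
  from uncountable_clopen_split[OF XX \<open>uncountable_clopen X A\<close> A(4) this]
  obtain K A1 where KA: "K \<subseteq> A" "uncountable_clopen X K" "A1 \<subseteq> A" "K \<inter> A1 = {}" "uncountable_clopen X A1" by auto
  interpret clopen_tree X K B
  proof
    show "compact_space X" by fact
    show "uncountable_clopen X K" by fact
    show "openin X (B n)" "closedin X (B n)" for n using B(1) by auto
    show "\<exists>n\<ge>m. B n = topspace X" for m using B(2) by auto
    show "\<exists>n\<ge>m. x \<in> B n \<and> y \<notin> B n" if "x \<in> K" "y \<in> K" "x \<noteq> y" for x y m
    proof -
      have "x \<in> Z" "y \<in> topspace X" using that KA(1) A(4) ZX by auto
      then show ?thesis using B(3) that(3) by simp
    qed
    fix A' n assume "uncountable_clopen X A'" "A' \<subseteq> K"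
    moreover have "A' \<subseteq> Z" using \<open>A' \<subseteq> K\<close> KA(1) A(4) by simp
    moreover have "openin X (B n)" "closedin X (B n)" using B(1) by auto
    ultimately show "\<exists>A0 A1. A0 \<subseteq> A' \<and> A1 \<subseteq> A' \<and> A0 \<inter> A1 = {} \<and> uncountable_clopen X A0 \<and> uncountable_clopen X A1 \<and>
        uncountable_clopen X (A' - A0 - A1) \<and> (A0 \<subseteq> B n \<or> A0 \<inter> B n = {}) \<and> (A1 \<subseteq> B n \<or> A1 \<inter> B n = {})"
      using uncountable_clopen_split[OF XX, of A' "B n"] by simp
  qed
  show thesis
  proof (rule that[of K code])
    show "openin X K" "closedin X K" using KA(2) by (auto simp: uncountable_clopen_def)
    have "A1 \<noteq> {}" using KA(5) by (auto simp: uncountable_clopen_def)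
    then obtain q where "q \<in> A1" by auto
    then have "q \<in> topspace X - K" using KA(3,4) A(4) ZX by blast
    then show "topspace X - K \<noteq> {}" by auto
    show "(\<lambda>n. if n = 0 then 2 else 0) \<in> code ` K" by (rule sparse_tail_code[of 0]) auto
  qed (fact code_prefix_continuous code_inj code_le binary_code code_tail code_start2 code_image_closed)+
qed

section \<open>Sequences and expansions\<close>

definition agree :: "nat \<Rightarrow> (nat \<Rightarrow> 'a) \<Rightarrow> (nat \<Rightarrow> 'a) \<Rightarrow> bool" where
  "agree n x y \<longleftrightarrow> (\<forall>k<n. x k = y k)"

lemma agree_refl [simp]: "agree n x x"
  by (simp add: agree_def)

lemma agree_sym: "agree n x y \<Longrightarrow> agree n y x"
  by (simp add: agree_def)

lemma agree_trans: "agree n x y \<Longrightarrow> agree n y z \<Longrightarrow> agree n x z"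
  by (simp add: agree_def)

lemma agree_mono: "agree n x y \<Longrightarrow> m \<le> n \<Longrightarrow> agree m x y"
  by (simp add: agree_def)

lemma agree_case_nat: "agree n x y \<Longrightarrow> agree (Suc n) (case_nat i x) (case_nat i y)"
  by (auto simp: agree_def split: nat.split)

lemma agree_tail: "agree n x y \<Longrightarrow> agree (n - 1) (\<lambda>k. x (Suc k)) (\<lambda>k. y (Suc k))"
  by (auto simp: agree_def)

lemma agree_all_imp_eq: "(\<And>n. agree n x y) \<Longrightarrow> x = y"
  by (rule ext) (use lessI in \<open>auto simp: agree_def\<close>)

lemma case_nat_tail: "case_nat (c 0) (\<lambda>n. c (Suc n)) = c"
  by (rule ext) (simp split: nat.split)

lemma thin_agree: "agree n c c' \<Longrightarrow> agree n (thin c) (thin c')"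
  unfolding agree_def
proof (intro allI impI)
  fix m assume *: "\<forall>k<n. c k = c' k" "m < n"
  have "(c k = 2 \<and> (\<forall>j<k. c j \<noteq> 2) \<and> k + 2 \<le> m \<and> \<not> 2 ^ Suc k dvd (m - (k + 2))) =
     (c' k = 2 \<and> (\<forall>j<k. c' j \<noteq> 2) \<and> k + 2 \<le> m \<and> \<not> 2 ^ Suc k dvd (m - (k + 2)))" for k
  proof (cases "k + 2 \<le> m")
    case True
    then have "c j = c' j" if "j \<le> k" for j using * that by auto
    then show ?thesis by auto
  qed auto
  note eq = this
  have "c m = c' m" using * by simp
  then show "thin c m = thin c' m" unfolding thin_def eq by (simp only:)
qed

text \<open>By closedness, \<open>z\<close> outside \<open>P\<close> has a longest prefix shared
  with \<open>P\<close>, of length \<open>m z - 1\<close>. Its image is an element of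
  \<open>P\<close> chosen as a function of that prefix alone (\<open>pre\<close> masks the rest), so
  sequences that agree beyond this point have equal images.\<close>

lemma agree_retraction:
  assumes P: "P \<noteq> {}" and closed: "\<And>z. (\<And>n. \<exists>e\<in>P. agree n e z) \<Longrightarrow> z \<in> P"
  obtains r :: "(nat \<Rightarrow> 'a) \<Rightarrow> nat \<Rightarrow> 'a" where "\<And>z. r z \<in> P" "\<And>z. z \<in> P \<Longrightarrow> r z = z"
    "\<And>n z z'. agree n z z' \<Longrightarrow> agree n (r z) (r z')"
proof -
  define pre where "pre = (\<lambda>(z::nat \<Rightarrow> 'a) k j. if j < k then z j else undefined)"
  define ch where "ch = (\<lambda>p k. SOME e. e \<in> P \<and> agree k e p)"
  define m where "m = (\<lambda>z. LEAST m. \<not> (\<exists>e\<in>P. agree m e z))"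
  define r where "r = (\<lambda>z. if z \<in> P then z else ch (pre z (m z - 1)) (m z - 1))"
  have pre_agree: "agree k e (pre z k) = agree k e z" for e z k by (auto simp: agree_def pre_def)
  have pre_eq: "pre z k = pre z' k" if "agree k z z'" for z z' k
    using that by (auto simp: agree_def pre_def)
  have m: "\<not> (\<exists>e\<in>P. agree (m z) e z)" "\<exists>e\<in>P. agree (m z - 1) e z" "0 < m z" if z: "z \<notin> P" for z
  proof -
    have ex: "\<exists>m. \<not> (\<exists>e\<in>P. agree m e z)" using closed[of z] z by blast
    show 1: "\<not> (\<exists>e\<in>P. agree (m z) e z)" using LeastI_ex[OF ex] by (simp add: m_def)
    have "\<exists>e\<in>P. agree 0 e z" using P by (auto simp: agree_def)
    then show 0: "0 < m z" using 1 by (metis gr0I)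
    then have "m z - 1 < m z" by simp
    then show "\<exists>e\<in>P. agree (m z - 1) e z"
      using not_less_Least[of "m z - 1" "\<lambda>m. \<not> (\<exists>e\<in>P. agree m e z)"] by (simp add: m_def)
  qed
  have ch: "ch (pre z (m z - 1)) (m z - 1) \<in> P" "agree (m z - 1) (ch (pre z (m z - 1)) (m z - 1)) z"
    if z: "z \<notin> P" for z
  proof -
    have "\<exists>e. e \<in> P \<and> agree (m z - 1) e (pre z (m z - 1))" using m(2)[OF z] by (auto simp: pre_agree)
    from someI_ex[OF this] show "ch (pre z (m z - 1)) (m z - 1) \<in> P" "agree (m z - 1) (ch (pre z (m z - 1)) (m z - 1)) z"
      unfolding ch_def pre_agree by auto
  qed
  have same: "z' \<notin> P \<and> m z' = m z" if z: "z \<notin> P" "m z \<le> n" "agree n z z'" for n z z'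
  proof -
    have eq: "(\<exists>e\<in>P. agree j e z') = (\<exists>e\<in>P. agree j e z)" if "j \<le> m z" for j
      using agree_mono[OF z(3), of j] that z(2) agree_trans agree_sym by (metis order_trans)
    have n1: "\<not> (\<exists>e\<in>P. agree (m z) e z')" using eq[of "m z"] m(1)[OF z(1)] by simp
    then have "z' \<notin> P" using agree_refl by blast
    moreover have "(LEAST j. \<not> (\<exists>e\<in>P. agree j e z')) = m z"
    proof (rule Least_equality)
      show "\<not> (\<exists>e\<in>P. agree (m z) e z')" by (rule n1)
      show "m z \<le> y" if y: "\<not> (\<exists>e\<in>P. agree y e z')" for y
      proof (rule ccontr)
        assume "\<not> ?thesis"
        then have "y < m z" by simp
        then have "\<not> (\<exists>e\<in>P. agree y e z)" using eq[of y] y by simp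
        then show False using \<open>y < m z\<close> not_less_Least[of y "\<lambda>m. \<not> (\<exists>e\<in>P. agree m e z)"] by (simp add: m_def)
      qed
    qed
    ultimately show ?thesis by (simp add: m_def)
  qed
  have near: "agree n (r z) z" if "z \<in> P \<or> n < m z" for n z
    using that ch(2)[of z] agree_mono[of "m z - 1" "r z" z n] by (cases "z \<in> P") (auto simp: r_def)
  show thesis
  proof (rule that[of r])
    show "r z \<in> P" for z using ch(1) by (simp add: r_def)
    show "r z = z" if "z \<in> P" for z using that by (simp add: r_def)
    fix n and z z' :: "nat \<Rightarrow> 'a" assume a: "agree n z z'"
    show "agree n (r z) (r z')"
    proof (cases "(z \<in> P \<or> n < m z) \<and> (z' \<in> P \<or> n < m z')")
      case True
      then show ?thesis using near a agree_trans agree_sym by metis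
    next
      case False
      then have "z \<notin> P \<and> z' \<notin> P \<and> m z' = m z \<and> m z \<le> n"
        using same[OF _ _ a] same[OF _ _ agree_sym[OF a]] by (metis not_less)
      moreover from this have "agree (m z - 1) z z'" by (intro agree_mono[OF a]) auto
      ultimately show ?thesis using pre_eq[of "m z - 1" z z'] by (simp add: r_def)
    qed
  qed
qed

section \<open>Interleaved dyadic expansions\<close>

primrec dyadic_num :: "nat \<Rightarrow> (nat \<Rightarrow> nat) \<Rightarrow> nat \<Rightarrow> nat \<Rightarrow> nat" where
  "dyadic_num N z c 0 = 0"
| "dyadic_num N z c (Suc q) = 2 * dyadic_num N z c q + z (q * N + c)"

text \<open>Coordinate \<open>c\<close> reads the positions congruent to \<open>c\<close> modulo
  \<open>N\<close>, so a prefix of length \<open>q * N\<close> holds \<open>q\<close> bits of every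
  coordinate; \<open>dyadic_num\<close> is the integer formed by these bits.\<close>

definition dyadic_val :: "nat \<Rightarrow> (nat \<Rightarrow> nat) \<Rightarrow> nat \<Rightarrow> real" where
  "dyadic_val N z c = (\<Sum>q. real (z (q * N + c)) * (1/2) ^ Suc q)"

lemma dyadic_num_partial_sum:
  "real (dyadic_num N z c q) / 2 ^ q = (\<Sum>j<q. real (z (j * N + c)) * (1/2) ^ Suc j)"
proof (induction q)
  case (Suc q)
  have "real (dyadic_num N z c (Suc q)) / 2 ^ Suc q = real (dyadic_num N z c q) / 2 ^ q + real (z (q * N + c)) * (1/2) ^ Suc q"
    by (simp add: field_simps)
  then show ?case using Suc by simp
qed simp

lemma dyadic_bounds:
  assumes z: "\<And>n. z n < 2"
  shows "summable (\<lambda>q. real (z (q * N + c)) * (1/2) ^ Suc q)"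
    "real (dyadic_num N z c q) / 2 ^ q \<le> dyadic_val N z c"
    "dyadic_val N z c \<le> (real (dyadic_num N z c q) + 1) / 2 ^ q"
proof -
  let ?f = "\<lambda>q. real (z (q * N + c)) * (1/2) ^ Suc q"
  have f1: "?f j \<le> (1/2) ^ Suc j" "0 \<le> ?f j" for j using z[of "j * N + c"] by (auto simp: mult_le_cancel_right1)
  have gs: "summable (\<lambda>j. (1/2::real) ^ Suc j)" by (simp add: summable_geometric)
  show s: "summable ?f" by (rule summable_comparison_test'[OF gs, of 0]) (use f1 in auto)
  have split: "dyadic_val N z c = (\<Sum>j. ?f (j + q)) + (\<Sum>j<q. ?f j)"
    unfolding dyadic_val_def by (rule suminf_split_initial_segment[OF s])
  have s': "summable (\<lambda>j. ?f (j + q))" using s by (rule summable_ignore_initial_segment)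
  have "0 \<le> (\<Sum>j. ?f (j + q))" using s' f1(2) by (intro suminf_nonneg) auto
  then show "real (dyadic_num N z c q) / 2 ^ q \<le> dyadic_val N z c" using split by (simp add: dyadic_num_partial_sum)
  have "(\<Sum>j. ?f (j + q)) \<le> (\<Sum>j. (1/2) ^ q * (1/2) ^ Suc j)"
  proof (rule suminf_le[OF _ s'])
    show "?f (j + q) \<le> (1/2) ^ q * (1/2) ^ Suc j" for j using f1(1)[of "j + q"] by (simp add: power_add mult_ac)
    show "summable (\<lambda>j. (1/2::real) ^ q * (1/2) ^ Suc j)" by (intro summable_mult gs)
  qed
  also have "\<dots> = (1/2) ^ q * (\<Sum>j. (1/2) ^ Suc j)" by (rule suminf_mult[OF gs])
  also have "(\<Sum>j. (1/2::real) ^ Suc j) = 1" by (rule sums_unique[symmetric]) (rule power_half_series)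
  finally have "dyadic_val N z c \<le> (1/2) ^ q + real (dyadic_num N z c q) / 2 ^ q"
    using split by (simp add: dyadic_num_partial_sum)
  then show "dyadic_val N z c \<le> (real (dyadic_num N z c q) + 1) / 2 ^ q"
    by (simp add: add_divide_distrib power_one_over)
qed

lemma dyadic_num_inj:
  assumes "dyadic_num N z c q = dyadic_num N z' c q" "\<And>n. z n < 2" "\<And>n. z' n < 2" "j < q"
  shows "z (j * N + c) = z' (j * N + c)"
  using assms(1,4)
proof (induction q)
  case (Suc q)
  have b: "z (q * N + c) < 2" "z' (q * N + c) < 2" using assms by auto
  have e: "2 * dyadic_num N z c q + z (q * N + c) = 2 * dyadic_num N z' c q + z' (q * N + c)" using Suc.prems by simp
  then have "z (q * N + c) = z' (q * N + c)" "dyadic_num N z c q = dyadic_num N z' c q" using b by presburger+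
  then show ?case using Suc by (auto simp: less_Suc_eq)
qed simp

lemma dyadic_num_agree: "agree (q * N) z z' \<Longrightarrow> c < N \<Longrightarrow> dyadic_num N z c q = dyadic_num N z' c q"
proof (induction q)
  case (Suc q)
  then have "dyadic_num N z c q = dyadic_num N z' c q" by (intro Suc.IH agree_mono[OF Suc.prems(1)]) auto
  moreover have "z (q * N + c) = z' (q * N + c)" using Suc.prems by (auto simp: agree_def)
  ultimately show ?case by simp
qed simp

text \<open>A prefix of length \<open>m\<close> fixes \<open>m div N\<close> bits, so the error is
  at most \<open>l ^ (N * (m div N))\<close> because \<open>l ^ N = 1/2\<close>. Rounding down costs
  less than \<open>N\<close> positions, that is a factor of at most 2.\<close>

lemma dyadic_val_agree:
  assumes z: "\<And>n. z n < 2" "\<And>n. z' n < 2" and a: "agree m z z'" and c: "c < N"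
    and l: "0 < l" "l < (1::real)" "l ^ N = 1/2"
  shows "\<bar>dyadic_val N z c - dyadic_val N z' c\<bar> \<le> 2 * l ^ m"
proof -
  define q where "q = m div N"
  have N: "0 < N" using c by simp
  have qm: "q * N \<le> m" "m \<le> q * N + N" using N mod_less_divisor[OF N, of m] div_mult_mod_eq[of m N] unfolding q_def by linarith+
  have "dyadic_num N z c q = dyadic_num N z' c q" using agree_mono[OF a qm(1)] c by (rule dyadic_num_agree)
  then have "\<bar>dyadic_val N z c - dyadic_val N z' c\<bar> \<le> 1 / 2 ^ q"
    using dyadic_bounds(2,3)[where z=z and N=N and c=c and q=q, OF z(1)]
       dyadic_bounds(2,3)[where z=z' and N=N and c=c and q=q, OF z(2)] by (simp add: add_divide_distrib)
  also have "1 / 2 ^ q = l ^ (q * N)" unfolding mult.commute[of q N] power_mult l(3) by (simp add: power_one_over)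
  also have "\<dots> = 2 * l ^ (q * N + N)" using l(3) by (simp add: power_add)
  also have "\<dots> \<le> 2 * l ^ m" using l qm(2) by (intro mult_left_mono power_decreasing) auto
  finally show ?thesis .
qed

text \<open>Greedy doubling of the remainder \<open>R n\<close>, which stays in the closed unit
  interval; the number 1 gets all digits 1.\<close>

lemma binary_expansion:
  assumes "0 \<le> r" "r \<le> 1"
  shows "\<exists>b :: nat \<Rightarrow> nat. (\<forall>n. b n < 2) \<and> (\<lambda>q. real (b q) * (1/2) ^ Suc q) sums r"
proof -
  define R where "R = rec_nat r (\<lambda>_ s. if s \<ge> 1/2 then 2 * s - 1 else 2 * s)"
  define b where "b = (\<lambda>n. if R n \<ge> 1/2 then 1 else (0::nat))"
  have R0: "R 0 = r" and RS: "R (Suc n) = 2 * R n - real (b n)" for n by (simp_all add: R_def b_def)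
  have R01: "0 \<le> R n \<and> R n \<le> 1" for n
    by (induction n) (use assms R0 RS in \<open>auto simp: b_def\<close>)
  have part: "(\<Sum>q<n. real (b q) * (1/2) ^ Suc q) = r - R n * (1/2) ^ n" for n
  proof (induction n)
    case (Suc n)
    have "R (Suc n) * (1/2) ^ Suc n = R n * (1/2) ^ n - real (b n) * (1/2) ^ Suc n"
      unfolding RS by (simp add: field_simps)
    then show ?case using Suc.IH unfolding sum.lessThan_Suc by linarith
  qed (simp add: R0)
  have "(\<lambda>n. R n * (1/2) ^ n) \<longlonglongrightarrow> 0"
  proof (rule tendsto_sandwich[of "\<lambda>_. 0" _ _ "\<lambda>n. (1/2::real) ^ n"])
    show "(\<lambda>n. (1/2::real) ^ n) \<longlonglongrightarrow> 0" by (rule LIMSEQ_power_zero) simp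
  qed (use R01 in \<open>auto intro!: always_eventually simp: mult_left_le_one_le\<close>)
  then have "(\<lambda>n. r - R n * (1/2) ^ n) \<longlonglongrightarrow> r - 0" by (intro tendsto_diff tendsto_const)
  then have "(\<lambda>q. real (b q) * (1/2) ^ Suc q) sums r" unfolding sums_def part by simp
  then show ?thesis by (intro exI[of _ b]) (simp add: b_def)
qed

lemma dyadic_val_surj:
  assumes "\<And>c. c < N \<Longrightarrow> 0 \<le> v c \<and> v c \<le> 1"
  shows "\<exists>z. (\<forall>n. z n < 2) \<and> (\<forall>c<N. dyadic_val N z c = v c)"
proof (cases "N = 0")
  case False
  have "\<exists>b :: nat \<Rightarrow> nat. (\<forall>n. b n < 2) \<and> (\<lambda>q. real (b q) * (1/2) ^ Suc q) sums v c" if "c < N" for c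
    using binary_expansion assms that by blast
  then obtain b :: "nat \<Rightarrow> nat \<Rightarrow> nat" where b: "\<And>c n. c < N \<Longrightarrow> b c n < 2"
    "\<And>c. c < N \<Longrightarrow> (\<lambda>q. real (b c q) * (1/2) ^ Suc q) sums v c" by metis
  define z where "z = (\<lambda>n. b (n mod N) (n div N))"
  have "z n < 2" for n using b(1)[of "n mod N"] False by (simp add: z_def)
  moreover have "dyadic_val N z c = v c" if "c < N" for c
    using sums_unique[OF b(2)[OF that]] that by (simp add: dyadic_val_def z_def)
  ultimately show ?thesis by blast
qed (auto intro!: exI[of _ "\<lambda>_. 0"])

text \<open>Close values have close integer numerators at level \<open>q\<close>, even when the bits
  differ widely as in 0111... and 1000.... So boundedly many numerators occur per coordinate, and
  those of all \<open>N\<close> coordinates determine the first \<open>q * N \<ge> n\<close>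
  bits.\<close>

lemma dyadic_close_count:
  assumes N: "0 < N" and l: "0 < l" "l < (1::real)" "l ^ N = 1/2"
    and A: "\<And>z k. z \<in> A \<Longrightarrow> z k < 2"
      "\<And>z z' c. z \<in> A \<Longrightarrow> z' \<in> A \<Longrightarrow> c < N \<Longrightarrow> \<bar>dyadic_val N z c - dyadic_val N z' c\<bar> \<le> C * l ^ n"
    and C: "0 \<le> C"
  shows "finite ((\<lambda>z. map z [0..<n]) ` A) \<and> card ((\<lambda>z. map z [0..<n]) ` A) \<le> (2 * nat \<lceil>2 * C + 1\<rceil> + 1) ^ N"
proof (cases "A = {}")
  case False
  then obtain w where w: "w \<in> A" by auto
  define q where "q = Suc (n div N)"
  have nq: "n \<le> q * N" "q * N \<le> n + N"
  proof -
    have "q * N = n div N * N + N" by (simp add: q_def)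
    then show "n \<le> q * N" "q * N \<le> n + N"
      using mod_less_divisor[OF N, of n] div_mult_mod_eq[of n N] by linarith+
  qed
  define D where "D = nat \<lceil>2 * C + 1\<rceil>"
  define v where "v = (\<lambda>z. restrict (\<lambda>c. dyadic_num N z c q) {..<N})"
  \<comment> \<open>Subtraction of naturals may cut the interval off at 0; it still has at most
    \<open>2 * D + 1\<close> elements.\<close>
  have "v z \<in> PiE {..<N} (\<lambda>c. {dyadic_num N w c q - D..dyadic_num N w c q + D})" if z: "z \<in> A" for z
  proof -
    have "dyadic_num N z c q \<in> {dyadic_num N w c q - D..dyadic_num N w c q + D}" if c: "c < N" for c
    proof -
      let ?a = "real (dyadic_num N z c q)" and ?b = "real (dyadic_num N w c q)"
      have 1: "\<bar>?a / 2 ^ q - ?b / 2 ^ q\<bar> \<le> C * l ^ n + 1 / 2 ^ q"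
        using A(2)[OF z w c] dyadic_bounds(2,3)[where z=z and N=N and c=c and q=q, OF A(1)[OF z]]
          dyadic_bounds(2,3)[where z=w and N=N and c=c and q=q, OF A(1)[OF w]] by (simp add: add_divide_distrib)
      have lq: "2 ^ q * l ^ (q * N) = 1"
        unfolding mult.commute[of q N] power_mult l(3) by (simp add: power_one_over)
      have "l ^ n = 2 * l ^ (n + N)" using l(3) by (simp add: power_add)
      also have "\<dots> \<le> 2 * l ^ (q * N)" using l nq by (intro mult_left_mono power_decreasing) auto
      finally have "2 ^ q * l ^ n \<le> 2 * (2 ^ q * l ^ (q * N))" by (simp add: mult_left_mono mult.left_commute)
      then have "2 ^ q * l ^ n \<le> 2" by (simp only: lq)
      then have "C * (2 ^ q * l ^ n) \<le> C * 2" using C by (rule mult_left_mono)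
      moreover have "2 ^ q * \<bar>?a / 2 ^ q - ?b / 2 ^ q\<bar> \<le> 2 ^ q * (C * l ^ n + 1 / 2 ^ q)" using 1 by (rule mult_left_mono) simp
      moreover have "2 ^ q * \<bar>?a / 2 ^ q - ?b / 2 ^ q\<bar> = \<bar>?a - ?b\<bar>"
        by (simp flip: diff_divide_distrib add: abs_divide)
      moreover have "2 ^ q * (C * l ^ n + 1 / 2 ^ q) = C * (2 ^ q * l ^ n) + 1" by (simp add: algebra_simps)
      ultimately have "\<bar>?a - ?b\<bar> \<le> 2 * C + 1" by linarith
      also have "\<dots> \<le> real D" unfolding D_def by linarith
      finally show ?thesis by (auto simp: abs_le_iff)
    qed
    then show ?thesis by (auto simp: v_def)
  qed
  then have vA: "v ` A \<subseteq> PiE {..<N} (\<lambda>c. {dyadic_num N w c q - D..dyadic_num N w c q + D})" by auto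
  have finP: "finite (PiE {..<N} (\<lambda>c. {dyadic_num N w c q - D..dyadic_num N w c q + D}))" by (intro finite_PiE) auto
  have "card (v ` A) \<le> card (PiE {..<N} (\<lambda>c. {dyadic_num N w c q - D..dyadic_num N w c q + D}))"
    using finP vA by (rule card_mono)
  also have "\<dots> = (\<Prod>c<N. card {dyadic_num N w c q - D..dyadic_num N w c q + D})" by (simp add: card_PiE)
  also have "\<dots> \<le> (\<Prod>c<N. 2 * D + 1)" by (intro prod_mono) auto
  also have "\<dots> = (2 * D + 1) ^ N" by simp
  finally have card: "card (v ` A) \<le> (2 * D + 1) ^ N" .
  \<comment> \<open>Choosing any preimage of the numerators recovers the prefix, so prefixes are no
    more numerous than tuples of numerators.\<close>
  define u where "u = (\<lambda>t. map (inv_into A v t) [0..<n])"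
  have "map z [0..<n] = u (v z)" if z: "z \<in> A" for z
  proof -
    define z' where "z' = inv_into A v (v z)"
    have z': "z' \<in> A" "v z' = v z" unfolding z'_def using z by (auto simp: inv_into_into f_inv_into_f)
    have "z k = z' k" if "k < n" for k
    proof -
      have km: "k mod N < N" using N by simp
      have "k < q * N" using that nq by simp
      then have kd: "k div N < q" by (simp add: less_mult_imp_div_less)
      have "v z' (k mod N) = v z (k mod N)" using z'(2) by simp
      then have "dyadic_num N z (k mod N) q = dyadic_num N z' (k mod N) q" using km by (simp add: v_def)
      from dyadic_num_inj[OF this A(1)[OF z] A(1)[OF z'(1)] kd] show ?thesis by simp
    qed
    then show ?thesis by (simp add: u_def z'_def)
  qed
  then have "(\<lambda>z. map z [0..<n]) ` A = u ` v ` A" by (auto simp: image_image)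
  moreover have "finite (v ` A)" using finP vA finite_subset by blast
  ultimately have "finite ((\<lambda>z. map z [0..<n]) ` A)" "card ((\<lambda>z. map z [0..<n]) ` A) \<le> card (v ` A)"
    by (simp_all only: card_image_le finite_imageI)
  then show ?thesis using card by (simp add: D_def)
qed simp

section \<open>Base 4 expansions with digits 0, 1, 2\<close>

definition base4 :: "(nat \<Rightarrow> nat) \<Rightarrow> real" where
  "base4 a = (\<Sum>q. real (a q) * (1/4) ^ q)"

text \<open>Omitting the digit 3 leaves gaps: a first difference at \<open>m\<close> contributes at
  least \<open>(1/4) ^ m\<close>, and all later digits together at most two thirds of that.\<close>

lemma base4_diff:
  assumes a: "\<And>q. a q \<le> 2" "\<And>q. b q \<le> 2" and ag: "agree m a b"
  shows "\<bar>base4 a - base4 b\<bar> \<le> 8/3 * (1/4) ^ m" "a m \<noteq> b m \<Longrightarrow> 1/3 * (1/4) ^ m \<le> \<bar>base4 a - base4 b\<bar>"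
proof -
  have gs: "summable (\<lambda>j. (1/4::real) ^ j)" by (simp add: summable_geometric)
  have s: "summable (\<lambda>q. real (a q) * (1/4) ^ q)" if "\<And>q. a q \<le> 2" for a :: "nat \<Rightarrow> nat"
  proof (rule summable_comparison_test'[OF summable_mult[OF gs, of 2], of 0])
    show "norm (real (a q) * (1/4) ^ q) \<le> 2 * (1/4) ^ q" for q using that[of q] by (simp add: mult_right_mono)
  qed
  define d where "d = (\<lambda>q. (real (a q) - real (b q)) * (1/4) ^ q)"
  have ds: "summable d" "base4 a - base4 b = suminf d"
    using suminf_diff[OF s[OF a(1)] s[OF a(2)]] summable_diff[OF s[OF a(1)] s[OF a(2)]]
    by (simp_all add: base4_def d_def left_diff_distrib)
  have tail: "\<bar>\<Sum>j. d (j + k)\<bar> \<le> 8/3 * (1/4) ^ k" for k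
  proof -
    have g2: "summable (\<lambda>j. 2 * (1/4) ^ k * (1/4::real) ^ j)" by (intro summable_mult gs)
    have le: "norm (d (j + k)) \<le> 2 * (1/4) ^ k * (1/4) ^ j" for j
    proof -
      have "\<bar>real (a (j + k)) - real (b (j + k))\<bar> \<le> 2" using a(1)[of "j + k"] a(2)[of "j + k"] by linarith
      then have "\<bar>real (a (j + k)) - real (b (j + k))\<bar> * (1/4) ^ (j + k) \<le> 2 * (1/4) ^ (j + k)" by (rule mult_right_mono) simp
      then show ?thesis by (simp add: d_def abs_mult power_add mult_ac)
    qed
    have sn: "summable (\<lambda>j. norm (d (j + k)))"
      by (rule summable_comparison_test'[OF g2, of 0]) (use le in simp)
    have "norm (\<Sum>j. d (j + k)) \<le> (\<Sum>j. norm (d (j + k)))" using sn by (rule summable_norm)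
    also have "\<dots> \<le> (\<Sum>j. 2 * (1/4) ^ k * (1/4) ^ j)" by (rule suminf_le[OF le sn g2])
    also have "\<dots> = 2 * (1/4) ^ k * (4/3)" using suminf_mult[OF gs, of "2 * (1/4) ^ k"] by (simp add: suminf_geometric)
    finally show ?thesis by simp
  qed
  have zero: "(\<Sum>j<m. d j) = 0" using ag by (intro sum.neutral) (simp add: d_def agree_def)
  have sp: "suminf d = (\<Sum>j. d (j + k)) + (\<Sum>j<k. d j)" for k by (rule suminf_split_initial_segment[OF ds(1)])
  show "\<bar>base4 a - base4 b\<bar> \<le> 8/3 * (1/4) ^ m" using tail[of m] sp[of m] zero ds(2) by simp
  assume "a m \<noteq> b m"
  then have "1 \<le> \<bar>real (a m) - real (b m)\<bar>" by linarith
  then have "1 * (1/4) ^ m \<le> \<bar>real (a m) - real (b m)\<bar> * (1/4) ^ m" by (rule mult_right_mono) simp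
  then have "(1/4) ^ m \<le> \<bar>d m\<bar>" by (simp add: d_def abs_mult)
  moreover have "suminf d = (\<Sum>j. d (j + Suc m)) + d m" using sp[of "Suc m"] zero by simp
  moreover have "\<bar>\<Sum>j. d (j + Suc m)\<bar> \<le> 2/3 * (1/4) ^ m" using tail[of "Suc m"] by simp
  ultimately show "1/3 * (1/4) ^ m \<le> \<bar>base4 a - base4 b\<bar>" using ds(2) by linarith
qed

section \<open>The four maps and the metric\<close>

locale fractal_model =
  fixes X :: "'a topology" and K :: "'a set" and \<kappa> :: "'a \<Rightarrow> nat \<Rightarrow> nat"
    and N :: nat and \<eta> :: "nat \<Rightarrow> 'a \<Rightarrow> real" and l :: real
  assumes cpt: "compact_space X"
    and K: "openin X K" "closedin X K" and Y_ne: "topspace X - K \<noteq> {}"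
    and \<kappa>_cont: "\<And>x n. x \<in> K \<Longrightarrow> \<exists>U. openin X U \<and> x \<in> U \<and> U \<subseteq> K \<and> (\<forall>y\<in>U. \<forall>k<n. \<kappa> y k = \<kappa> x k)"
    and \<kappa>_inj: "inj_on \<kappa> K" and \<kappa>_le: "\<And>x n. \<kappa> x n \<le> 2"
    and \<kappa>_bin: "\<And>c. (\<And>n. c n < 2) \<Longrightarrow> c \<in> \<kappa> ` K"
    and \<kappa>_tail: "\<And>c. c \<in> \<kappa> ` K \<Longrightarrow> c 0 < 2 \<Longrightarrow> (\<lambda>n. c (Suc n)) \<in> \<kappa> ` K"
    and \<kappa>_thin: "\<And>c. c \<in> \<kappa> ` K \<Longrightarrow> c 0 < 2 \<Longrightarrow> thin (\<lambda>n. c (Suc n)) = (\<lambda>n. c (Suc n))"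
    and \<kappa>_21: "\<And>c. c \<in> \<kappa> ` K \<Longrightarrow> c 0 = 2 \<Longrightarrow> c 1 = 0"
    and \<kappa>_22: "\<And>c n. c \<in> \<kappa> ` K \<Longrightarrow> c 0 = 2 \<Longrightarrow> c (n + 2) < 2"
    and \<kappa>_closed: "\<And>c. (\<And>n. \<exists>x\<in>K. \<forall>k<n. \<kappa> x k = c k) \<Longrightarrow> c \<in> \<kappa> ` K"
    and \<kappa>_two: "(\<lambda>n. if n = 0 then 2 else 0) \<in> \<kappa> ` K"
    and N: "0 < N" and \<eta>_cont: "\<And>c. c < N \<Longrightarrow> continuous_map X euclideanreal (\<eta> c)"
    and \<eta>_inj: "\<And>x y. x \<in> topspace X \<Longrightarrow> y \<in> topspace X \<Longrightarrow> (\<And>c. c < N \<Longrightarrow> \<eta> c x = \<eta> c y) \<Longrightarrow> x = y"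
    and \<eta>_01: "\<And>x c. x \<in> topspace X \<Longrightarrow> c < N \<Longrightarrow> 0 \<le> \<eta> c x \<and> \<eta> c x \<le> 1"
    and l: "0 < l" "l < 1" "l ^ N = 1/2"
begin

abbreviation "S \<equiv> topspace X"

text \<open>
  \<open>R\<close> and \<open>RE\<close> are non-expanding retractions of the sequence space onto the codes \<open>P\<close> of \<open>K\<close> and onto the
  binary expansions \<open>E\<close> of points of \<open>Y\<close>. All points of \<open>Y\<close> share the code \<open>2 1 0 0 \<dots>\<close>, which is not in
  \<open>P\<close>, and are told apart by \<open>\<eta>\<close>.
\<close>

definition "P = \<kappa> ` K"
definition "Y = S - K"
definition "E = {z. (\<forall>n. z n < 2) \<and> (\<exists>y\<in>Y. \<forall>c<N. dyadic_val N z c = \<eta> c y)}"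
definition "R = (SOME r. (\<forall>z. r z \<in> P) \<and> (\<forall>z\<in>P. r z = z) \<and> (\<forall>n z z'. agree n z z' \<longrightarrow> agree n (r z) (r z')))"
definition "RE = (SOME r. (\<forall>z. r z \<in> E) \<and> (\<forall>z\<in>E. r z = z) \<and> (\<forall>n z z'. agree n z z' \<longrightarrow> agree n (r z) (r z')))"
definition "point = inv_into K \<kappa>"
definition "ypoint z = (SOME y. y \<in> Y \<and> (\<forall>c<N. dyadic_val N z c = \<eta> c y))"
definition ycode :: "nat \<Rightarrow> nat" where "ycode n = (if n = 0 then 2 else if n = 1 then 1 else 0)"
definition "kap x = (if x \<in> K then \<kappa> x else ycode)"
definition "eta c x = (if x \<in> K then 0 else \<eta> c x)"
text \<open>Cuts a code off at its first letter 2, so that the map built on binary sequences can be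
  applied to every code. Each letter depends on the prefix up to it, hence agreement is
  preserved.\<close>

definition bin :: "(nat \<Rightarrow> nat) \<Rightarrow> nat \<Rightarrow> nat" where "bin c n = (if \<forall>k\<le>n. c k < 2 then c n else 0)"
text \<open>The first bit selects the target: with \<open>u\<close> binary, \<open>0 z\<close> goes
  to the point coded \<open>2 0 z\<close> if there is one, and \<open>1 z\<close> to the point of
  \<open>Y\<close> with expansion \<open>z\<close>. In both cases the letter 2 is prepended.\<close>

definition "spread u = (if u 0 = (0::nat) then point (R (case_nat 2 (case_nat 0 (\<lambda>n. u (Suc n)))))
    else ypoint (RE (\<lambda>n. u (Suc n))))"
definition "f i x = (if i < (2::nat) then point (R (case_nat i (thin (kap x)))) else spread (bin (kap x)))"

section \<open>Retractions and contraction of codes\<close>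

lemma KS: "K \<subseteq> S"
  using K(1) by (rule openin_subset)

lemma retraction_choice:
  assumes "Q \<noteq> {}" "\<And>z. (\<And>n. \<exists>e\<in>Q. agree n e z) \<Longrightarrow> z \<in> Q"
  shows "\<exists>r. (\<forall>z. r z \<in> Q) \<and> (\<forall>z\<in>Q. r z = z) \<and> (\<forall>n z z'. agree n z z' \<longrightarrow> agree n (r z) (r z'))"
proof -
  obtain r where "\<And>z. r z \<in> Q" "\<And>z. z \<in> Q \<Longrightarrow> r z = z" "\<And>n z z'. agree n z z' \<Longrightarrow> agree n (r z) (r z')"
    using agree_retraction[OF assms] by blast
  then show ?thesis by blast
qed

lemma R: "R z \<in> P" "z \<in> P \<Longrightarrow> R z = z" "agree n z z' \<Longrightarrow> agree n (R z) (R z')"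
proof -
  have "\<exists>r. (\<forall>z. r z \<in> P) \<and> (\<forall>z\<in>P. r z = z) \<and> (\<forall>n z z'. agree n z z' \<longrightarrow> agree n (r z) (r z'))"
  proof (rule retraction_choice)
    show "P \<noteq> {}" using \<kappa>_two by (auto simp: P_def)
    show "z \<in> P" if z: "\<And>n. \<exists>e\<in>P. agree n e z" for z
      unfolding P_def
    proof (rule \<kappa>_closed)
      show "\<exists>x\<in>K. \<forall>k<n. \<kappa> x k = z k" for n using z[of n] by (auto simp: P_def agree_def)
    qed
  qed
  from someI_ex[OF this, folded R_def]
  show "R z \<in> P" "z \<in> P \<Longrightarrow> R z = z" "agree n z z' \<Longrightarrow> agree n (R z) (R z')" by auto
qed

text \<open>A limit of expansions of points of \<open>Y\<close> expands a point of \<open>Y\<close>: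
  the points whose coordinates are within \<open>2 * l ^ n\<close> of the dyadic values form nested
  nonempty closed sets in the compact space.\<close>

lemma E_closed:
  assumes z: "\<And>n. \<exists>e\<in>E. agree n e z"
  shows "z \<in> E"
proof -
  have bin: "z n < 2" for n
  proof -
    obtain e where "e \<in> E" "agree (Suc n) e z" using z by blast
    then show ?thesis by (auto simp: E_def agree_def) (metis lessI)
  qed
  define C where "C = (\<lambda>n. {y \<in> Y. \<forall>c\<in>{..<N}. \<bar>\<eta> c y - dyadic_val N z c\<bar> \<le> 2 * l ^ n})"
  have "(\<Inter>n. C n) \<noteq> {}"
  proof (rule compact_space_imp_nest[OF cpt])
    fix n
    obtain e where e: "e \<in> E" "agree n e z" using z by blast
    then obtain y where y: "y \<in> Y" "\<forall>c<N. dyadic_val N e c = \<eta> c y" by (auto simp: E_def)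
    have "\<bar>\<eta> c y - dyadic_val N z c\<bar> \<le> 2 * l ^ n" if "c < N" for c
    proof -
      have "e k < 2" for k using e(1) by (simp add: E_def)
      then have "\<bar>dyadic_val N e c - dyadic_val N z c\<bar> \<le> 2 * l ^ n"
        using dyadic_val_agree[of e z, OF _ bin e(2) that l] by blast
      then show ?thesis using y(2) that by simp
    qed
    then show "C n \<noteq> {}" using y(1) by (auto simp: C_def)
    have "closedin X {y \<in> S. \<bar>\<eta> c y - dyadic_val N z c\<bar> \<le> 2 * l ^ n}" if "c < N" for c
    proof -
      have "continuous_map X euclideanreal (\<lambda>y. \<bar>\<eta> c y - dyadic_val N z c\<bar>)"
        using \<eta>_cont[OF that] by (intro continuous_intros) auto
      from closedin_continuous_map_preimage[OF this, of "{..2 * l ^ n}"]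
      show ?thesis by (simp add: closed_atMost)
    qed
    then have "closedin X (\<Inter>c\<in>{..<N}. {y \<in> S. \<bar>\<eta> c y - dyadic_val N z c\<bar> \<le> 2 * l ^ n})"
      using N by (intro closedin_INT) auto
    moreover have "closedin X Y" using K(1) by (auto simp: Y_def)
    ultimately have "closedin X (Y \<inter> (\<Inter>c\<in>{..<N}. {y \<in> S. \<bar>\<eta> c y - dyadic_val N z c\<bar> \<le> 2 * l ^ n}))"
      by (intro closedin_Int)
    moreover have "C n = Y \<inter> (\<Inter>c\<in>{..<N}. {y \<in> S. \<bar>\<eta> c y - dyadic_val N z c\<bar> \<le> 2 * l ^ n})"
      by (auto simp: C_def Y_def)
    ultimately show "closedin X (C n)" by simp
  next
    show "decseq C"
      unfolding antimono_def
    proof (intro allI impI)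
      fix m n :: nat assume "m \<le> n"
      then have "l ^ n \<le> l ^ m" using l by (intro power_decreasing) auto
      then have le: "2 * l ^ n \<le> 2 * l ^ m" by simp
      show "C n \<subseteq> C m" unfolding C_def using order_trans[OF _ le] by blast
    qed
  qed
  then obtain y where y: "\<And>n. y \<in> C n" by auto
  have "dyadic_val N z c = \<eta> c y" if c: "c < N" for c
  proof -
    have lim: "(\<lambda>n. 2 * l ^ n) \<longlonglongrightarrow> 0" using l by (intro tendsto_mult_right_zero LIMSEQ_power_zero) auto
    have "\<bar>\<eta> c y - dyadic_val N z c\<bar> \<le> 2 * l ^ n" for n using y[of n] c unfolding C_def by blast
    then have "\<bar>\<eta> c y - dyadic_val N z c\<bar> \<le> 0" by (intro LIMSEQ_le_const[OF lim]) blast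
    then show ?thesis by simp
  qed
  moreover have "y \<in> Y" using y[of 0] unfolding C_def by blast
  ultimately show ?thesis using bin by (auto simp: E_def)
qed

lemma E_surj: "y \<in> Y \<Longrightarrow> \<exists>z\<in>E. \<forall>c<N. dyadic_val N z c = \<eta> c y"
proof -
  assume y: "y \<in> Y"
  have "\<exists>z. (\<forall>n. z n < 2) \<and> (\<forall>c<N. dyadic_val N z c = \<eta> c y)"
    using y \<eta>_01 by (intro dyadic_val_surj) (auto simp: Y_def)
  then show ?thesis using y by (auto simp: E_def)
qed

lemma RE: "RE z \<in> E" "z \<in> E \<Longrightarrow> RE z = z" "agree n z z' \<Longrightarrow> agree n (RE z) (RE z')"
proof -
  have "\<exists>r. (\<forall>z. r z \<in> E) \<and> (\<forall>z\<in>E. r z = z) \<and> (\<forall>n z z'. agree n z z' \<longrightarrow> agree n (r z) (r z'))"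
  proof (rule retraction_choice)
    show "E \<noteq> {}" using E_surj Y_ne by (auto simp: Y_def)
  qed (rule E_closed)
  from someI_ex[OF this, folded RE_def]
  show "RE z \<in> E" "z \<in> E \<Longrightarrow> RE z = z" "agree n z z' \<Longrightarrow> agree n (RE z) (RE z')" by auto
qed

lemma point: "c \<in> P \<Longrightarrow> point c \<in> K" "c \<in> P \<Longrightarrow> \<kappa> (point c) = c"
  unfolding P_def point_def by (auto simp: inv_into_into f_inv_into_f)

lemma point_\<kappa>: "x \<in> K \<Longrightarrow> point (\<kappa> x) = x"
  unfolding point_def using \<kappa>_inj by (rule inv_into_f_f)

lemma ypoint:
  assumes "z \<in> E"
  shows "ypoint z \<in> Y" "c < N \<Longrightarrow> \<eta> c (ypoint z) = dyadic_val N z c"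
proof -
  have "\<exists>y. y \<in> Y \<and> (\<forall>c<N. dyadic_val N z c = \<eta> c y)" using assms by (auto simp: E_def)
  from someI_ex[OF this, folded ypoint_def]
  show "ypoint z \<in> Y" "c < N \<Longrightarrow> \<eta> c (ypoint z) = dyadic_val N z c" by auto
qed

lemma kap_point: "c \<in> P \<Longrightarrow> kap (point c) = c"
  using point by (simp add: kap_def)

lemma kap_Y: "y \<in> Y \<Longrightarrow> kap y = ycode"
  by (simp add: Y_def kap_def)

lemma f_in_S: "f i x \<in> S"
  using point(1)[OF R(1)] ypoint(1)[OF RE(1)] KS by (auto simp: f_def spread_def Y_def)

lemma bin_agree: "agree n c c' \<Longrightarrow> agree n (bin c) (bin c')"
  by (auto simp: agree_def bin_def)

text \<open>The retraction cannot destroy the prefix \<open>2 0\<close>, since it fixes the code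
  \<open>2 0 0 ...\<close> and preserves agreement with it.\<close>

lemma R_20: "agree 2 (R (case_nat 2 (case_nat 0 z))) (case_nat 2 (case_nat 0 z))"
proof -
  let ?c = "\<lambda>n::nat. if n = 0 then 2 else 0 :: nat"
  have "?c \<in> P" using \<kappa>_two by (simp add: P_def)
  moreover have ag: "agree 2 (case_nat 2 (case_nat 0 z)) ?c"
    by (auto simp: agree_def less_Suc_eq numeral_2_eq_2)
  ultimately have "agree 2 (R (case_nat 2 (case_nat 0 z))) ?c" using R(2,3) by metis
  then show ?thesis using ag agree_sym agree_trans by blast
qed

lemma kap_spread_0: "kap (spread u) 0 = 2"
proof (cases "u 0 = 0")
  case True
  then show ?thesis using R_20 kap_point[OF R(1)] by (simp add: spread_def agree_def)
next
  case False
  then show ?thesis using kap_Y[OF ypoint(1)[OF RE(1)]] by (simp add: spread_def ycode_def)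
qed

text \<open>Only codes occur in the hypothesis because \<open>f i\<close> factors through
  \<open>kap\<close>. Prepending a letter gains one position and retractions lose none. The constant
  arises in \<open>Y\<close>: the selecting bit is dropped, so \<open>n - 1\<close> bits agree, and
  \<open>2 * l ^ (n - 1) = 2 / l\<^sup>2 * l ^ Suc n\<close>.\<close>

lemma contract:
  assumes "agree n (kap x) (kap y)"
  shows "agree (Suc n) (kap (f i x)) (kap (f i y))"
    "c < N \<Longrightarrow> \<bar>eta c (f i x) - eta c (f i y)\<bar> \<le> 2 / l\<^sup>2 * l ^ Suc n"
proof -
  have C0: "0 \<le> 2 / l\<^sup>2 * l ^ Suc n" using l by simp
  have "agree (Suc n) (kap (f i x)) (kap (f i y)) \<and> (c < N \<longrightarrow> \<bar>eta c (f i x) - eta c (f i y)\<bar> \<le> 2 / l\<^sup>2 * l ^ Suc n)"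
  proof (cases "i < 2")
    case True
    have "agree (Suc n) (R (case_nat i (thin (kap x)))) (R (case_nat i (thin (kap y))))"
      by (intro R(3) agree_case_nat thin_agree assms)
    then show ?thesis using True C0 point(1)[OF R(1)] by (simp add: f_def kap_point[OF R(1)] eta_def)
  next
    case False
    define u v where "u = bin (kap x)" and "v = bin (kap y)"
    have uv: "agree n u v" unfolding u_def v_def using assms by (rule bin_agree)
    have fx: "f i x = spread u" "f i y = spread v" using False by (simp_all add: f_def u_def v_def)
    have tl: "agree (n - 1) (\<lambda>k. u (Suc k)) (\<lambda>k. v (Suc k))" using uv by (rule agree_tail)
    show ?thesis
    proof (cases n)
      \<comment> \<open>The selecting bits may differ and send one point to \<open>K\<close>, the
        other to \<open>Y\<close>. Both image codes start with 2, and the coordinates are in the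
        unit interval, where the bound \<open>2 / l\<close> is trivial.\<close>
      case 0
      have "\<bar>eta c (spread u) - eta c (spread v)\<bar> \<le> 1" if c: "c < N"
      proof -
        have "0 \<le> eta c (f i x) \<and> eta c (f i x) \<le> 1" for x
          using \<eta>_01[OF f_in_S c] by (simp add: eta_def)
        from this[of x] this[of y] show ?thesis unfolding fx by linarith
      qed
      moreover have "1 \<le> 2 / l\<^sup>2 * l ^ Suc n"
      proof -
        have "2 / l\<^sup>2 * l ^ Suc n = 2 / l" using l 0 by (simp add: power2_eq_square)
        also have "1 \<le> 2 / l" using l by simp
        finally show ?thesis .
      qed
      ultimately show ?thesis using kap_spread_0 0 unfolding fx by (force simp: agree_def)
    next
      case (Suc m)
      then have u0: "u 0 = v 0" using uv by (simp add: agree_def)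
      show ?thesis
      proof (cases "u 0 = 0")
        case True
        let ?a = "case_nat 2 (case_nat 0 (\<lambda>k. u (Suc k)))" and ?b = "case_nat 2 (case_nat 0 (\<lambda>k. v (Suc k)))"
        have "agree (Suc (Suc (n - 1))) (R ?a) (R ?b)" using tl by (intro R(3) agree_case_nat)
        then have "agree (Suc n) (R ?a) (R ?b)" using Suc by simp
        then show ?thesis using True u0 C0 point(1)[OF R(1)] unfolding fx
          by (simp add: spread_def kap_point[OF R(1)] eta_def)
      next
        case False
        define z w where "z = RE (\<lambda>k. u (Suc k))" and "w = RE (\<lambda>k. v (Suc k))"
        have zw: "z \<in> E" "w \<in> E" "agree m z w" using RE(1) RE(3)[OF tl] Suc by (simp_all add: z_def w_def)
        have fz: "f i x = ypoint z" "f i y = ypoint w" using False u0 unfolding fx by (simp_all add: spread_def z_def w_def)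
        have nK: "ypoint z \<notin> K" "ypoint w \<notin> K" using ypoint(1) zw by (auto simp: Y_def)
        have "\<bar>eta c (ypoint z) - eta c (ypoint w)\<bar> \<le> 2 * l ^ m" if c: "c < N"
        proof -
          have "z k < 2" "w k < 2" for k using zw by (auto simp: E_def)
          then have "\<bar>dyadic_val N z c - dyadic_val N w c\<bar> \<le> 2 * l ^ m"
            using dyadic_val_agree[of z w, OF _ _ zw(3) c l] by blast
          then show ?thesis using nK ypoint(2)[OF zw(1) c] ypoint(2)[OF zw(2) c] by (simp add: eta_def)
        qed
        moreover have "2 / l\<^sup>2 * l ^ Suc n = 2 * l ^ m" using l Suc by (simp add: power2_eq_square)
        ultimately show ?thesis using nK unfolding fz by (simp add: kap_def)
      qed
    qed
  qed
  then show "agree (Suc n) (kap (f i x)) (kap (f i y))"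
    "c < N \<Longrightarrow> \<bar>eta c (f i x) - eta c (f i y)\<bar> \<le> 2 / l\<^sup>2 * l ^ Suc n" by auto
qed

section \<open>Each point as the image of its tail\<close>

lemma bin_id: "(\<And>n. c n < 2) \<Longrightarrow> bin c = c"
  by (auto simp: bin_def)

text \<open>Prepending the first letter to the tail gives the code of \<open>x\<close> back, and the
  retraction fixes codes. For first letter 2 the tail is binary with first bit 0, so the third map
  prepends the 2.\<close>

lemma f_point_tail:
  assumes x: "x \<in> K"
  shows "(\<lambda>n. \<kappa> x (Suc n)) \<in> P" "f (\<kappa> x 0) (point (\<lambda>n. \<kappa> x (Suc n))) = x"
proof -
  have xP: "\<kappa> x \<in> \<kappa> ` K" using x by simp
  have "(\<lambda>n. \<kappa> x (Suc n)) \<in> P \<and> f (\<kappa> x 0) (point (\<lambda>n. \<kappa> x (Suc n))) = x"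
  proof (cases "\<kappa> x 0 < 2")
    case True
    have tP: "(\<lambda>n. \<kappa> x (Suc n)) \<in> P" using \<kappa>_tail[OF xP True] by (simp add: P_def)
    have "case_nat (\<kappa> x 0) (thin (\<lambda>n. \<kappa> x (Suc n))) = \<kappa> x"
      unfolding \<kappa>_thin[OF xP True] by (rule case_nat_tail)
    then have "f (\<kappa> x 0) (point (\<lambda>n. \<kappa> x (Suc n))) = point (R (\<kappa> x))"
      using True by (simp add: f_def kap_point[OF tP])
    also have "\<dots> = x" using R(2)[of "\<kappa> x"] xP x by (simp add: P_def point_\<kappa>)
    finally show ?thesis using tP by simp
  next
    case False
    then have c0: "\<kappa> x 0 = 2" using \<kappa>_le[of x 0] by simp
    have b: "\<kappa> x (Suc n) < 2" for n
      using \<kappa>_21[OF xP c0] \<kappa>_22[OF xP c0, of "n - 1"] by (cases n) auto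
    then have tP: "(\<lambda>n. \<kappa> x (Suc n)) \<in> P" using \<kappa>_bin[of "\<lambda>n. \<kappa> x (Suc n)"] by (simp add: P_def)
    have "case_nat 2 (case_nat 0 (\<lambda>n. \<kappa> x (Suc (Suc n)))) = \<kappa> x"
      using c0 \<kappa>_21[OF xP c0] by (intro ext) (simp split: nat.split)
    moreover have "bin (\<lambda>n. \<kappa> x (Suc n)) = (\<lambda>n. \<kappa> x (Suc n))" using b by (rule bin_id)
    ultimately have "f (\<kappa> x 0) (point (\<lambda>n. \<kappa> x (Suc n))) = point (R (\<kappa> x))"
      using c0 \<kappa>_21[OF xP c0] by (simp add: f_def kap_point[OF tP] spread_def)
    also have "\<dots> = x" using R(2)[of "\<kappa> x"] xP x by (simp add: P_def point_\<kappa>)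
    finally show ?thesis using tP by simp
  qed
  then show "(\<lambda>n. \<kappa> x (Suc n)) \<in> P" "f (\<kappa> x 0) (point (\<lambda>n. \<kappa> x (Suc n))) = x" by auto
qed

definition "ybits y = (SOME z. z \<in> E \<and> (\<forall>c<N. dyadic_val N z c = \<eta> c y))"

lemma ybits: "y \<in> Y \<Longrightarrow> ybits y \<in> E" "y \<in> Y \<Longrightarrow> c < N \<Longrightarrow> dyadic_val N (ybits y) c = \<eta> c y"
proof -
  have *: "ybits y \<in> E \<and> (\<forall>c<N. dyadic_val N (ybits y) c = \<eta> c y)" if "y \<in> Y" for y
  proof -
    have "\<exists>z. z \<in> E \<and> (\<forall>c<N. dyadic_val N z c = \<eta> c y)" using E_surj[OF that] by blast
    then show ?thesis unfolding ybits_def by (rule someI_ex)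
  qed
  show "y \<in> Y \<Longrightarrow> ybits y \<in> E" "y \<in> Y \<Longrightarrow> c < N \<Longrightarrow> dyadic_val N (ybits y) c = \<eta> c y" using * by auto
qed

text \<open>Unlike \<open>kap\<close>, this also distinguishes the points of \<open>Y\<close>: it
  lists the letters of maps that lead to the point. Its tail is a code even on \<open>Y\<close>,
  being the binary sequence 1 followed by the expansion.\<close>

definition "full_code x = (if x \<in> K then \<kappa> x else case_nat 2 (case_nat 1 (ybits x)))"

lemma f_full_code_tail:
  assumes x: "x \<in> S"
  shows "(\<lambda>n. full_code x (Suc n)) \<in> P" "f (full_code x 0) (point (\<lambda>n. full_code x (Suc n))) = x"
proof -
  have "(\<lambda>n. full_code x (Suc n)) \<in> P \<and> f (full_code x 0) (point (\<lambda>n. full_code x (Suc n))) = x"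
  proof (cases "x \<in> K")
    case True
    then show ?thesis using f_point_tail[OF True] by (simp add: full_code_def)
  next
    case False
    then have xY: "x \<in> Y" using x by (simp add: Y_def)
    define z where "z = ybits x"
    have z: "z \<in> E" "z k < 2" for k using ybits(1)[OF xY] by (auto simp: z_def E_def)
    have fc: "(\<lambda>n. full_code x (Suc n)) = case_nat 1 z" "full_code x 0 = 2"
      using False by (auto simp: full_code_def z_def)
    have b: "case_nat 1 z n < 2" for n using z(2) by (simp split: nat.split)
    then have P1: "case_nat 1 z \<in> P" using \<kappa>_bin[of "case_nat 1 z"] by (simp add: P_def)
    have "f 2 (point (case_nat 1 z)) = ypoint (RE z)"
      using bin_id[of "case_nat 1 z", OF b] kap_point[OF P1] by (simp add: f_def spread_def del: One_nat_def)
    also have "\<dots> = ypoint z" using RE(2)[OF z(1)] by simp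
    also have "\<dots> = x"
    proof (rule \<eta>_inj)
      show "ypoint z \<in> S" using ypoint(1)[OF z(1)] by (simp add: Y_def)
      show "\<eta> c (ypoint z) = \<eta> c x" if "c < N" for c
        using ypoint(2)[OF z(1) that] ybits(2)[OF xY that] by (simp add: z_def)
    qed (rule x)
    finally show ?thesis using P1 by (simp add: fc)
  qed
  then show "(\<lambda>n. full_code x (Suc n)) \<in> P" "f (full_code x 0) (point (\<lambda>n. full_code x (Suc n))) = x" by auto
qed

lemma full_code_0: "full_code x 0 \<le> 2"
  using \<kappa>_le by (simp add: full_code_def)

section \<open>The system of four maps and the cells of words\<close>

definition "g i = restrict (f i) S"
text \<open>The constant map contracts trivially and brings the number of maps to four; its value
  has code \<open>0 0 0 ...\<close>.\<close>

definition "F = {g 0, g 1, g 2, restrict (\<lambda>_. point (\<lambda>_. 0)) S}"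

primrec word_map :: "nat list \<Rightarrow> 'a \<Rightarrow> 'a" where
  "word_map [] = (\<lambda>x\<in>S. x)"
| "word_map (i # w) = compose S (g i) (word_map w)"

lemma binary_P: "(\<And>n. c n < 2) \<Longrightarrow> c \<in> P"
  using \<kappa>_bin by (simp add: P_def)

lemma F_funcset: "F \<subseteq> S \<rightarrow>\<^sub>E S"
proof -
  have "point (\<lambda>_. 0) \<in> S" using point(1)[OF binary_P] KS by auto
  then show ?thesis using f_in_S by (auto simp: F_def g_def)
qed

lemma F_contract:
  assumes h: "h \<in> F" and x: "x \<in> S" "y \<in> S" and a: "agree n (kap x) (kap y)"
  shows "agree (Suc n) (kap (h x)) (kap (h y))"
    "c < N \<Longrightarrow> \<bar>eta c (h x) - eta c (h y)\<bar> \<le> 2 / l\<^sup>2 * l ^ Suc n"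
proof -
  consider i where "h = g i" | "h = restrict (\<lambda>_. point (\<lambda>_. 0)) S" using h by (auto simp: F_def)
  then have "agree (Suc n) (kap (h x)) (kap (h y)) \<and> (c < N \<longrightarrow> \<bar>eta c (h x) - eta c (h y)\<bar> \<le> 2 / l\<^sup>2 * l ^ Suc n)"
  proof cases
    case (1 i)
    then show ?thesis using contract(1)[OF a, of i] contract(2)[OF a, of c i] x by (simp add: g_def)
  next
    case 2
    then show ?thesis using x l by simp
  qed
  then show "agree (Suc n) (kap (h x)) (kap (h y))"
    "c < N \<Longrightarrow> \<bar>eta c (h x) - eta c (h y)\<bar> \<le> 2 / l\<^sup>2 * l ^ Suc n" by auto
qed

text \<open>The empty word is excluded from the second estimate: the coordinates of the original
  points are uncontrolled, while those of an image are governed by the codes before the last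
  map.\<close>

lemma iterates_contract:
  assumes "h \<in> iterates S F k" "x \<in> S" "y \<in> S" "agree n (kap x) (kap y)"
  shows "agree (n + k) (kap (h x)) (kap (h y)) \<and> h x \<in> S \<and> h y \<in> S \<and>
    (0 < k \<longrightarrow> (\<forall>c<N. \<bar>eta c (h x) - eta c (h y)\<bar> \<le> 2 / l\<^sup>2 * l ^ (n + k)))"
  using assms
proof (induction k arbitrary: h)
  case (Suc k)
  then obtain f' h' where h: "h = compose S f' h'" "f' \<in> F" "h' \<in> iterates S F k" by auto
  have hx: "h x = f' (h' x)" "h y = f' (h' y)" using h(1) Suc.prems by (simp_all add: compose_def)
  have IH: "agree (n + k) (kap (h' x)) (kap (h' y))" "h' x \<in> S" "h' y \<in> S" using Suc.IH[OF h(3) Suc.prems(2-4)] by auto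
  have "f' (h' x) \<in> S" "f' (h' y) \<in> S" using F_funcset h(2) IH by auto
  then show ?case using F_contract[OF h(2) IH(2,3,1)] by (simp add: hx)
qed simp

text \<open>For a letter below 2 the retraction keeps it, as some binary code starts with it. The
  first letter of a value thus tells the three maps apart.\<close>

lemma kap_f_0: "i \<le> 2 \<Longrightarrow> kap (f i x) 0 = i"
proof (cases "i < 2")
  case True
  have "case_nat i (\<lambda>_. 0) \<in> P" using True by (intro binary_P) (simp split: nat.split)
  moreover have "agree 1 (case_nat i (thin (kap x))) (case_nat i (\<lambda>_. 0))" by (simp add: agree_def)
  ultimately have "agree 1 (R (case_nat i (thin (kap x)))) (case_nat i (\<lambda>_. 0))" using R(2,3) by metis
  then show ?thesis using True by (simp add: f_def kap_point[OF R(1)] agree_def)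
next
  case False
  moreover assume "i \<le> 2"
  ultimately show ?thesis using kap_spread_0 by (simp add: f_def)
qed

text \<open>The constant map could only coincide with \<open>g 0\<close>, which shares the first
  letter 0. It does not, since \<open>g 0\<close> also takes the value with code
  \<open>0 1 0 0 ...\<close>.\<close>

lemma card_F: "card F = 4" "finite F"
proof -
  let ?p = "point (\<lambda>_. 0)"
  have zP: "(\<lambda>_. 0) \<in> P" by (rule binary_P) simp
  have p: "?p \<in> S" "kap ?p = (\<lambda>_. 0)" using point(1)[OF zP] KS kap_point[OF zP] by auto
  have ne: "g i \<noteq> h" if "i \<le> 2" "kap (h ?p) 0 \<noteq> i" for i h
    using that p(1) kap_f_0[OF that(1), of ?p] by (auto simp: g_def)
  have gi: "kap (g i ?p) 0 = i" if "i \<le> 2" for i using kap_f_0[OF that] p(1) by (simp add: g_def)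
  have gne: "g i \<noteq> g j" if "i \<le> 2" "j \<le> 2" "i \<noteq> j" for i j
    using gi[OF that(1)] gi[OF that(2)] that(3) by auto
  have "g 0 \<noteq> g 1" "g 0 \<noteq> g 2" "g 1 \<noteq> g 2" by (rule gne; simp)+
  moreover have "g 1 \<noteq> restrict (\<lambda>_. ?p) S" "g 2 \<noteq> restrict (\<lambda>_. ?p) S" by (rule ne; use p in simp)+
  moreover have "g 0 \<noteq> restrict (\<lambda>_. ?p) S"
  proof
    assume eq: "g 0 = restrict (\<lambda>_. ?p) S"
    let ?c = "case_nat 0 (case_nat 1 (\<lambda>_. 0)) :: nat \<Rightarrow> nat"
    have cP: "?c \<in> P" by (rule binary_P) (simp split: nat.split)
    define x where "x = point ?c"
    have x: "x \<in> K" "\<kappa> x = ?c" using point[OF cP] by (auto simp: x_def)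
    have "f 0 (point (\<lambda>n. \<kappa> x (Suc n))) = x" using f_point_tail(2)[OF x(1)] x(2) by simp
    moreover have "point (\<lambda>n. \<kappa> x (Suc n)) \<in> S" using point(1)[OF f_point_tail(1)[OF x(1)]] KS by auto
    ultimately have "x = ?p" using fun_cong[OF eq, of "point (\<lambda>n. \<kappa> x (Suc n))"] by (simp add: g_def)
    then have "?c = (\<lambda>_. 0)" using p(2) x by (simp add: kap_def)
    then have "?c 1 = 0" by (rule fun_cong)
    then show False by simp
  qed
  ultimately show "card F = 4" "finite F" by (auto simp: F_def)
qed

lemma word_map_iterates: "(\<And>i. i \<in> set w \<Longrightarrow> i \<le> 2) \<Longrightarrow> word_map w \<in> iterates S F (length w)"
proof (induction w)
  case (Cons i w)
  have "i \<le> 2" using Cons.prems by simp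
  then have "i = 0 \<or> i = 1 \<or> i = 2" by linarith
  then have "g i \<in> F" by (auto simp: F_def)
  then show ?case using Cons by auto
qed simp

lemma map_upt_Suc_0: "map c [0..<Suc n] = c 0 # map (\<lambda>k. c (Suc k)) [0..<n]"
  by (simp only: map_upt_Suc)

lemma in_word_cell_step:
  assumes x': "x' \<in> word_map w ` S" "x' \<in> S" "f i x' = x"
  shows "x \<in> word_map (i # w) ` S"
proof -
  obtain y where y: "y \<in> S" "x' = word_map w y" using x' by auto
  then have "word_map (i # w) y = x" using x' by (simp add: compose_def g_def)
  then show ?thesis using y(1) by (metis imageI)
qed

lemma in_word_cell_K: "x \<in> K \<Longrightarrow> x \<in> word_map (map (\<kappa> x) [0..<n]) ` S"
proof (induction n arbitrary: x)
  case 0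
  then show ?case using KS by (auto intro!: image_eqI[of _ _ x])
next
  case (Suc n)
  define x' where "x' = point (\<lambda>k. \<kappa> x (Suc k))"
  have x': "x' \<in> K" "\<kappa> x' = (\<lambda>k. \<kappa> x (Suc k))" using f_point_tail(1)[OF Suc.prems] point by (auto simp: x'_def)
  show ?case
    unfolding map_upt_Suc_0
  proof (rule in_word_cell_step)
    show "x' \<in> word_map (map (\<lambda>k. \<kappa> x (Suc k)) [0..<n]) ` S" using Suc.IH[OF x'(1)] by (simp add: x'(2))
    show "x' \<in> S" using x'(1) KS by auto
    show "f (\<kappa> x 0) x' = x" using f_point_tail(2)[OF Suc.prems] by (simp add: x'_def)
  qed
qed

text \<open>After one letter the remaining word is a prefix of the code of a point of
  \<open>K\<close>, also when \<open>x\<close> lies in \<open>Y\<close>; so the induction runs in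
  \<open>K\<close> alone.\<close>

lemma in_word_cell: "x \<in> S \<Longrightarrow> x \<in> word_map (map (full_code x) [0..<n]) ` S"
proof (cases n)
  case 0
  then show "x \<in> S \<Longrightarrow> ?thesis" by (auto intro!: image_eqI[of _ _ x])
next
  case (Suc m)
  assume x: "x \<in> S"
  define x' where "x' = point (\<lambda>k. full_code x (Suc k))"
  have x': "x' \<in> K" "\<kappa> x' = (\<lambda>k. full_code x (Suc k))" using f_full_code_tail(1)[OF x] point by (auto simp: x'_def)
  show ?thesis
    unfolding Suc map_upt_Suc_0
  proof (rule in_word_cell_step)
    show "x' \<in> word_map (map (\<lambda>k. full_code x (Suc k)) [0..<m]) ` S" using in_word_cell_K[OF x'(1), of m] by (simp only: x'(2))
    show "x' \<in> S" using x'(1) KS by auto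
    show "f (full_code x 0) x' = x" using f_full_code_tail(2)[OF x] by (simp add: x'_def)
  qed
qed

lemma full_code_le: "x \<in> S \<Longrightarrow> full_code x n \<le> 2"
  using \<kappa>_le[of x n] ybits(1)[of x] by (auto simp: full_code_def Y_def E_def split: nat.split) (metis less_imp_le)

lemma F_cover: "S = (\<Union>h\<in>F. h ` S)"
proof
  show "S \<subseteq> (\<Union>h\<in>F. h ` S)"
  proof
    fix x assume x: "x \<in> S"
    have x': "point (\<lambda>k. full_code x (Suc k)) \<in> S" using point(1)[OF f_full_code_tail(1)[OF x]] KS by auto
    have "full_code x 0 = 0 \<or> full_code x 0 = 1 \<or> full_code x 0 = 2" using full_code_0[of x] by linarith
    then have "g (full_code x 0) \<in> F" by (auto simp: F_def)
    moreover have "x \<in> g (full_code x 0) ` S"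
      using f_full_code_tail(2)[OF x] x' by (intro image_eqI[of _ _ "point (\<lambda>k. full_code x (Suc k))"]) (simp_all add: g_def)
    ultimately show "x \<in> (\<Union>h\<in>F. h ` S)" by blast
  qed
  show "(\<Union>h\<in>F. h ` S) \<subseteq> S" using F_funcset by fastforce
qed

text \<open>The points of \<open>T\<close> in \<open>K\<close> share one prefix, hence one word. For
  those in \<open>Y\<close> the count of dyadic prefixes with \<open>C = 1\<close> gives
  \<open>2 * 3 + 1 = 7\<close> numerators per coordinate.\<close>

lemma close_count:
  assumes T: "T \<subseteq> S" and ag: "\<And>x y. x \<in> T \<Longrightarrow> y \<in> T \<Longrightarrow> agree n (kap x) (kap y)"
    and et: "\<And>x y c. x \<in> T \<Longrightarrow> y \<in> T \<Longrightarrow> c < N \<Longrightarrow> \<bar>eta c x - eta c y\<bar> \<le> l ^ n"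
  shows "\<exists>\<G>. \<G> \<subseteq> iterates S F n \<and> finite \<G> \<and> card \<G> \<le> 7 ^ N + 1 \<and> T \<subseteq> (\<Union>h\<in>\<G>. h ` S)"
proof -
  define W where "W = (\<lambda>x. map (full_code x) [0..<n]) ` T"
  define A where "A = ybits ` (T - K)"
  have WK: "(\<lambda>x. map (full_code x) [0..<n]) ` (T \<inter> K) \<subseteq> {map (full_code x) [0..<n] | x. x = (SOME x. x \<in> T \<inter> K)}"
  proof
    fix w assume "w \<in> (\<lambda>x. map (full_code x) [0..<n]) ` (T \<inter> K)"
    then obtain x where x: "x \<in> T \<inter> K" "w = map (full_code x) [0..<n]" by auto
    define y where "y = (SOME x. x \<in> T \<inter> K)"
    have y: "y \<in> T \<inter> K" unfolding y_def using x(1) by (rule someI)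
    have "map (full_code x) [0..<n] = map (full_code y) [0..<n]"
      using ag[of x y] x y by (auto simp: full_code_def kap_def agree_def)
    then show "w \<in> {map (full_code x) [0..<n] | x. x = (SOME x. x \<in> T \<inter> K)}" using x by (auto simp: y_def)
  qed
  then have cK: "card ((\<lambda>x. map (full_code x) [0..<n]) ` (T \<inter> K)) \<le> 1"
    using card_mono[OF _ WK] by simp
  have fK: "finite ((\<lambda>x. map (full_code x) [0..<n]) ` (T \<inter> K))" using finite_subset[OF WK] by simp
  have TY: "x \<in> Y" if "x \<in> T - K" for x using that T by (auto simp: Y_def)
  have "finite ((\<lambda>z. map z [0..<n]) ` A) \<and> card ((\<lambda>z. map z [0..<n]) ` A) \<le> (2 * nat \<lceil>2 * 1 + 1 :: real\<rceil> + 1) ^ N"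
  proof (rule dyadic_close_count[OF N l])
    show "z k < 2" if "z \<in> A" for z k using that ybits(1)[OF TY] by (auto simp: A_def E_def)
    fix z z' c assume z: "z \<in> A" "z' \<in> A" "c < N"
    then obtain x x' where x: "x \<in> T - K" "z = ybits x" "x' \<in> T - K" "z' = ybits x'" by (auto simp: A_def)
    have "\<bar>eta c x - eta c x'\<bar> \<le> l ^ n" using et x z(3) by auto
    then show "\<bar>dyadic_val N z c - dyadic_val N z' c\<bar> \<le> 1 * l ^ n"
      using x ybits(2)[OF TY[OF x(1)] z(3)] ybits(2)[OF TY[OF x(3)] z(3)] by (auto simp: eta_def)
  qed simp
  then have A: "finite ((\<lambda>z. map z [0..<n]) ` A)" "card ((\<lambda>z. map z [0..<n]) ` A) \<le> 7 ^ N" by simp_all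
  \<comment> \<open>Truncation by \<open>take n\<close> also covers \<open>n < 2\<close>, where the
    word is shorter than the fixed beginning \<open>2 1\<close>.\<close>
  have full: "map (full_code x) [0..<n] = take n (2 # 1 # map (ybits x) [0..<n])" if "x \<in> T - K" for x
    using that by (intro nth_equalityI) (auto simp: full_code_def nth_Cons split: nat.split)
  have "(\<lambda>x. map (full_code x) [0..<n]) ` (T - K) = (\<lambda>v. take n (2 # 1 # v)) ` (\<lambda>z. map z [0..<n]) ` A"
    unfolding A_def image_image using full by (intro image_cong) auto
  then have Y: "finite ((\<lambda>x. map (full_code x) [0..<n]) ` (T - K))" "card ((\<lambda>x. map (full_code x) [0..<n]) ` (T - K)) \<le> 7 ^ N"
    using A card_image_le[OF A(1), of "\<lambda>v. take n (2 # 1 # v)"] by (simp_all del: One_nat_def)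
  have Wu: "W = (\<lambda>x. map (full_code x) [0..<n]) ` (T \<inter> K) \<union> (\<lambda>x. map (full_code x) [0..<n]) ` (T - K)"
    unfolding W_def by (subst image_Un[symmetric]) (simp add: Int_Diff_Un)
  have fW: "finite W" unfolding Wu using fK Y(1) by simp
  have "card W \<le> 7 ^ N + 1"
    unfolding Wu using card_Un_le[of "(\<lambda>x. map (full_code x) [0..<n]) ` (T \<inter> K)" "(\<lambda>x. map (full_code x) [0..<n]) ` (T - K)"] cK Y(2) by linarith
  then have "card (word_map ` W) \<le> 7 ^ N + 1" using card_image_le[OF fW, of word_map] by linarith
  moreover have "word_map ` W \<subseteq> iterates S F n"
  proof
    fix h assume "h \<in> word_map ` W"
    then obtain x where x: "x \<in> T" "h = word_map (map (full_code x) [0..<n])" by (auto simp: W_def)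
    then show "h \<in> iterates S F n" using word_map_iterates[of "map (full_code x) [0..<n]"] full_code_le T by auto
  qed
  moreover have "T \<subseteq> (\<Union>h\<in>word_map ` W. h ` S)"
  proof
    fix x assume x: "x \<in> T"
    then have "x \<in> word_map (map (full_code x) [0..<n]) ` S" using T by (intro in_word_cell) auto
    then show "x \<in> (\<Union>h\<in>word_map ` W. h ` S)" unfolding W_def using x by blast
  qed
  ultimately show ?thesis using fW by (intro exI[of _ "word_map ` W"]) simp
qed

text \<open>
  Base 4 expansions of the digits of the code in each residue class modulo \<open>2 N\<close> (note
  \<open>l\<^bsup>2 N\<^esup> = 1/4\<close>): the digit at position \<open>k\<close> then gets weight \<open>l\<^sup>k\<close>.
\<close>

definition "emb x i = (if i < 2 * N then l ^ i * base4 (\<lambda>q. kap x (2 * N * q + i)) else if i < 3 * N then eta (i - 2 * N) x else 0)"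
definition "dE x y = L2_set (\<lambda>i. emb x i - emb y i) {..<3 * N}"

section \<open>Estimates for the embedding\<close>

lemma kap_le: "kap x n \<le> 2"
  using \<kappa>_le by (simp add: kap_def ycode_def)

lemma l2N: "l ^ (2 * N) = 1/4"
proof -
  have "l ^ (2 * N) = (l ^ N) ^ 2" by (simp only: mult.commute[of 2] power_mult)
  then show ?thesis by (simp add: l(3) power2_eq_square)
qed

lemma quarter_power: "(1/4) ^ q = l ^ (2 * N * q)"
  by (simp only: power_mult[of l "2 * N" q] l2N)

text \<open>The constant is \<open>8/3\<close> from \<open>base4_diff\<close>, times 4 for rounding
  \<open>n\<close> down to a multiple of \<open>2 * N\<close>, because
  \<open>l ^ (2 * N) = 1/4\<close>.\<close>

lemma emb_close:
  assumes a: "agree n (kap x) (kap y)" and i: "i < 2 * N"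
  shows "\<bar>emb x i - emb y i\<bar> \<le> 32/3 * l ^ n"
proof -
  define q where "q = n div (2 * N)"
  have N2: "0 < 2 * N" using N by simp
  have qn: "2 * N * q \<le> n" "n \<le> 2 * N * q + 2 * N"
    using mod_less_divisor[OF N2, of n] mult_div_mod_eq[of "2 * N" n] unfolding q_def by linarith+
  have "agree q (\<lambda>q. kap x (2 * N * q + i)) (\<lambda>q. kap y (2 * N * q + i))"
    unfolding agree_def
  proof (intro allI impI)
    fix k assume "k < q"
    then have "2 * N * Suc k \<le> 2 * N * q" by (intro mult_le_mono2) simp
    moreover have "2 * N * Suc k = 2 * N * k + 2 * N" by (rule mult_Suc_right[THEN trans], rule add.commute)
    ultimately have "2 * N * k + i < n" using i qn(1) by linarith
    then show "kap x (2 * N * k + i) = kap y (2 * N * k + i)" using a by (simp add: agree_def)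
  qed
  then have "\<bar>base4 (\<lambda>q. kap x (2 * N * q + i)) - base4 (\<lambda>q. kap y (2 * N * q + i))\<bar> \<le> 8/3 * (1/4) ^ q"
    by (intro base4_diff(1) kap_le)
  then have "l ^ i * \<bar>base4 (\<lambda>q. kap x (2 * N * q + i)) - base4 (\<lambda>q. kap y (2 * N * q + i))\<bar> \<le> 1 * (8/3 * (1/4) ^ q)"
    using l by (intro mult_mono) (auto simp: power_le_one)
  moreover have "\<bar>emb x i - emb y i\<bar> = l ^ i * \<bar>base4 (\<lambda>q. kap x (2 * N * q + i)) - base4 (\<lambda>q. kap y (2 * N * q + i))\<bar>"
    using i l by (simp add: emb_def abs_mult flip: right_diff_distrib)
  moreover have "(1/4) ^ q \<le> 4 * l ^ n"
  proof -
    have "(1/4) ^ q = 4 * (l ^ (2 * N * q) * l ^ (2 * N))" unfolding l2N quarter_power by simp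
    also have "\<dots> = 4 * l ^ (2 * N * q + 2 * N)" by (simp only: power_add)
    also have "\<dots> \<le> 4 * l ^ n" using l qn(2) by (intro mult_left_mono power_decreasing) auto
    finally show ?thesis .
  qed
  ultimately show ?thesis by linarith
qed

lemma emb_le_dE: "i < 3 * N \<Longrightarrow> \<bar>emb x i - emb y i\<bar> \<le> dE x y"
  unfolding dE_def using member_le_L2_set[of "{..<3 * N}" i "\<lambda>i. \<bar>emb x i - emb y i\<bar>"] by (simp add: L2_set_def)

text \<open>The coordinate \<open>k mod (2 * N)\<close> meets the first difference at digit
  \<open>k div (2 * N)\<close>, and its scaling makes this digit weigh exactly
  \<open>l ^ k\<close>.\<close>

lemma emb_far:
  assumes a: "agree k (kap x) (kap y)" and ne: "kap x k \<noteq> kap y k"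
  shows "1/3 * l ^ k \<le> dE x y"
proof -
  define i q where "i = k mod (2 * N)" and "q = k div (2 * N)"
  have i: "i < 2 * N" using N by (simp add: i_def)
  have k: "2 * N * q + i = k" unfolding i_def q_def by (rule mult_div_mod_eq)
  have "agree q (\<lambda>q. kap x (2 * N * q + i)) (\<lambda>q. kap y (2 * N * q + i))"
    unfolding agree_def
  proof (intro allI impI)
    fix j assume "j < q"
    then have "2 * N * j < 2 * N * q" using N by simp
    then have "2 * N * j + i < k" using k by linarith
    then show "kap x (2 * N * j + i) = kap y (2 * N * j + i)" using a by (simp add: agree_def)
  qed
  then have "1/3 * (1/4) ^ q \<le> \<bar>base4 (\<lambda>q. kap x (2 * N * q + i)) - base4 (\<lambda>q. kap y (2 * N * q + i))\<bar>"
    using base4_diff(2)[of "\<lambda>q. kap x (2 * N * q + i)" "\<lambda>q. kap y (2 * N * q + i)" q] kap_le ne k by simp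
  then have "l ^ i * (1/3 * (1/4) ^ q) \<le> l ^ i * \<bar>base4 (\<lambda>q. kap x (2 * N * q + i)) - base4 (\<lambda>q. kap y (2 * N * q + i))\<bar>"
    using l by (intro mult_left_mono) auto
  also have "\<dots> = \<bar>emb x i - emb y i\<bar>"
    using i l by (simp add: emb_def abs_mult flip: right_diff_distrib)
  also have "\<dots> \<le> dE x y" using i by (intro emb_le_dE) simp
  also have "l ^ i * (1/3 * (1/4) ^ q) = 1/3 * l ^ k"
    unfolding quarter_power k[symmetric] power_add by simp
  finally show ?thesis .
qed

lemma dE_upper:
  assumes a: "agree n (kap x) (kap y)" and e: "\<And>c. c < N \<Longrightarrow> \<bar>eta c x - eta c y\<bar> \<le> A * l ^ n" and A: "0 \<le> A"
  shows "dE x y \<le> 3 * real N * (32/3 + A) * l ^ n"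
proof -
  have "dE x y \<le> (\<Sum>i<3 * N. \<bar>emb x i - emb y i\<bar>)" unfolding dE_def by (rule L2_set_le_sum_abs)
  also have "\<dots> \<le> (\<Sum>i<3 * N. (32/3 + A) * l ^ n)"
  proof (rule sum_mono)
    fix i assume i: "i \<in> {..<3 * N}"
    have ge: "32/3 * l ^ n \<le> (32/3 + A) * l ^ n" "A * l ^ n \<le> (32/3 + A) * l ^ n" using l A by (auto intro!: mult_right_mono)
    show "\<bar>emb x i - emb y i\<bar> \<le> (32/3 + A) * l ^ n"
    proof (cases "i < 2 * N")
      case True
      then show ?thesis using emb_close[OF a True] ge by linarith
    next
      case False
      then have "\<bar>emb x i - emb y i\<bar> \<le> A * l ^ n" using e[of "i - 2 * N"] i by (simp add: emb_def)
      then show ?thesis using ge by linarith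
    qed
  qed
  finally show ?thesis by simp
qed

lemma dE_agree: "dE x y < 1/3 * l ^ n \<Longrightarrow> agree n (kap x) (kap y)"
proof (rule ccontr)
  assume d: "dE x y < 1/3 * l ^ n" and "\<not> agree n (kap x) (kap y)"
  then have ex: "\<exists>k. k < n \<and> kap x k \<noteq> kap y k" by (auto simp: agree_def)
  define k where "k = (LEAST k. k < n \<and> kap x k \<noteq> kap y k)"
  have k: "k < n" "kap x k \<noteq> kap y k" using LeastI_ex[OF ex] by (auto simp: k_def)
  have "agree k (kap x) (kap y)"
    using not_less_Least[of _ "\<lambda>k. k < n \<and> kap x k \<noteq> kap y k"] k(1) unfolding agree_def k_def[symmetric]
    by (meson less_trans)
  then have "1/3 * l ^ k \<le> dE x y" using k(2) by (rule emb_far)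
  moreover have "l ^ n \<le> l ^ k" using l k(1) by (intro power_decreasing) auto
  ultimately show False using d by linarith
qed

lemma eta_le_dE: "c < N \<Longrightarrow> \<bar>eta c x - eta c y\<bar> \<le> dE x y"
  using emb_le_dE[of "2 * N + c" x y] by (simp add: emb_def)

lemma dE_eq_0:
  assumes x: "x \<in> S" "y \<in> S" and d: "dE x y = 0"
  shows "x = y"
proof -
  have "agree n (kap x) (kap y)" for n using d l by (intro dE_agree) simp
  then have eq: "kap x = kap y" by (rule agree_all_imp_eq)
  \<comment> \<open>A code that starts with 2 continues with 0, whereas \<open>ycode\<close>
    continues with 1; so equal codes put both points on the same side of \<open>K\<close>.\<close>
  have ny: "\<kappa> z \<noteq> ycode" if "z \<in> K" for z
  proof
    assume *: "\<kappa> z = ycode"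
    have "\<kappa> z \<in> \<kappa> ` K" using that by simp
    moreover have "\<kappa> z 0 = 2" using * by (simp add: ycode_def)
    ultimately have "\<kappa> z 1 = 0" by (rule \<kappa>_21)
    then show False using fun_cong[OF *, of 1] by (simp add: ycode_def)
  qed
  have iff: "x \<in> K \<longleftrightarrow> y \<in> K" using eq ny[of x] ny[of y] by (auto simp: kap_def split: if_splits)
  show ?thesis
  proof (cases "x \<in> K")
    case True
    then show ?thesis using eq iff \<kappa>_inj by (auto simp: kap_def inj_on_def)
  next
    case False
    have "\<eta> c x = \<eta> c y" if "c < N" for c
      using eta_le_dE[OF that, of x y] d False iff by (simp add: eta_def)
    then show ?thesis using \<eta>_inj x by blast
  qed
qed

lemma kap_locally: "x \<in> S \<Longrightarrow> \<exists>U. openin X U \<and> x \<in> U \<and> (\<forall>y\<in>U. agree n (kap y) (kap x) \<and> (y \<in> K \<longleftrightarrow> x \<in> K))"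
proof (cases "x \<in> K")
  case True
  from \<kappa>_cont[OF True, of n]
  obtain U where U: "openin X U" "x \<in> U" "U \<subseteq> K" "\<forall>y\<in>U. \<forall>k<n. \<kappa> y k = \<kappa> x k" by (elim exE conjE)
  have "agree n (kap y) (kap x) \<and> (y \<in> K \<longleftrightarrow> x \<in> K)" if "y \<in> U" for y
  proof -
    have "y \<in> K" using that U(3) by auto
    moreover have "agree n (\<kappa> y) (\<kappa> x)" using bspec[OF U(4) that] unfolding agree_def .
    ultimately show ?thesis using True by (simp add: kap_def)
  qed
  then show ?thesis using U(1,2) by blast
next
  case False
  moreover assume "x \<in> S"
  moreover have "openin X (S - K)" using K(2) by auto
  ultimately show ?thesis by (intro exI[of _ "S - K"]) (auto simp: kap_def)
qed

lemma emb_cont: "continuous_map X euclideanreal (\<lambda>x. emb x i)"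
proof -
  have "continuous_map X Met_TC.mtopology (\<lambda>x. emb x i)"
    unfolding Met_TC.continuous_map_to_metric
  proof (intro ballI allI impI)
    fix x and e :: real assume x: "x \<in> S" and e: "0 < e"
    have "\<exists>U. openin X U \<and> x \<in> U \<and> (\<forall>y\<in>U. \<bar>emb y i - emb x i\<bar> < e)"
    proof (cases "i < 2 * N")
      case True
      \<comment> \<open>The denominator 11 exceeds the constant \<open>32/3\<close> of
        \<open>emb_close\<close>.\<close>
      obtain n where n: "l ^ n < e / 11" using real_arch_pow_inv[of "e / 11" l] e l by auto
      obtain U where U: "openin X U" "x \<in> U" "\<forall>y\<in>U. agree n (kap y) (kap x) \<and> (y \<in> K \<longleftrightarrow> x \<in> K)" using kap_locally[OF x] by blast
      have "\<bar>emb y i - emb x i\<bar> < e" if "y \<in> U" for y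
        using emb_close[of n y x i] U(3) that True n e by auto
      then show ?thesis using U by blast
    next
      case False
      show ?thesis
      proof (cases "i < 3 * N \<and> x \<notin> K")
        case T: True
        define c where "c = i - 2 * N"
        have c: "c < N" using T False N unfolding c_def by arith
        obtain U where U: "openin X U" "x \<in> U" "\<forall>y\<in>U. agree 0 (kap y) (kap x) \<and> (y \<in> K \<longleftrightarrow> x \<in> K)" using kap_locally[OF x] by blast
        have "continuous_map X Met_TC.mtopology (\<eta> c)" using \<eta>_cont[OF c] by simp
        from this[unfolded Met_TC.continuous_map_to_metric, rule_format, OF x e]
        obtain V where V: "openin X V" "x \<in> V" "\<forall>y\<in>V. \<eta> c y \<in> ball (\<eta> c x) e" by auto
        have "\<bar>emb y i - emb x i\<bar> < e" if "y \<in> U \<inter> V" for y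
        proof -
          have "y \<notin> K" "dist (\<eta> c x) (\<eta> c y) < e" using that U(3) V(3) T by auto
          then show ?thesis using T False by (simp add: emb_def eta_def c_def dist_real_def abs_minus_commute)
        qed
        then show ?thesis using U V by (intro exI[of _ "U \<inter> V"]) auto
      next
        case F': False
        obtain U where U: "openin X U" "x \<in> U" "\<forall>y\<in>U. agree 0 (kap y) (kap x) \<and> (y \<in> K \<longleftrightarrow> x \<in> K)" using kap_locally[OF x] by blast
        have "\<bar>emb y i - emb x i\<bar> < e" if "y \<in> U" for y
        proof -
          have "y \<in> K \<longleftrightarrow> x \<in> K" using U(3) that by blast
          then have "emb y i = emb x i" using F' False by (simp add: emb_def eta_def)
          then show ?thesis using e by simp
        qed
        then show ?thesis using U(1,2) by blast
      qed
    qed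
    then show "\<exists>U. openin X U \<and> x \<in> U \<and> (\<forall>y\<in>U. emb y i \<in> Met_TC.mball (emb x i) e)"
      by (simp add: dist_real_def abs_minus_commute)
  qed
  then show ?thesis by simp
qed

lemma dE_nonneg: "0 \<le> dE x y"
  by (simp add: dE_def)

text \<open>Distances are compared through prefixes: points at distance about \<open>l ^ n\<close>
  have codes that agree up to position \<open>n\<close>, a word of length \<open>k\<close> raises
  this to \<open>n + k\<close>, and \<open>dE_upper\<close> turns it back into a distance.\<close>

lemma iterates_Lipschitz:
  shows "\<exists>C\<ge>1. \<forall>k. \<forall>h\<in>iterates S F k. \<forall>x\<in>S. \<forall>y\<in>S. dE (h x) (h y) \<le> C * l ^ k * dE x y"
proof -
  define C1 where "C1 = 3 * real N * (32/3 + 2 / l\<^sup>2)"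
  have C1: "0 \<le> C1" using l by (simp add: C1_def)
  define C where "C = max 1 (3 * C1 / l)"
  have "dE (h x) (h y) \<le> C * l ^ k * dE x y" if h: "h \<in> iterates S F k" and x: "x \<in> S" "y \<in> S" for k h x y
  \<comment> \<open>Codes alone do not bound the coordinates for the identity; the 1 in the maximum
    \<open>C\<close> covers this case.\<close>
  proof (cases "k = 0")
    case True
    then have "dE (h x) (h y) = 1 * dE x y" using h x by simp
    also have "\<dots> \<le> C * dE x y" by (intro mult_right_mono) (auto simp: C_def dE_nonneg)
    finally show ?thesis using True by simp
  next
    case False
    show ?thesis
    proof (cases "dE x y = 0")
      case True
      then have "x = y" using dE_eq_0 x by blast
      then show ?thesis by (simp add: dE_def L2_set_def)
    next
      case nz: False
      then have d0: "0 < dE x y" using dE_nonneg[of x y] by simp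
      have "\<exists>n. agree n (kap x) (kap y) \<and> l ^ n \<le> 3 / l * dE x y"
      proof -
        have ex: "\<exists>n. 1/3 * l ^ n \<le> dE x y"
        proof -
          obtain n where "l ^ n < 3 * dE x y" using real_arch_pow_inv[of "3 * dE x y" l] d0 l by auto
          then show ?thesis by (intro exI[of _ n]) simp
        qed
        \<comment> \<open>Minimality gives agreement on \<open>n - 1\<close> letters; passing from
          \<open>l ^ n\<close> to \<open>l ^ (n - 1)\<close> costs the factor
          \<open>1 / l\<close>.\<close>
        define n where "n = (LEAST n. 1/3 * l ^ n \<le> dE x y)"
        have n: "1/3 * l ^ n \<le> dE x y" unfolding n_def using ex by (rule LeastI_ex)
        have ag: "agree (n - 1) (kap x) (kap y)"
        proof (cases n)
          case (Suc m)
          then have "\<not> 1/3 * l ^ m \<le> dE x y" unfolding n_def by (metis lessI not_less_Least)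
          then show ?thesis using dE_agree[of x y m] Suc by simp
        qed (simp add: agree_def)
        have "l * l ^ (n - 1) \<le> l ^ n" using l by (cases n) auto
        then have "l * l ^ (n - 1) \<le> 3 * dE x y" using n by linarith
        then have "l ^ (n - 1) \<le> 3 / l * dE x y" using l by (simp add: field_simps)
        then show ?thesis using ag by blast
      qed
      then obtain n where n: "agree n (kap x) (kap y)" "l ^ n \<le> 3 / l * dE x y" by blast
      have "dE (h x) (h y) \<le> C1 * l ^ (n + k)"
        unfolding C1_def using iterates_contract[OF h x n(1)] False l by (intro dE_upper) auto
      also have "\<dots> = C1 * l ^ k * l ^ n" by (simp add: power_add mult_ac)
      also have "\<dots> \<le> C1 * l ^ k * (3 / l * dE x y)" using n(2) C1 l by (intro mult_left_mono) auto
      also have "\<dots> = (3 * C1 / l) * (l ^ k * dE x y)" by simp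
      also have "\<dots> \<le> C * (l ^ k * dE x y)" using dE_nonneg l by (intro mult_right_mono) (auto simp: C_def)
      finally show ?thesis by (simp add: mult_ac)
    qed
  qed
  then show ?thesis by (intro exI[of _ C]) (auto simp: C_def)
qed

text \<open>The factor \<open>1/4\<close> stays below the \<open>1/3\<close> of
  \<open>dE_agree\<close>, so the codes agree on \<open>n\<close> letters, and the coordinates are
  bounded by the distance.\<close>

lemma dE_count:
  assumes T: "T \<subseteq> S" and d: "\<And>x y. x \<in> T \<Longrightarrow> y \<in> T \<Longrightarrow> dE x y \<le> 1/4 * l ^ n"
  shows "\<exists>\<G>. \<G> \<subseteq> iterates S F n \<and> finite \<G> \<and> card \<G> \<le> 7 ^ N + 1 \<and> T \<subseteq> (\<Union>h\<in>\<G>. h ` S)"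
proof (rule close_count[OF T])
  have pos: "0 < l ^ n" using l by simp
  show "agree n (kap x) (kap y)" if "x \<in> T" "y \<in> T" for x y
    using d[OF that] pos by (intro dE_agree) linarith
  show "\<bar>eta c x - eta c y\<bar> \<le> l ^ n" if "x \<in> T" "y \<in> T" "c < N" for x y c
    using d[OF that(1,2)] eta_le_dE[OF that(3), of x y] pos by linarith
qed

end

section \<open>The Kameyama pseudometric\<close>

lemma iterates_funcset:
  assumes "F \<subseteq> S \<rightarrow>\<^sub>E S"
  shows "iterates S F n \<subseteq> S \<rightarrow>\<^sub>E S"
proof (induction n)
  case (Suc n)
  show ?case
  proof
    fix h assume "h \<in> iterates S F (Suc n)"
    then obtain f g where "h = compose S f g" "f \<in> F" "g \<in> iterates S F n" by auto
    moreover from this have "f \<in> S \<rightarrow> S" "g \<in> S \<rightarrow> S" using assms Suc by auto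
    ultimately show "h \<in> S \<rightarrow>\<^sub>E S" by (auto simp: compose_def)
  qed
qed auto

lemma finite_iterates: "finite F \<Longrightarrow> finite (iterates S F n)"
proof (induction n)
  case (Suc n)
  have "iterates S F (Suc n) = (\<lambda>(f, g). compose S f g) ` (F \<times> iterates S F n)" by auto
  then show ?case using Suc by (simp del: iterates.simps)
qed simp

lemma iterates_cover:
  assumes "S = (\<Union>f\<in>F. f ` S)"
  shows "(\<Union>h\<in>iterates S F n. h ` S) = S"
proof (induction n)
  case (Suc n)
  have "(\<Union>h\<in>iterates S F (Suc n). h ` S) = (\<Union>f\<in>F. \<Union>g\<in>iterates S F n. compose S f g ` S)" by auto
  also have "\<dots> = (\<Union>f\<in>F. f ` (\<Union>g\<in>iterates S F n. g ` S))" by (auto simp: compose_def)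
  also have "\<dots> = S" unfolding Suc using assms by simp
  finally show ?case .
qed auto

lemma compose_iterates:
  assumes F: "F \<subseteq> S \<rightarrow>\<^sub>E S" and h: "h \<in> iterates S F k"
  shows "g \<in> iterates S F n \<Longrightarrow> compose S g h \<in> iterates S F (n + k)"
proof (induction n arbitrary: g)
  case 0
  have "h \<in> S \<rightarrow>\<^sub>E S" using iterates_funcset[OF F] h by blast
  then have "compose S (\<lambda>x\<in>S. x) h = h" by (intro ext) (auto simp: compose_def PiE_def extensional_def)
  moreover have "g = (\<lambda>x\<in>S. x)" using 0 by simp
  ultimately have "compose S g h = h" by (simp only:)
  then show ?case using h by simp
next
  case (Suc n)
  then obtain f g' where g: "g = compose S f g'" "f \<in> F" "g' \<in> iterates S F n" by auto
  have "h \<in> S \<rightarrow> S" using iterates_funcset[OF F] h by blast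
  then have "compose S g h = compose S f (compose S g' h)" unfolding g(1) by (intro ext) (auto simp: compose_def)
  then show ?case using Suc.IH[OF g(3)] g(2) by auto
qed

lemma iterates_continuous:
  assumes F: "F \<subseteq> topspace X \<rightarrow>\<^sub>E topspace X" "\<And>f. f \<in> F \<Longrightarrow> continuous_map X X f"
  shows "h \<in> iterates (topspace X) F n \<Longrightarrow> continuous_map X X h"
proof (induction n arbitrary: h)
  case 0
  then show ?case using continuous_map_id[of X] by (simp add: continuous_map_eq[of X X id])
next
  case (Suc n)
  then obtain f g where h: "h = compose (topspace X) f g" "f \<in> F" "g \<in> iterates (topspace X) F n" by auto
  have "continuous_map X X (f \<circ> g)" using Suc.IH[OF h(3)] F(2)[OF h(2)] by (rule continuous_map_compose)
  then show ?case by (rule continuous_map_eq) (simp add: h(1) compose_def)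
qed

lemma enat_power_nonneg: "0 \<le> r \<Longrightarrow> 0 \<le> enat_power r k"
  by (simp add: enat_power_def split: enat.split)

lemma enat_power_iterate_order_le:
  assumes "f \<in> iterates S F n" "0 \<le> r" "r \<le> 1"
  shows "enat_power r (iterate_order S F f) \<le> r ^ n"
proof -
  have "enat n \<le> iterate_order S F f" unfolding iterate_order_def by (rule Sup_upper) (use assms(1) in auto)
  then show ?thesis using assms by (auto simp: enat_power_def power_decreasing split: enat.split)
qed

text \<open>A finite supremum of a nonempty set of naturals is attained; membership in
  \<open>all_iterates\<close> excludes the empty set, whose supremum is 0.\<close>

lemma iterate_order_enat:
  assumes "f \<in> all_iterates S F" "iterate_order S F f = enat n"
  shows "f \<in> iterates S F n"
proof -
  let ?A = "{enat n |n. f \<in> iterates S F n}"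
  have ne: "?A \<noteq> {}" using assms(1) by (auto simp: all_iterates_def)
  have "finite ?A" using assms(2) ne unfolding iterate_order_def Sup_enat_def by (auto split: if_splits)
  then have "Max ?A = enat n" using assms(2) ne unfolding iterate_order_def Sup_enat_def by (simp split: if_splits)
  then have "enat n \<in> ?A" using Max_in[OF \<open>finite ?A\<close> ne] by simp
  then show ?thesis by auto
qed

lemma iterate_order_infinity:
  assumes "iterate_order S F f = \<infinity>"
  shows "\<exists>n\<ge>m. f \<in> iterates S F n"
proof (rule ccontr)
  assume "\<not> ?thesis"
  then have "{enat n |n. f \<in> iterates S F n} \<subseteq> {..enat m}" by auto (metis linear)
  then have "iterate_order S F f \<le> enat m" unfolding iterate_order_def by (intro Sup_least) auto
  then show False using assms by simp
qed

abbreviation "chain_length S F r fs \<equiv> \<Sum>f\<leftarrow>fs. enat_power r (iterate_order S F f)"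

lemma chain_length_nonneg: "0 \<le> r \<Longrightarrow> 0 \<le> chain_length S F r fs"
  by (induction fs) (auto intro: add_nonneg_nonneg enat_power_nonneg)

lemma Kameyama_less_iff:
  assumes "x \<in> S" "y \<in> S" "0 \<le> r"
  shows "Kameyama_pseudometric S F r x y < e \<longleftrightarrow> (\<exists>fs. Kameyama_chain S F x y fs \<and> chain_length S F r fs < e)"
proof -
  have "Kameyama_chain S F x y [\<lambda>x\<in>S. x]"
    unfolding Kameyama_chain_def all_iterates_def using assms by (auto intro!: exI[of _ 0] image_eqI[of _ _ x] image_eqI[of _ _ y])
  then have "{fs. Kameyama_chain S F x y fs} \<noteq> {}" by blast
  moreover have "bdd_below (chain_length S F r ` {fs. Kameyama_chain S F x y fs})"
    using chain_length_nonneg[OF assms(3)] by (intro bdd_belowI[of _ 0]) auto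
  ultimately show ?thesis using assms by (simp add: Kameyama_pseudometric_def cINF_less_iff)
qed

lemma Kameyama_le_chain:
  assumes "x \<in> S" "y \<in> S" "0 \<le> r" "Kameyama_chain S F x y fs"
  shows "Kameyama_pseudometric S F r x y \<le> chain_length S F r fs"
  using Kameyama_less_iff[OF assms(1-3), of F] assms(4) by (metis less_irrefl not_le)

lemma Kameyama_nonneg: "0 \<le> r \<Longrightarrow> 0 \<le> Kameyama_pseudometric S F r x y"
proof (cases "x \<in> S \<and> y \<in> S")
  case True
  assume r: "0 \<le> r"
  show ?thesis
  proof (rule ccontr)
    assume "\<not> ?thesis"
    then obtain fs where "chain_length S F r fs < 0" using Kameyama_less_iff[of x S y r F 0] True r by auto
    then show False using chain_length_nonneg[OF r, of S F fs] by simp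
  qed
next
  case False
  then have "Kameyama_pseudometric S F r x y = 0" unfolding Kameyama_pseudometric_def by (rule if_not_P)
  then show ?thesis by simp
qed

lemma Kameyama_le_iterate:
  assumes "f \<in> iterates S F n" "x \<in> f ` S" "y \<in> f ` S" "x \<in> S" "y \<in> S" "0 \<le> r" "r \<le> 1"
  shows "Kameyama_pseudometric S F r x y \<le> r ^ n"
proof -
  have "Kameyama_chain S F x y [f]" using assms by (auto simp: Kameyama_chain_def all_iterates_def)
  then have "Kameyama_pseudometric S F r x y \<le> chain_length S F r [f]" using assms by (intro Kameyama_le_chain)
  also have "\<dots> \<le> r ^ n" using enat_power_iterate_order_le[OF assms(1,6,7)] by simp
  finally show ?thesis .
qed

lemma Kameyama_le_1:
  assumes "x \<in> S" "y \<in> S" "0 \<le> r" "r \<le> 1"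
  shows "Kameyama_pseudometric S F r x y \<le> 1"
  using Kameyama_le_iterate[of "\<lambda>x\<in>S. x" S F 0 x y r] assms by simp

lemma Kameyama_chain_rev:
  assumes "Kameyama_chain S F x y fs"
  shows "Kameyama_chain S F y x (rev fs)"
  unfolding Kameyama_chain_def
proof (intro conjI allI impI)
  have fs: "fs \<noteq> []" "x \<in> hd fs ` S" "y \<in> last fs ` S" "set fs \<subseteq> all_iterates S F"
    and step: "\<And>i. Suc i < length fs \<Longrightarrow> (fs ! i) ` S \<inter> (fs ! Suc i) ` S \<noteq> {}"
    using assms by (auto simp: Kameyama_chain_def)
  show "rev fs \<noteq> []" "set (rev fs) \<subseteq> all_iterates S F" "y \<in> hd (rev fs) ` S" "x \<in> last (rev fs) ` S"
    using fs by (simp_all add: hd_rev last_rev)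
  fix i assume i: "Suc i < length (rev fs)"
  define j where "j = length fs - Suc (Suc i)"
  have "rev fs ! i = fs ! Suc j" "rev fs ! Suc i = fs ! j" "Suc j < length fs"
    using i by (simp_all add: rev_nth j_def Suc_diff_Suc)
  then show "rev fs ! i ` S \<inter> rev fs ! Suc i ` S \<noteq> {}" using step[of j] by (simp add: Int_commute)
qed

lemma Kameyama_chain_append:
  assumes "Kameyama_chain S F x y fs" "Kameyama_chain S F y z gs"
  shows "Kameyama_chain S F x z (fs @ gs)"
  unfolding Kameyama_chain_def
proof (intro conjI allI impI)
  have fs: "fs \<noteq> []" "x \<in> hd fs ` S" "y \<in> last fs ` S" "set fs \<subseteq> all_iterates S F"
    and fstep: "\<And>i. Suc i < length fs \<Longrightarrow> (fs ! i) ` S \<inter> (fs ! Suc i) ` S \<noteq> {}"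
    using assms(1) by (auto simp: Kameyama_chain_def)
  have gs: "gs \<noteq> []" "y \<in> hd gs ` S" "z \<in> last gs ` S" "set gs \<subseteq> all_iterates S F"
    and gstep: "\<And>i. Suc i < length gs \<Longrightarrow> (gs ! i) ` S \<inter> (gs ! Suc i) ` S \<noteq> {}"
    using assms(2) by (auto simp: Kameyama_chain_def)
  show "fs @ gs \<noteq> []" "set (fs @ gs) \<subseteq> all_iterates S F" "x \<in> hd (fs @ gs) ` S" "z \<in> last (fs @ gs) ` S"
    using fs gs by simp_all
  fix i assume i: "Suc i < length (fs @ gs)"
  consider "Suc i < length fs" | "Suc i = length fs" | "length fs \<le> i" by linarith
  then show "(fs @ gs) ! i ` S \<inter> (fs @ gs) ! Suc i ` S \<noteq> {}"
  proof cases
    case 1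
    then show ?thesis using fstep[of i] by (simp add: nth_append)
  next
    case 2
    then have "(fs @ gs) ! i = last fs" "(fs @ gs) ! Suc i = hd gs"
      using fs(1) gs(1) by (auto simp: nth_append last_conv_nth hd_conv_nth simp flip: 2)
    then show ?thesis using fs(3) gs(2) by auto
  next
    case 3
    then show ?thesis using gstep[of "i - length fs"] i by (simp add: nth_append Suc_diff_le)
  qed
qed

lemma Kameyama_commute:
  assumes "0 \<le> r"
  shows "Kameyama_pseudometric S F r x y = Kameyama_pseudometric S F r y x"
proof (cases "x \<in> S \<and> y \<in> S")
  case True
  have le: "Kameyama_pseudometric S F r y x \<le> Kameyama_pseudometric S F r x y" if xy: "x \<in> S" "y \<in> S" for x y
  proof (rule ccontr)
    assume "\<not> ?thesis"
    then obtain fs where fs: "Kameyama_chain S F x y fs" "chain_length S F r fs < Kameyama_pseudometric S F r y x"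
      using Kameyama_less_iff[OF xy assms, of F] by (auto simp: not_le)
    have "Kameyama_pseudometric S F r y x \<le> chain_length S F r (rev fs)"
      using xy assms Kameyama_chain_rev[OF fs(1)] by (intro Kameyama_le_chain)
    also have "chain_length S F r (rev fs) = chain_length S F r fs" by (induction fs) simp_all
    finally show False using fs(2) by simp
  qed
  show ?thesis using le[of x y] le[of y x] True by simp
next
  case False
  then show ?thesis unfolding Kameyama_pseudometric_def by (simp only: conj_commute if_False)
qed

lemma Kameyama_triangle:
  assumes "x \<in> S" "y \<in> S" "z \<in> S" "0 \<le> r"
  shows "Kameyama_pseudometric S F r x z \<le> Kameyama_pseudometric S F r x y + Kameyama_pseudometric S F r y z"
proof (rule field_le_epsilon)
  fix e :: real assume "0 < e"
  then have "Kameyama_pseudometric S F r x y < Kameyama_pseudometric S F r x y + e / 2"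
    "Kameyama_pseudometric S F r y z < Kameyama_pseudometric S F r y z + e / 2" by auto
  then obtain fs gs where fs: "Kameyama_chain S F x y fs" "chain_length S F r fs < Kameyama_pseudometric S F r x y + e / 2"
    and gs: "Kameyama_chain S F y z gs" "chain_length S F r gs < Kameyama_pseudometric S F r y z + e / 2"
    using Kameyama_less_iff assms by metis
  have "Kameyama_pseudometric S F r x z \<le> chain_length S F r (fs @ gs)"
    using assms Kameyama_chain_append[OF fs(1) gs(1)] by (intro Kameyama_le_chain)
  then show "Kameyama_pseudometric S F r x z \<le> Kameyama_pseudometric S F r x y + Kameyama_pseudometric S F r y z + e"
    using fs(2) gs(2) by simp
qed

section \<open>The Kameyama metric induces the given topology\<close>

lemma compact_Hausdorff_topology_eq:
  assumes X: "compact_space X" and Y: "Hausdorff_space Y" and eq: "topspace X = topspace Y"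
    and op: "\<And>U. openin Y U \<Longrightarrow> openin X U"
  shows "X = Y"
proof -
  have c: "continuous_map X Y id"
    unfolding continuous_map
  proof (intro conjI allI impI)
    fix U assume U: "openin Y U"
    have "{x \<in> topspace X. id x \<in> U} = U" using openin_subset[OF U] eq by auto
    then show "openin X {x \<in> topspace X. id x \<in> U}" using op[OF U] by simp
  qed (use eq in simp)
  have cl: "closedin Y C" if "closedin X C" for C
  proof -
    have "closed_map X Y id" using X Y c by (intro continuous_imp_closed_map)
    then show ?thesis using that by (simp add: closed_map_def)
  qed
  have "openin Y U" if U: "openin X U" for U
  proof -
    have "closedin X (topspace X - U)" using U by (intro closedin_diff) auto
    then have "closedin Y (topspace Y - U)" using cl eq by simp
    moreover have "U \<subseteq> topspace Y" using openin_subset[OF U] eq by simp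
    ultimately show ?thesis by (simp add: openin_closedin)
  qed
  then show ?thesis using op by (auto simp: topology_eq)
qed

text \<open>Remove from the space the finitely many level-\<open>n\<close> cells that miss
  \<open>x\<close>; they are closed. Every remaining point shares a level-\<open>n\<close> cell with
  \<open>x\<close>, so its distance from \<open>x\<close> is at most \<open>r ^ n\<close>.\<close>

lemma Kameyama_ball_open:
  assumes tfs: "topological_fractal_structure X F" and r: "0 < r" "r < 1" and x: "x \<in> topspace X" and e: "0 < e"
  shows "\<exists>U. openin X U \<and> x \<in> U \<and> (\<forall>y\<in>U. Kameyama_pseudometric (topspace X) F r x y < e)"
proof -
  have X: "compact_space X" "Hausdorff_space X" "finite F" "F \<subseteq> topspace X \<rightarrow>\<^sub>E topspace X"
    "\<And>f. f \<in> F \<Longrightarrow> continuous_map X X f" "topspace X = (\<Union>f\<in>F. f ` topspace X)"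
    using tfs unfolding topological_fractal_structure_def by simp_all
  obtain n where n: "r ^ n < e" using real_arch_pow_inv[OF e r(2)] by blast
  define I where "I = {h \<in> iterates (topspace X) F n. x \<notin> h ` topspace X}"
  have fin: "finite I" using finite_iterates[OF X(3)] by (simp add: I_def)
  have clo: "closedin X (h ` topspace X)" if "h \<in> iterates (topspace X) F n" for h
  proof -
    have "continuous_map X X h" using iterates_continuous[OF X(4,5) that] .
    then have "compactin X (h ` topspace X)" using X(1) by (intro image_compactin) (auto simp: compact_space_def)
    then show ?thesis using X(2) by (rule compactin_imp_closedin[rotated])
  qed
  define U where "U = topspace X - (\<Union>h\<in>I. h ` topspace X)"
  have "closedin X (\<Union>h\<in>I. h ` topspace X)" using fin clo by (intro closedin_Union) (auto simp: I_def)
  then have "openin X U" by (simp add: U_def openin_diff)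
  moreover have "x \<in> U" using x by (auto simp: U_def I_def)
  moreover have "Kameyama_pseudometric (topspace X) F r x y < e" if y: "y \<in> U" for y
  proof -
    have yX: "y \<in> topspace X" using y by (simp add: U_def)
    then obtain h where h: "h \<in> iterates (topspace X) F n" "y \<in> h ` topspace X"
      using iterates_cover[OF X(6), of n] by blast
    then have "x \<in> h ` topspace X" using y by (auto simp: U_def I_def)
    then have "Kameyama_pseudometric (topspace X) F r x y \<le> r ^ n"
      using h x yX r by (intro Kameyama_le_iterate) auto
    then show ?thesis using n by simp
  qed
  ultimately show ?thesis by blast
qed

lemma Kameyama_topology:
  assumes tfs: "topological_fractal_structure X F" and r: "0 < r" "r < 1"
    and m: "Metric_space (topspace X) (Kameyama_pseudometric (topspace X) F r)"
  shows "X = Metric_space.mtopology (topspace X) (Kameyama_pseudometric (topspace X) F r)"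
proof -
  interpret Metric_space "topspace X" "Kameyama_pseudometric (topspace X) F r" by fact
  have "compact_space X" using tfs by (simp add: topological_fractal_structure_def)
  then show ?thesis
  proof (rule compact_Hausdorff_topology_eq)
    fix U assume U: "openin mtopology U"
    show "openin X U"
    proof (subst openin_subopen, intro ballI)
      fix x assume x: "x \<in> U"
      then obtain e where e: "0 < e" "mball x e \<subseteq> U" using U by (auto simp: openin_mtopology)
      have xX: "x \<in> topspace X" using U x by (auto simp: openin_mtopology)
      obtain V where V: "openin X V" "x \<in> V" "\<forall>y\<in>V. Kameyama_pseudometric (topspace X) F r x y < e"
        using Kameyama_ball_open[OF tfs r xX e(1)] by blast
      have "V \<subseteq> mball x e" using V(3) openin_subset[OF V(1)] xX by auto
      then show "\<exists>T. openin X T \<and> x \<in> T \<and> T \<subseteq> U" using V e(2) by blast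
    qed
  qed (simp_all add: Hausdorff_space_mtopology)
qed

lemma doubling_Kameyama_imp_finite_dimensional:
  assumes tfs: "topological_fractal_structure X F" and r: "0 < r" "r < 1"
    and m: "Metric_space (topspace X) (Kameyama_pseudometric (topspace X) F r)"
    and d: "doubling (topspace X) (Kameyama_pseudometric (topspace X) F r)"
  shows "finite_dimensional X"
proof -
  have "\<exists>n. Metric_space.mtopology (topspace X) (Kameyama_pseudometric (topspace X) F r) dim_le n"
  proof (rule doubling_imp_dim_le[OF m d])
    show "Kameyama_pseudometric (topspace X) F r x y \<le> 1" if "x \<in> topspace X" "y \<in> topspace X" for x y
      using that r by (intro Kameyama_le_1) auto
  qed
  then show ?thesis using Kameyama_topology[OF assms(1-4)] by (simp add: finite_dimensional_def)
qed

section \<open>Systems whose iterates contract\<close>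

text \<open>As \<open>C \<ge> 1\<close>, a single map may expand distances and only long words
  contract. Hence the same system is used directly for the Kameyama metric but through an iterate
  for Euclidean fractals.\<close>

locale contracting_system = Metric_space S d for S :: "'a set" and d +
  fixes F :: "('a \<Rightarrow> 'a) set" and r C :: real
  assumes compact: "compact_space mtopology"
    and F: "F \<subseteq> S \<rightarrow>\<^sub>E S" "finite F" and cover: "S = (\<Union>f\<in>F. f ` S)"
    and ne: "S \<noteq> {}" and r: "0 < r" "r < 1" and C: "1 \<le> C"
    and Lipschitz: "\<And>k h x y. h \<in> iterates S F k \<Longrightarrow> x \<in> S \<Longrightarrow> y \<in> S \<Longrightarrow> d (h x) (h y) \<le> C * r ^ k * d x y"
begin

lemma iterates_in: "h \<in> iterates S F k \<Longrightarrow> x \<in> S \<Longrightarrow> h x \<in> S"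
  using iterates_funcset[OF F(1), of k] by auto

lemma bounded_diam: "\<exists>D>0. \<forall>x\<in>S. \<forall>y\<in>S. d x y \<le> D"
proof -
  have "mbounded S" using compact compactin_imp_mbounded[of S] by (simp add: compact_space_def)
  then show ?thesis by (auto simp: mbounded_alt_pos)
qed

lemma F_continuous: "f \<in> F \<Longrightarrow> continuous_map mtopology mtopology f"
proof -
  assume f: "f \<in> F"
  have "f \<in> S \<rightarrow>\<^sub>E S" using F(1) f by blast
  then have "compose S f (\<lambda>x\<in>S. x) = f" by (intro ext) (auto simp: compose_def PiE_def extensional_def)
  then have f1: "f \<in> iterates S F 1" using f by force
  show ?thesis
    unfolding continuous_map_to_metric
  proof (intro ballI allI impI)
    fix x e assume x: "x \<in> topspace mtopology" and e: "0 < (e::real)"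
    have xS: "x \<in> S" using x by simp
    show "\<exists>U. openin mtopology U \<and> x \<in> U \<and> (\<forall>y\<in>U. f y \<in> mball (f x) e)"
    proof (intro exI[of _ "mball x (e / C)"] conjI ballI)
      show "x \<in> mball x (e / C)" using xS e C by simp
      fix y assume y: "y \<in> mball x (e / C)"
      then have "d (f x) (f y) \<le> C * r ^ 1 * d x y" using Lipschitz[OF f1, of x y] by simp
      also have "\<dots> \<le> C * d x y" using r C y by (simp add: mult_left_le_one_le)
      also have "\<dots> < e" using y C by (simp add: field_simps)
      finally show "f y \<in> mball (f x) e" using iterates_in[OF f1] y xS by simp
    qed simp
  qed
qed

lemma Lebesgue_number:
  assumes "\<And>U. U \<in> \<U> \<Longrightarrow> openin mtopology U" "\<Union>\<U> = S" "S \<noteq> {}"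
  shows "\<exists>e>0. \<forall>x\<in>S. \<exists>U\<in>\<U>. mball x e \<subseteq> U"
proof -
  define R where "R = (\<lambda>x e. 0 < e \<and> (\<exists>U\<in>\<U>. mball x (2 * e) \<subseteq> U))"
  have "\<forall>x\<in>S. \<exists>e. R x e"
  proof
    fix x assume "x \<in> S"
    then obtain U where U: "U \<in> \<U>" "x \<in> U" using assms(2) by auto
    then obtain e where "0 < e" "mball x e \<subseteq> U" using assms(1)[OF U(1)] by (auto simp: openin_mtopology)
    then show "\<exists>e. R x e" unfolding R_def using U(1) by (intro exI[of _ "e / 2"]) auto
  qed
  then obtain \<rho> where \<rho>: "\<forall>x\<in>S. R x (\<rho> x)" by (rule bchoice [THEN exE])
  define \<B> where "\<B> = (\<lambda>x. mball x (\<rho> x)) ` S"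
  have "\<forall>B\<in>\<B>. openin mtopology B" "S \<subseteq> \<Union>\<B>" using \<rho> by (auto simp: \<B>_def R_def)
  then obtain \<F> where \<F>: "finite \<F>" "\<F> \<subseteq> \<B>" "S \<subseteq> \<Union>\<F>"
    using compact unfolding compact_space_alt by (metis topspace_mtopology)
  then obtain A where A: "A \<subseteq> S" "finite A" "\<F> = (\<lambda>x. mball x (\<rho> x)) ` A"
    using finite_subset_image[of \<F> "\<lambda>x. mball x (\<rho> x)" S] by (auto simp: \<B>_def)
  have "A \<noteq> {}" using A(3) \<F>(3) assms(3) by auto
  define e where "e = Min (\<rho> ` A)"
  have e: "0 < e" "\<And>a. a \<in> A \<Longrightarrow> e \<le> \<rho> a"
    using A \<rho> \<open>A \<noteq> {}\<close> by (auto simp: e_def R_def)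
  have "\<exists>U\<in>\<U>. mball x e \<subseteq> U" if x: "x \<in> S" for x
  proof -
    obtain a where a: "a \<in> A" "x \<in> mball a (\<rho> a)" using \<F>(3) x A(3) by auto
    have "R a (\<rho> a)" using \<rho> a(1) A(1) by blast
    then obtain U where U: "U \<in> \<U>" "mball a (2 * \<rho> a) \<subseteq> U" unfolding R_def by (elim conjE bexE)
    have "mball x e \<subseteq> mball a (2 * \<rho> a)"
      using a(2) e(2)[OF a(1)] x by (intro mball_subset) (auto simp: commute)
    then show ?thesis using U by blast
  qed
  then show ?thesis using e(1) by blast
qed

lemma topologically_contracting: "topologically_contracting mtopology F"
  unfolding topologically_contracting_def topspace_mtopology
proof (intro allI impI)
  fix \<U> assume U: "(\<forall>U\<in>\<U>. openin mtopology U) \<and> \<Union>\<U> = S"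
  show "\<exists>n. \<forall>f\<in>iterates S F n. \<exists>U\<in>\<U>. f ` S \<subseteq> U"
  proof -
    obtain e where e: "0 < e" "\<forall>x\<in>S. \<exists>U\<in>\<U>. mball x e \<subseteq> U" using Lebesgue_number[of \<U>] U ne by blast
    obtain D where D: "0 < D" "\<forall>x\<in>S. \<forall>y\<in>S. d x y \<le> D" using bounded_diam by blast
    obtain n where n: "r ^ n < e / (C * D)" using real_arch_pow_inv[of "e / (C * D)" r] e D C r by auto
    have "\<exists>U\<in>\<U>. h ` S \<subseteq> U" if h: "h \<in> iterates S F n" for h
    proof -
      obtain x where x: "x \<in> S" using ne by auto
      obtain U where U: "U \<in> \<U>" "mball (h x) e \<subseteq> U" using e(2) iterates_in[OF h x] by blast
      have "h y \<in> mball (h x) e" if y: "y \<in> S" for y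
      proof -
        have "d (h x) (h y) \<le> C * r ^ n * d x y" using Lipschitz[OF h x y] .
        also have "\<dots> \<le> C * r ^ n * D" using D x y C r by (intro mult_left_mono) auto
        also have "\<dots> < e" using n C D by (simp add: field_simps)
        finally show ?thesis using iterates_in[OF h] x y by simp
      qed
      then show ?thesis using U by blast
    qed
    then show ?thesis by blast
  qed
qed

lemma topological_fractal_structure: "topological_fractal_structure mtopology F"
  unfolding topological_fractal_structure_def topspace_mtopology
  using compact Hausdorff_space_mtopology F cover F_continuous topologically_contracting by simp

text \<open>A word of infinite order belongs to arbitrarily long iterates, so its image is a single
  point, in accordance with the value 0 of the power.\<close>

lemma dist_le_enat_power:
  assumes D: "\<forall>x\<in>S. \<forall>y\<in>S. d x y \<le> D" and h: "h \<in> all_iterates S F" and x: "x \<in> h ` S" "y \<in> h ` S"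
  shows "d x y \<le> C * D * enat_power r (iterate_order S F h)"
proof -
  obtain u v where uv: "u \<in> S" "v \<in> S" "x = h u" "y = h v" using x by auto
  have D0: "0 \<le> D" using D uv(1) by (metis mdist_zero order_refl)
  have le: "d x y \<le> C * D * r ^ n" if "h \<in> iterates S F n" for n
  proof -
    have "d x y \<le> C * r ^ n * d u v" using Lipschitz[OF that uv(1,2)] uv by simp
    also have "\<dots> \<le> C * r ^ n * D" using D uv C r by (intro mult_left_mono) auto
    finally show ?thesis by (simp add: mult_ac)
  qed
  show ?thesis
  proof (cases "iterate_order S F h")
    case (enat n)
    then show ?thesis using le[OF iterate_order_enat[OF h enat]] by (simp add: enat_power_def)
  next
    case infinity
    have "d x y \<le> 0"
    proof (rule ccontr)
      assume "\<not> ?thesis"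
      then have pos: "0 < d x y" by simp
      then have "0 < C * D" using le[of _] h C D0 by (metis (no_types, lifting) all_iterates_def UN_E le_less mult_eq_0_iff mult_nonneg_nonneg not_less order_trans zero_le_one)
      then obtain m where m: "r ^ m < d x y / (C * D)" using real_arch_pow_inv[of "d x y / (C * D)" r] pos r by auto
      obtain n where n: "n \<ge> m" "h \<in> iterates S F n" using iterate_order_infinity[OF infinity] by blast
      have "d x y \<le> C * D * r ^ n" using le[OF n(2)] .
      also have "\<dots> \<le> C * D * r ^ m" using \<open>0 < C * D\<close> n(1) r by (intro mult_left_mono power_decreasing) auto
      also have "\<dots> < d x y" using m \<open>0 < C * D\<close> by (simp add: field_simps)
      finally show False by simp
    qed
    then show ?thesis using infinity by (simp add: enat_power_def)
  qed
qed

lemma dist_le_chain: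
  assumes D: "\<forall>x\<in>S. \<forall>y\<in>S. d x y \<le> D"
  shows "Kameyama_chain S F x y fs \<Longrightarrow> x \<in> S \<Longrightarrow> y \<in> S \<Longrightarrow> d x y \<le> C * D * chain_length S F r fs"
proof (induction fs arbitrary: x)
  case Nil
  then show ?case by (simp add: Kameyama_chain_def)
next
  case (Cons f fs)
  have f: "f \<in> all_iterates S F" "x \<in> f ` S" using Cons.prems(1) by (auto simp: Kameyama_chain_def)
  show ?case
  proof (cases "fs = []")
    case True
    then have "y \<in> f ` S" using Cons.prems(1) by (auto simp: Kameyama_chain_def)
    then show ?thesis using dist_le_enat_power[OF D f] True by simp
  next
    case False
    have step: "\<And>i. Suc i < length (f # fs) \<Longrightarrow> ((f # fs) ! i) ` S \<inter> ((f # fs) ! Suc i) ` S \<noteq> {}"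
      using Cons.prems(1) by (auto simp: Kameyama_chain_def)
    from step[of 0] False obtain z where z: "z \<in> f ` S" "z \<in> hd fs ` S" by (auto simp: hd_conv_nth)
    have zS: "z \<in> S" using z(1) f(1) iterates_in by (auto simp: all_iterates_def)
    have "Kameyama_chain S F z y fs"
      unfolding Kameyama_chain_def using Cons.prems(1) False z(2) step[of "Suc _"] by (auto simp: Kameyama_chain_def)
    then have "d z y \<le> C * D * chain_length S F r fs" using Cons.IH[of z] zS Cons.prems(3) by blast
    moreover have "d x z \<le> C * D * enat_power r (iterate_order S F f)" using dist_le_enat_power[OF D f(1) f(2) z(1)] .
    moreover have "d x y \<le> d x z + d z y" using Cons.prems zS by (intro triangle)
    ultimately show ?thesis by (simp add: distrib_left)
  qed
qed

abbreviation "p \<equiv> Kameyama_pseudometric S F r"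

lemma dist_le_Kameyama: "\<exists>B\<ge>1. \<forall>x\<in>S. \<forall>y\<in>S. d x y \<le> B * p x y"
proof -
  obtain D where D: "0 < D" "\<forall>x\<in>S. \<forall>y\<in>S. d x y \<le> D" using bounded_diam by blast
  \<comment> \<open>The maximum makes \<open>B\<close> at least 1, so that division by it is
    harmless.\<close>
  define B where "B = max 1 (C * D)"
  have "d x y \<le> B * p x y" if xy: "x \<in> S" "y \<in> S" for x y
  proof (rule ccontr)
    assume "\<not> ?thesis"
    then have "p x y < d x y / B" by (simp add: B_def field_simps)
    then obtain fs where fs: "Kameyama_chain S F x y fs" "chain_length S F r fs < d x y / B"
      using Kameyama_less_iff[OF xy, of r F] r by auto
    have "d x y \<le> C * D * chain_length S F r fs" using dist_le_chain[OF D(2) fs(1) xy] .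
    also have "\<dots> \<le> B * chain_length S F r fs"
      using chain_length_nonneg[of r S F fs] r by (intro mult_right_mono) (auto simp: B_def)
    also have "\<dots> < d x y" using fs(2) by (simp add: B_def field_simps)
    finally show False by simp
  qed
  then show ?thesis by (intro exI[of _ B]) (auto simp: B_def)
qed

text \<open>Distinct points have positive distance since \<open>d\<close> is bounded by a multiple
  of \<open>p\<close>; a point has distance 0 to itself because it lies in cells of every
  level.\<close>

lemma Metric_space_Kameyama: "Metric_space S p"
proof
  fix x y z
  show "0 \<le> p x y" using r by (intro Kameyama_nonneg) simp
  show "p x y = p y x" using r by (intro Kameyama_commute) simp
  assume xyz: "x \<in> S" "y \<in> S"
  show "p x z \<le> p x y + p y z" if "z \<in> S" using xyz that r by (intro Kameyama_triangle) auto
  show "p x y = 0 \<longleftrightarrow> x = y"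
  proof
    assume 0: "p x y = 0"
    obtain B where "1 \<le> B" "d x y \<le> B * p x y" using dist_le_Kameyama xyz by blast
    then have "d x y \<le> 0" using 0 by simp
    then show "x = y" using nonneg[of x y] zero[of x y] xyz by simp
  next
    assume "x = y"
    have "p x y \<le> r ^ n" for n
    proof -
      obtain h where "h \<in> iterates S F n" "x \<in> h ` S" using iterates_cover[OF cover, of n] xyz(1) by blast
      then show ?thesis using xyz r \<open>x = y\<close> by (intro Kameyama_le_iterate) auto
    qed
    moreover have "(\<lambda>n. r ^ n) \<longlonglongrightarrow> 0" using r by (intro LIMSEQ_power_zero) auto
    ultimately have "p x y \<le> 0" by (intro LIMSEQ_le_const[of _ _ "p x y"]) blast+
    moreover have "0 \<le> p x y" using r by (intro Kameyama_nonneg) simp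
    ultimately show "p x y = 0" by simp
  qed
qed

text \<open>For diameter \<open>\<delta>\<close> with
  \<open>r ^ (m + 1) < \<delta> \<le> r ^ m\<close>, the \<open>d\<close>-diameter is at most
  \<open>B * r ^ m \<le> a * r ^ (m - j)\<close>, so boundedly many cells of level
  \<open>m - j\<close> cover the set. Refining each by \<open>j + k\<close> levels gives cells of
  \<open>p\<close>-diameter at most \<open>r ^ (m + k) \<le> \<delta> / 2\<close>, and the number of
  refinements depends on \<open>j + k\<close> only.\<close>

lemma doubling_Kameyama:
  assumes a: "0 < a" and count: "\<And>n T. T \<subseteq> S \<Longrightarrow> (\<And>x y. x \<in> T \<Longrightarrow> y \<in> T \<Longrightarrow> d x y \<le> a * r ^ n) \<Longrightarrow>
     \<exists>\<G>. \<G> \<subseteq> iterates S F n \<and> finite \<G> \<and> card \<G> \<le> M \<and> T \<subseteq> (\<Union>h\<in>\<G>. h ` S)"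
  shows "doubling S p"
proof -
  interpret K: Metric_space S p by (rule Metric_space_Kameyama)
  obtain B where B: "1 \<le> B" "\<forall>x\<in>S. \<forall>y\<in>S. d x y \<le> B * p x y" using dist_le_Kameyama by blast
  obtain j where j: "r ^ j < a / B" using real_arch_pow_inv[of "a / B" r] a B r by auto
  obtain k where k: "r ^ k < r / 2" using real_arch_pow_inv[of "r / 2" r] r by auto
  define L where "L = card (iterates S F (j + k))"
  define N where "N = max 1 (max 1 M * L)"
  show ?thesis
    unfolding doubling_def
  proof (intro exI[of _ N] allI impI)
    fix T assume T: "T \<subseteq> S"
    have "ediam p T \<le> ennreal 1" using T r by (intro ediam_leI Kameyama_le_1) auto
    then obtain \<delta> where \<delta>: "ediam p T = ennreal \<delta>" "0 \<le> \<delta>" "\<delta> \<le> 1"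
      by (cases "ediam p T") (auto simp: ennreal_le_iff top_unique simp del: ennreal_1)
    have pT: "p x y \<le> \<delta>" if "x \<in> T" "y \<in> T" for x y
      using ediam_leD[of p T \<delta> x y] \<delta> that by simp
    show "\<exists>\<A>. finite \<A> \<and> card \<A> \<le> N \<and> T \<subseteq> \<Union>\<A> \<and> (\<forall>A\<in>\<A>. A \<subseteq> S \<and> ediam p A \<le> ediam p T / 2)"
    proof (cases "\<delta> = 0")
      case True
      then show ?thesis using \<delta>(1) T by (intro exI[of _ "{T}"]) (simp add: N_def)
    next
      case False
      then have \<delta>0: "0 < \<delta>" using \<delta>(2) by simp
      have ex: "\<exists>m. r ^ m < \<delta>" using real_arch_pow_inv[OF \<delta>0 r(2)] .
      define m' where "m' = (LEAST m. r ^ m < \<delta>)"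
      have m': "r ^ m' < \<delta>" unfolding m'_def using ex by (rule LeastI_ex)
      have "m' \<noteq> 0"
      proof
        assume "m' = 0"
        then show False using m' \<delta>(3) by simp
      qed
      then obtain m where m: "m' = Suc m" by (cases m') auto
      have rm: "\<delta> \<le> r ^ m"
      proof (rule ccontr)
        assume "\<not> ?thesis"
        then have "(LEAST m. r ^ m < \<delta>) \<le> m" by (intro Least_le) simp
        then show False using m by (simp add: m'_def)
      qed
      obtain n \<G> where n: "m \<le> n + j" and G: "\<G> \<subseteq> iterates S F n" "finite \<G>" "card \<G> \<le> max 1 M" "T \<subseteq> (\<Union>h\<in>\<G>. h ` S)"
      proof (cases "j \<le> m")
        case True
        have dT: "d x y \<le> a * r ^ (m - j)" if "x \<in> T" "y \<in> T" for x y
        proof -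
          have "d x y \<le> B * p x y" using B(2) T that by auto
          also have "\<dots> \<le> B * r ^ m" using pT[OF that] rm B by (intro mult_left_mono) auto
          also have "\<dots> = B * r ^ j * r ^ (m - j)" using True by (simp flip: power_add)
          also have "\<dots> \<le> a * r ^ (m - j)" using j B(1) r by (intro mult_right_mono) (auto simp: field_simps)
          finally show ?thesis .
        qed
        have "\<exists>\<G>. \<G> \<subseteq> iterates S F (m - j) \<and> finite \<G> \<and> card \<G> \<le> M \<and> T \<subseteq> (\<Union>h\<in>\<G>. h ` S)"
          using T by (rule count) (rule dT)
        then obtain \<G> where "\<G> \<subseteq> iterates S F (m - j)" "finite \<G>" "card \<G> \<le> M" "T \<subseteq> (\<Union>h\<in>\<G>. h ` S)"
          by (elim exE conjE)
        then show thesis using True by (intro that[of "m - j" \<G>]) auto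
      next
        \<comment> \<open>For \<open>m < j\<close> the whole space, the only cell of level 0, is
          coarse by a bounded number of levels.\<close>
        case False
        then show thesis using T by (intro that[of 0 "{\<lambda>x\<in>S. x}"]) auto
      qed
      define \<A> where "\<A> = (\<lambda>(g, h). compose S g h ` S) ` (\<G> \<times> iterates S F (j + k))"
      have fin: "finite (\<G> \<times> iterates S F (j + k))" using G(2) finite_iterates[OF F(2)] by simp
      have "card \<A> \<le> card (\<G> \<times> iterates S F (j + k))" unfolding \<A>_def using fin by (rule card_image_le)
      also have "\<dots> = card \<G> * L" by (simp add: card_cartesian_product L_def)
      also have "\<dots> \<le> max 1 M * L" using G(3) by (rule mult_right_mono) simp
      finally have cA: "card \<A> \<le> N" by (simp add: N_def)
      have TA: "T \<subseteq> \<Union>\<A>"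
      proof
        fix x assume "x \<in> T"
        then obtain g y where g: "g \<in> \<G>" "y \<in> S" "x = g y" using G(4) by auto
        obtain h z where h: "h \<in> iterates S F (j + k)" "z \<in> S" "y = h z"
          using iterates_cover[OF cover, of "j + k"] g(2) by blast
        have "x = compose S g h z" using g h by (simp add: compose_def)
        then show "x \<in> \<Union>\<A>" unfolding \<A>_def using g(1) h(1,2) by auto
      qed
      have small: "A \<subseteq> S \<and> ediam p A \<le> ediam p T / 2" if A: "A \<in> \<A>" for A
      proof -
        obtain g h where gh: "g \<in> \<G>" "h \<in> iterates S F (j + k)" "A = compose S g h ` S" using A by (auto simp: \<A>_def)
        have it: "compose S g h \<in> iterates S F (n + (j + k))" using compose_iterates[OF F(1) gh(2)] G(1) gh(1) by blast
        have AS: "A \<subseteq> S" using iterates_in[OF it] gh(3) by auto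
        have "p x y \<le> \<delta> / 2" if xy: "x \<in> A" "y \<in> A" for x y
        proof -
          have "p x y \<le> r ^ (n + (j + k))" using it xy gh(3) AS r by (intro Kameyama_le_iterate) auto
          also have "\<dots> \<le> r ^ (m + k)" using r n by (intro power_decreasing) auto
          also have "\<dots> \<le> r ^ m * (r / 2)" unfolding power_add using k r by (intro mult_left_mono) auto
          also have "\<dots> = r ^ m' / 2" by (simp add: m)
          finally show ?thesis using m' by linarith
        qed
        then have "ediam p A \<le> ennreal (\<delta> / 2)" by (rule ediam_leI)
        also have "ennreal (\<delta> / 2) = ediam p T / 2"
          using divide_ennreal[of \<delta> 2] \<delta> by simp
        finally show ?thesis using AS by simp
      qed
      have "finite \<A>" unfolding \<A>_def using fin by (rule finite_imageI)
      then show ?thesis using cA TA small by (intro exI[of _ \<A>]) simp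
    qed
  qed
qed

end

section \<open>Fractals in Euclidean space\<close>

lemma mtopology_of_Euclidean_space_metric:
  "mtopology_of (Euclidean_space_metric m) =
     Metric_space.mtopology (topspace (Euclidean_space m)) (\<lambda>x y. L2_set (\<lambda>i. x i - y i) {..<m})"
  unfolding Euclidean_space_metric_def by (rule Metric_space.mtopology_of[OF Metric_space_Euclidean_space])

lemma coordinate_le_L2_set: "i < (m :: nat) \<Longrightarrow> \<bar>x i - y i\<bar> \<le> L2_set (\<lambda>i. x i - y i :: real) {..<m}"
proof -
  assume "i < m"
  then have "\<bar>x i - y i\<bar> \<le> L2_set (\<lambda>i. \<bar>x i - y i\<bar>) {..<m}" by (intro member_le_L2_set) auto
  then show ?thesis by (simp add: L2_set_def)
qed

lemma mcomplete_of_Euclidean_space_metric: "mcomplete_of (Euclidean_space_metric m)"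
proof -
  define d where "d = (\<lambda>x y. L2_set (\<lambda>i. x i - y i :: real) {..<m})"
  interpret Metric_space "topspace (Euclidean_space m)" d
    unfolding d_def by (rule Metric_space_Euclidean_space)
  have "mcomplete"
    unfolding mcomplete_def
  proof (intro allI impI)
    fix \<sigma> assume \<sigma>: "MCauchy \<sigma>"
    then have \<sigma>S: "\<sigma> n \<in> topspace (Euclidean_space m)" for n by (auto simp: MCauchy_def)
    have "convergent (\<lambda>n. \<sigma> n i)" if i: "i < m" for i
    proof (rule Cauchy_convergent, rule metric_CauchyI)
      fix e :: real assume "0 < e"
      then obtain M where M: "\<And>n n'. M \<le> n \<Longrightarrow> M \<le> n' \<Longrightarrow> d (\<sigma> n) (\<sigma> n') < e" using \<sigma> unfolding MCauchy_def by blast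
      have "dist (\<sigma> n i) (\<sigma> n' i) < e" if "n \<ge> M" "n' \<ge> M" for n n'
        using coordinate_le_L2_set[OF i, of "\<sigma> n" "\<sigma> n'"] M[OF that] by (simp add: d_def dist_real_def)
      then show "\<exists>M. \<forall>n\<ge>M. \<forall>n'\<ge>M. dist (\<sigma> n i) (\<sigma> n' i) < e" by blast
    qed
    then have lim: "(\<lambda>n. \<sigma> n i) \<longlonglongrightarrow> lim (\<lambda>n. \<sigma> n i)" if "i < m" for i using that by (simp add: convergent_LIMSEQ_iff)
    define v where "v = (\<lambda>i. if i < m then lim (\<lambda>n. \<sigma> n i) else 0)"
    have v: "v \<in> topspace (Euclidean_space m)" by (simp add: v_def topspace_Euclidean_space)
    have "(\<lambda>n. \<Sum>i<m. \<bar>\<sigma> n i - v i\<bar>) \<longlonglongrightarrow> (\<Sum>i<m. \<bar>v i - v i\<bar>)"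
      using lim by (intro tendsto_sum tendsto_rabs tendsto_diff tendsto_const) (auto simp: v_def)
    then have s0: "(\<lambda>n. \<Sum>i<m. \<bar>\<sigma> n i - v i\<bar>) \<longlonglongrightarrow> 0" by simp
    have "(\<lambda>n. d (\<sigma> n) v) \<longlonglongrightarrow> 0"
    proof (rule tendsto_sandwich[of "\<lambda>_. 0" _ _ "\<lambda>n. \<Sum>i<m. \<bar>\<sigma> n i - v i\<bar>"])
      show "\<forall>\<^sub>F n in sequentially. d (\<sigma> n) v \<le> (\<Sum>i<m. \<bar>\<sigma> n i - v i\<bar>)"
        unfolding d_def using L2_set_le_sum_abs by (intro always_eventually) blast
    qed (use s0 in auto)
    then have "limitin mtopology \<sigma> v sequentially"
      unfolding limitin_metric_dist_null using v \<sigma>S by simp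
    then show "\<exists>x. limitin mtopology \<sigma> x sequentially" by blast
  qed
  then show ?thesis unfolding Euclidean_space_metric_def d_def[symmetric] by (simp add: mcomplete_of_def)
qed

text \<open>McShane's formula: the infimum of the cones of slope \<open>k\<close> erected over the
  graph of \<open>f\<close>.\<close>

lemma (in Metric_space) Lipschitz_extension:
  fixes f :: "'a \<Rightarrow> real"
  assumes A: "A \<subseteq> M" "A \<noteq> {}" and k: "0 \<le> k" and f: "\<And>u v. u \<in> A \<Longrightarrow> v \<in> A \<Longrightarrow> \<bar>f u - f v\<bar> \<le> k * d u v"
  obtains g where "\<And>u. u \<in> A \<Longrightarrow> g u = f u" "\<And>x y. x \<in> M \<Longrightarrow> y \<in> M \<Longrightarrow> \<bar>g x - g y\<bar> \<le> k * d x y"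
proof -
  define g where "g = (\<lambda>x. INF v\<in>A. f v + k * d v x)"
  obtain a where a: "a \<in> A" using A by auto
  have low: "f u - k * d u x \<le> f v + k * d v x" if "u \<in> A" "v \<in> A" "x \<in> M" for u v x
  proof -
    have "d u v \<le> d u x + d v x" using that A triangle'[of u x v] by auto
    then have "k * d u v \<le> k * (d u x + d v x)" using k by (rule mult_left_mono)
    then show ?thesis using f[OF that(1,2)] by (simp add: distrib_left)
  qed
  have bdd: "bdd_below ((\<lambda>v. f v + k * d v x) ` A)" if "x \<in> M" for x
    using low[OF a _ that] by (intro bdd_belowI[of _ "f a - k * d a x"]) auto
  have le: "g x - g y \<le> k * d x y" if xy: "x \<in> M" "y \<in> M" for x y
  proof -
    have "g x - k * d x y \<le> (INF v\<in>A. f v + k * d v y)"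
    proof (rule cINF_greatest)
      show "A \<noteq> {}" by fact
      fix v assume v: "v \<in> A"
      have "g x \<le> f v + k * d v x" unfolding g_def using bdd[OF xy(1)] v by (rule cINF_lower)
      also have "\<dots> \<le> f v + k * (d v y + d x y)"
        using triangle'[of v y x] v A xy k by (intro add_left_mono mult_left_mono) auto
      finally show "g x - k * d x y \<le> f v + k * d v y" by (simp add: distrib_left)
    qed
    then show ?thesis by (simp add: g_def)
  qed
  show thesis
  proof (rule that[of g])
    fix u assume u: "u \<in> A"
    then have uM: "u \<in> M" using A by auto
    have "g u \<le> f u + k * d u u" unfolding g_def using bdd[OF uM] u by (rule cINF_lower)
    moreover have "f u \<le> g u" unfolding g_def using A(2) low[OF u _ uM] uM by (intro cINF_greatest) auto
    ultimately show "g u = f u" using uM by simp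
  next
    fix x y assume "x \<in> M" "y \<in> M"
    then show "\<bar>g x - g y\<bar> \<le> k * d x y" using le[of x y] le[of y x] by (simp add: commute abs_le_iff)
  qed
qed

text \<open>Extending each coordinate separately costs the factor \<open>m\<close> in the Lipschitz
  constant. This is affordable because \<open>k\<close> is made small by passing to a high
  iterate.\<close>

lemma Euclidean_Lipschitz_extension:
  defines "d \<equiv> \<lambda>m x y. L2_set (\<lambda>i. x i - y i :: real) {..<m}"
  assumes L: "L \<subseteq> topspace (Euclidean_space m)" "L \<noteq> {}" and k: "0 \<le> k" "real m * k < 1"
    and g: "g \<in> L \<rightarrow>\<^sub>E topspace (Euclidean_space m)" "\<And>u v. u \<in> L \<Longrightarrow> v \<in> L \<Longrightarrow> d m (g u) (g v) \<le> k * d m u v"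
  shows "\<exists>h. contracting_map (Euclidean_space_metric m) h \<and> g = restrict h L"
proof -
  let ?E = "topspace (Euclidean_space m)"
  interpret Metric_space ?E "d m"
    unfolding d_def by (rule Metric_space_Euclidean_space)
  have "\<exists>G. (\<forall>u\<in>L. G u = g u i) \<and> (\<forall>x\<in>?E. \<forall>y\<in>?E. \<bar>G x - G y\<bar> \<le> k * d m x y)" if i: "i < m" for i
  proof -
    have "\<bar>g u i - g v i\<bar> \<le> k * d m u v" if "u \<in> L" "v \<in> L" for u v
      using coordinate_le_L2_set[OF i, of "g u" "g v"] g(2)[OF that] by (simp add: d_def)
    then obtain G where "\<And>u. u \<in> L \<Longrightarrow> G u = g u i" "\<And>x y. x \<in> ?E \<Longrightarrow> y \<in> ?E \<Longrightarrow> \<bar>G x - G y\<bar> \<le> k * d m x y"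
      using Lipschitz_extension[OF L k(1), of "\<lambda>u. g u i"] by blast
    then show ?thesis by blast
  qed
  then obtain G where G: "\<And>i u. i < m \<Longrightarrow> u \<in> L \<Longrightarrow> G i u = g u i"
    "\<And>i x y. i < m \<Longrightarrow> x \<in> ?E \<Longrightarrow> y \<in> ?E \<Longrightarrow> \<bar>G i x - G i y\<bar> \<le> k * d m x y" by metis
  define h where "h = (\<lambda>x\<in>?E. \<lambda>i. if i < m then G i x else 0)"
  have "contracting_map (Euclidean_space_metric m) h"
    unfolding contracting_map_def mspace_Euclidean_space_metric mdist_Euclidean_space_metric
  proof (intro conjI exI[of _ "real m * k"] ballI)
    show "h \<in> ?E \<rightarrow>\<^sub>E ?E" by (auto simp: h_def topspace_Euclidean_space)
    fix x y assume xy: "x \<in> ?E" "y \<in> ?E"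
    have "L2_set (\<lambda>i. h x i - h y i) {..<m} \<le> (\<Sum>i<m. \<bar>h x i - h y i\<bar>)" by (rule L2_set_le_sum_abs)
    also have "\<dots> \<le> (\<Sum>i<m. k * d m x y)" using G(2) xy by (intro sum_mono) (simp add: h_def)
    finally show "L2_set (\<lambda>i. h x i - h y i) {..<m} \<le> real m * k * L2_set (\<lambda>i. x i - y i) {..<m}" by (simp add: d_def)
  qed (use k in auto)
  moreover have "g = restrict h L"
  proof
    fix u
    show "g u = restrict h L u"
    proof (cases "u \<in> L")
      case True
      then have "g u \<in> ?E" "u \<in> ?E" using g(1) L by auto
      then show ?thesis using True G(1) by (auto simp: h_def fun_eq_iff topspace_Euclidean_space)
    next
      case False
      then show ?thesis using g(1) by (auto simp: PiE_def extensional_def)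
    qed
  qed
  ultimately show ?thesis by blast
qed

text \<open>The fractal maps are the words of one length \<open>k\<close>, transported by the
  isometry \<open>e\<close>. The length is chosen so that \<open>C * r ^ k\<close> stays below
  \<open>1 / m\<close> after the loss in extending them to the whole space.\<close>

lemma (in contracting_system) Euclidean_fractal:
  assumes e: "\<And>x. x \<in> S \<Longrightarrow> e x \<in> topspace (Euclidean_space m)"
    and de: "\<And>x y. x \<in> S \<Longrightarrow> y \<in> S \<Longrightarrow> d x y = L2_set (\<lambda>i. e x i - e y i) {..<m}"
  shows "\<exists>L G. fractal_in (Euclidean_space_metric m) L G \<and>
     mtopology homeomorphic_space subtopology (mtopology_of (Euclidean_space_metric m)) L"
proof -
  define dm where "dm = (\<lambda>x y. L2_set (\<lambda>i. x i - y i :: real) {..<m})"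
  let ?E = "topspace (Euclidean_space m)"
  interpret E: Metric_space ?E dm
    unfolding dm_def by (rule Metric_space_Euclidean_space)
  have dd: "d x y = dm (e x) (e y)" if "x \<in> S" "y \<in> S" for x y using de[OF that] by (simp add: dm_def)
  have top: "mtopology_of (Euclidean_space_metric m) = E.mtopology"
    unfolding mtopology_of_Euclidean_space_metric dm_def ..
  have inj: "inj_on e S"
  proof (rule inj_onI)
    fix x y assume xy: "x \<in> S" "y \<in> S" "e x = e y"
    then have "d x y = 0" using dd E.mdist_zero[of "e x"] e by simp
    then show "x = y" using xy by simp
  qed
  define L where "L = e ` S"
  have LE: "L \<subseteq> ?E" "L \<noteq> {}" using e ne by (auto simp: L_def)
  have cont: "continuous_map mtopology E.mtopology e"
    unfolding E.continuous_map_to_metric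
  proof (intro ballI allI impI)
    fix x \<epsilon> assume x: "x \<in> topspace mtopology" "0 < (\<epsilon>::real)"
    then show "\<exists>U. openin mtopology U \<and> x \<in> U \<and> (\<forall>y\<in>U. e y \<in> E.mball (e x) \<epsilon>)"
      using e dd by (intro exI[of _ "mball x \<epsilon>"]) auto
  qed
  have "compactin E.mtopology L"
    unfolding L_def using compact cont by (intro image_compactin[of mtopology]) (auto simp: compact_space_def)
  have "homeomorphic_map mtopology (subtopology E.mtopology L) e"
  proof (rule continuous_imp_homeomorphic_map)
    show "continuous_map mtopology (subtopology E.mtopology L) e"
      using cont by (auto simp: continuous_map_in_subtopology L_def)
    show "Hausdorff_space (subtopology E.mtopology L)" by (intro Hausdorff_space_subtopology E.Hausdorff_space_mtopology)
    show "e ` topspace mtopology = topspace (subtopology E.mtopology L)" using LE by (auto simp: L_def)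
  qed (use compact inj in auto)
  then have homeo: "mtopology homeomorphic_space subtopology E.mtopology L" by (rule homeomorphic_map_imp_homeomorphic_space)
  have "0 < 1 / (C * (real m + 1))" using C by simp
  then obtain k where k: "r ^ k < 1 / (C * (real m + 1))" using real_arch_pow_inv[of "1 / (C * (real m + 1))" r] r by auto
  define \<kappa> where "\<kappa> = C * r ^ k"
  have \<kappa>: "0 \<le> \<kappa>" "real m * \<kappa> < 1"
  proof -
    show "0 \<le> \<kappa>" using C r by (simp add: \<kappa>_def)
    have "r ^ k * (C * (real m + 1)) < 1" using k C by (simp add: pos_less_divide_eq)
    then have "\<kappa> * (real m + 1) < 1" by (simp add: \<kappa>_def mult_ac)
    then show "real m * \<kappa> < 1" using \<open>0 \<le> \<kappa>\<close> by (simp add: algebra_simps)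
  qed
  define T where "T = (\<lambda>h. \<lambda>v\<in>L. e (h (inv_into S e v)))"
  have Te: "T h (e x) = e (h x)" if "x \<in> S" for h x using that inj by (simp add: T_def L_def)
  have TL: "T h \<in> L \<rightarrow>\<^sub>E L" if "h \<in> iterates S F k" for h
    using iterates_in[OF that] inj by (auto simp: T_def L_def)
  have ext: "\<exists>h'. contracting_map (Euclidean_space_metric m) h' \<and> T h = restrict h' L" if h: "h \<in> iterates S F k" for h
  proof (rule Euclidean_Lipschitz_extension[OF LE \<kappa>])
    show "T h \<in> L \<rightarrow>\<^sub>E ?E" using TL[OF h] LE(1) by auto
    fix u v assume "u \<in> L" "v \<in> L"
    then obtain x y where xy: "x \<in> S" "y \<in> S" "u = e x" "v = e y" by (auto simp: L_def)
    then have "dm (T h u) (T h v) \<le> \<kappa> * dm u v"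
      using Lipschitz[OF h xy(1,2)] dd iterates_in[OF h] by (simp add: Te \<kappa>_def)
    then show "L2_set (\<lambda>i. T h u i - T h v i) {..<m} \<le> \<kappa> * L2_set (\<lambda>i. u i - v i) {..<m}" by (simp add: dm_def)
  qed
  have "fractal_in (Euclidean_space_metric m) L (T ` iterates S F k)"
    unfolding fractal_in_def
  proof (intro conjI ballI)
    show "mcomplete_of (Euclidean_space_metric m)" by (rule mcomplete_of_Euclidean_space_metric)
    show "L \<noteq> {}" by fact
    show "compactin (mtopology_of (Euclidean_space_metric m)) L" unfolding top by fact
    show "finite (T ` iterates S F k)" using finite_iterates[OF F(2)] by simp
    show "T ` iterates S F k \<subseteq> L \<rightarrow>\<^sub>E L" using TL by auto
    show "\<exists>h. contracting_map (Euclidean_space_metric m) h \<and> g = restrict h L" if "g \<in> T ` iterates S F k" for g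
      using ext that by auto
    have "(\<Union>g\<in>T ` iterates S F k. g ` L) = (\<Union>h\<in>iterates S F k. e ` h ` S)"
      using Te by (force simp: L_def image_image)
    also have "\<dots> = e ` (\<Union>h\<in>iterates S F k. h ` S)" by (simp add: image_UN)
    also have "\<dots> = L" unfolding iterates_cover[OF cover] L_def ..
    finally show "L = (\<Union>g\<in>T ` iterates S F k. g ` L)" by simp
  qed
  then show ?thesis using homeo top by auto
qed

section \<open>Both structures from the four maps\<close>

context fractal_model
begin

lemma Metric_space_dE: "Metric_space S dE"
proof
  fix x y z
  show "0 \<le> dE x y" by (rule dE_nonneg)
  show "dE x y = dE y x" by (simp add: dE_def L2_set_def power2_commute)
  show "dE x z \<le> dE x y + dE y z"
    using L2_set_triangle_ineq [of "\<lambda>i. emb x i - emb y i" "\<lambda>i. emb y i - emb z i"] by (simp add: dE_def)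
  assume "x \<in> S" "y \<in> S"
  then show "dE x y = 0 \<longleftrightarrow> x = y" using dE_eq_0 by (auto simp: dE_def L2_set_def)
qed

lemma dE_topology: "X = Metric_space.mtopology S dE"
proof -
  interpret Metric_space S dE by (rule Metric_space_dE)
  show ?thesis
  proof (rule compact_Hausdorff_topology_eq[OF cpt Hausdorff_space_mtopology])
    fix U assume U: "openin mtopology U"
    show "openin X U"
    proof (subst openin_subopen, intro ballI)
      fix x assume x: "x \<in> U"
      then obtain e where e: "0 < e" "mball x e \<subseteq> U" using U by (auto simp: openin_mtopology)
      have xX: "x \<in> S" using U x by (auto simp: openin_mtopology)
      have "continuous_map X euclideanreal (\<lambda>y. \<Sum>i<3 * N. \<bar>emb x i - emb y i\<bar>)"
        using emb_cont by (intro continuous_intros) auto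
      from openin_continuous_map_preimage[OF this, of "{..<e}"]
      have op: "openin X {y \<in> S. (\<Sum>i<3 * N. \<bar>emb x i - emb y i\<bar>) < e}" by simp
      have "{y \<in> S. (\<Sum>i<3 * N. \<bar>emb x i - emb y i\<bar>) < e} \<subseteq> mball x e"
      proof
        fix y assume y: "y \<in> {y \<in> S. (\<Sum>i<3 * N. \<bar>emb x i - emb y i\<bar>) < e}"
        have "dE x y \<le> (\<Sum>i<3 * N. \<bar>emb x i - emb y i\<bar>)" unfolding dE_def by (rule L2_set_le_sum_abs)
        then show "y \<in> mball x e" using y xX by simp
      qed
      then show "\<exists>T. openin X T \<and> x \<in> T \<and> T \<subseteq> U" using op e xX by (intro exI[of _ "{y \<in> S. (\<Sum>i<3 * N. \<bar>emb x i - emb y i\<bar>) < e}"]) auto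
    qed
  qed simp
qed

theorem fractal_structures:
  shows "\<exists>m L G. fractal_in (Euclidean_space_metric m) L G \<and>
      X homeomorphic_space subtopology (mtopology_of (Euclidean_space_metric m)) L"
    and "\<exists>F. topological_fractal_structure X F \<and> card F = 4 \<and>
      (\<exists>r::real. 0 < r \<and> r < 1 \<and> Metric_space S (Kameyama_pseudometric S F r) \<and> doubling S (Kameyama_pseudometric S F r))"
proof -
  obtain C where C: "1 \<le> C" "\<forall>k. \<forall>h\<in>iterates S F k. \<forall>x\<in>S. \<forall>y\<in>S. dE (h x) (h y) \<le> C * l ^ k * dE x y"
    using iterates_Lipschitz by blast
  interpret M: Metric_space S dE by (rule Metric_space_dE)
  interpret contracting_system S dE F l C
  proof
    show "compact_space M.mtopology" using cpt dE_topology by simp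
    show "F \<subseteq> S \<rightarrow>\<^sub>E S" by (rule F_funcset)
    show "finite F" by (rule card_F)
    show "S = (\<Union>f\<in>F. f ` S)" by (rule F_cover)
    show "S \<noteq> {}" using Y_ne by auto
  qed (use l C in auto)
  have "emb x \<in> topspace (Euclidean_space (3 * N))" for x
    by (auto simp: topspace_Euclidean_space emb_def)
  then obtain L G where "fractal_in (Euclidean_space_metric (3 * N)) L G"
    "M.mtopology homeomorphic_space subtopology (mtopology_of (Euclidean_space_metric (3 * N))) L"
    using Euclidean_fractal[of emb "3 * N"] by (auto simp: dE_def)
  then show "\<exists>m L G. fractal_in (Euclidean_space_metric m) L G \<and>
      X homeomorphic_space subtopology (mtopology_of (Euclidean_space_metric m)) L"
    using dE_topology by auto
  have "doubling S (Kameyama_pseudometric S F l)"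
  proof (rule doubling_Kameyama)
    show "\<exists>\<G>. \<G> \<subseteq> iterates S F n \<and> finite \<G> \<and> card \<G> \<le> 7 ^ N + 1 \<and> T \<subseteq> (\<Union>h\<in>\<G>. h ` S)"
      if "T \<subseteq> S" "\<And>x y. x \<in> T \<Longrightarrow> y \<in> T \<Longrightarrow> dE x y \<le> 1/4 * l ^ n" for n T
      using that by (rule dE_count)
  qed simp
  moreover have "topological_fractal_structure X F" using topological_fractal_structure dE_topology by simp
  ultimately show "\<exists>F. topological_fractal_structure X F \<and> card F = 4 \<and>
      (\<exists>r::real. 0 < r \<and> r < 1 \<and> Metric_space S (Kameyama_pseudometric S F r) \<and> doubling S (Kameyama_pseudometric S F r))"
    using card_F(1) l Metric_space_Kameyama by blast
qed

end

lemma finite_dimensional_imp_fractal_structures: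
  fixes X :: "'a topology"
  assumes X: "compact_space X" "metrizable_space X" and Z: "openin X Z" "uncountable Z" "zero_dimensional (subtopology X Z)"
    and dim: "finite_dimensional X"
  shows "\<exists>m L G. fractal_in (Euclidean_space_metric m) L G \<and>
      X homeomorphic_space subtopology (mtopology_of (Euclidean_space_metric m)) L"
    and "\<exists>F. topological_fractal_structure X F \<and> card F = 4 \<and>
      (\<exists>r::real. 0 < r \<and> r < 1 \<and> Metric_space (topspace X) (Kameyama_pseudometric (topspace X) F r) \<and>
         doubling (topspace X) (Kameyama_pseudometric (topspace X) F r))"
proof -
  obtain N and h :: "nat \<Rightarrow> 'a \<Rightarrow> real" where N: "0 < N" and h: "\<And>c. c < N \<Longrightarrow> continuous_map X euclideanreal (h c)"
     "\<And>x y. x \<in> topspace X \<Longrightarrow> y \<in> topspace X \<Longrightarrow> (\<And>c. c < N \<Longrightarrow> h c x = h c y) \<Longrightarrow> x = y"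
    using finite_dimensional_injection[OF X dim] by blast
  have "\<exists>b>0. \<forall>x\<in>topspace X. \<bar>h c x\<bar> \<le> b" if c: "c < N" for c
  proof -
    have "compact (h c ` topspace X)"
      using image_compactin[OF _ h(1)[OF c], of "topspace X"] X(1) by (simp add: compact_space_def)
    then have "bounded (h c ` topspace X)" by (rule compact_imp_bounded)
    then show ?thesis by (auto simp: bounded_pos)
  qed
  then obtain b where b: "\<And>c. c < N \<Longrightarrow> 0 < b c" "\<And>c x. c < N \<Longrightarrow> x \<in> topspace X \<Longrightarrow> \<bar>h c x\<bar> \<le> b c" by metis
  \<comment> \<open>Rescales the range from \<open>[- b c, b c]\<close> to the unit interval, where
    the dyadic values lie.\<close>
  define \<eta> where "\<eta> = (\<lambda>c x. (h c x + b c) / (2 * b c))"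
  have \<eta>1: "continuous_map X euclideanreal (\<eta> c)" if "c < N" for c
    unfolding \<eta>_def using h(1)[OF that] b(1)[OF that] by (intro continuous_intros) auto
  have \<eta>2: "x = y" if "x \<in> topspace X" "y \<in> topspace X" "\<And>c. c < N \<Longrightarrow> \<eta> c x = \<eta> c y" for x y
  proof (rule h(2)[OF that(1,2)])
    fix c assume c: "c < N"
    then show "h c x = h c y" using that(3)[OF c] b(1)[OF c] by (simp add: \<eta>_def)
  qed
  have \<eta>3: "0 \<le> \<eta> c x \<and> \<eta> c x \<le> 1" if "x \<in> topspace X" "c < N" for c x
    using b(1)[OF that(2)] b(2)[OF that(2,1)] by (auto simp: \<eta>_def abs_le_iff field_simps)
  define l where "l = root N (1/2)"
  have l: "0 < l" "l < 1" "l ^ N = 1/2" using N by (simp_all add: l_def)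
  have Z0: "subtopology X Z dim_le 0" using Z(3) by (simp add: zero_dimensional_def)
  obtain K and \<kappa> :: "'a \<Rightarrow> nat \<Rightarrow> nat" where "fractal_model X K \<kappa> N \<eta> l"
  proof (rule coding_exists[OF X Z(1,2) Z0])
    fix K and \<kappa> :: "'a \<Rightarrow> nat \<Rightarrow> nat"
    assume * : "openin X K" "closedin X K" "topspace X - K \<noteq> {}"
      "\<And>x n. x \<in> K \<Longrightarrow> \<exists>U. openin X U \<and> x \<in> U \<and> U \<subseteq> K \<and> (\<forall>y\<in>U. \<forall>k<n. \<kappa> y k = \<kappa> x k)"
      "inj_on \<kappa> K" "\<And>x n. \<kappa> x n \<le> 2"
      "\<And>c. (\<And>n. c n < 2) \<Longrightarrow> c \<in> \<kappa> ` K"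
      "\<And>c. c \<in> \<kappa> ` K \<Longrightarrow> c 0 < 2 \<Longrightarrow> (\<lambda>n. c (Suc n)) \<in> \<kappa> ` K"
      "\<And>c. c \<in> \<kappa> ` K \<Longrightarrow> c 0 < 2 \<Longrightarrow> thin (\<lambda>n. c (Suc n)) = (\<lambda>n. c (Suc n))"
      "\<And>c n. c \<in> \<kappa> ` K \<Longrightarrow> c 0 = 2 \<Longrightarrow> c 1 = 0"
      "\<And>c n. c \<in> \<kappa> ` K \<Longrightarrow> c 0 = 2 \<Longrightarrow> c (n + 2) < 2"
      "\<And>c. (\<And>n. \<exists>x\<in>K. \<forall>k<n. \<kappa> x k = c k) \<Longrightarrow> c \<in> \<kappa> ` K"
      "(\<lambda>n. if n = 0 then 2 else 0) \<in> \<kappa> ` K"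
    have "fractal_model X K \<kappa> N \<eta> l"
      by (unfold_locales; fact X(1) * N \<eta>1 \<eta>2 \<eta>3 l)
    then show thesis by (rule that)
  qed
  then interpret fractal_model X K \<kappa> N \<eta> l .
  show "\<exists>m L G. fractal_in (Euclidean_space_metric m) L G \<and>
      X homeomorphic_space subtopology (mtopology_of (Euclidean_space_metric m)) L"
    and "\<exists>F. topological_fractal_structure X F \<and> card F = 4 \<and>
      (\<exists>r::real. 0 < r \<and> r < 1 \<and> Metric_space (topspace X) (Kameyama_pseudometric (topspace X) F r) \<and>
         doubling (topspace X) (Kameyama_pseudometric (topspace X) F r))"
    by (fact fractal_structures)+
qed

theorem theorem8p1:
  fixes X :: "'a topology" and Z :: "'a set"
  assumes "compact_space X" and "metrizable_space X"
    and "openin X Z" and "uncountable Z" and "zero_dimensional (subtopology X Z)"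
  shows "(finite_dimensional X \<longleftrightarrow>
            (\<exists>n L G. fractal_in (Euclidean_space_metric n) L G \<and>
               X homeomorphic_space subtopology (mtopology_of (Euclidean_space_metric n)) L)) \<and>
         (finite_dimensional X \<longleftrightarrow>
            (\<exists>F. topological_fractal_structure X F \<and> card F = 4 \<and>
               (\<exists>r::real. 0 < r \<and> r < 1 \<and>
                  Metric_space (topspace X) (Kameyama_pseudometric (topspace X) F r) \<and>
                  doubling (topspace X) (Kameyama_pseudometric (topspace X) F r))))"
proof (intro conjI iffI)
  assume "finite_dimensional X"
  from finite_dimensional_imp_fractal_structures[OF assms this]
  show "\<exists>n L G. fractal_in (Euclidean_space_metric n) L G \<and>
               X homeomorphic_space subtopology (mtopology_of (Euclidean_space_metric n)) L"
    and "\<exists>F. topological_fractal_structure X F \<and> card F = 4 \<and>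
               (\<exists>r::real. 0 < r \<and> r < 1 \<and>
                  Metric_space (topspace X) (Kameyama_pseudometric (topspace X) F r) \<and>
                  doubling (topspace X) (Kameyama_pseudometric (topspace X) F r))" by auto
next
  assume "\<exists>n L G. fractal_in (Euclidean_space_metric n) L G \<and>
               X homeomorphic_space subtopology (mtopology_of (Euclidean_space_metric n)) L"
  then obtain n L G where L: "fractal_in (Euclidean_space_metric n) L G"
    "X homeomorphic_space subtopology (mtopology_of (Euclidean_space_metric n)) L" by (elim exE conjE)
  then have "finite_dimensional (subtopology (mtopology_of (Euclidean_space_metric n)) L)"
    by (intro finite_dimensional_compactin_Euclidean) (simp add: fractal_in_def)
  then show "finite_dimensional X"
    using homeomorphic_space_dimension_le[OF L(2)] by (simp add: finite_dimensional_def)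
next
  assume "\<exists>F. topological_fractal_structure X F \<and> card F = 4 \<and>
               (\<exists>r::real. 0 < r \<and> r < 1 \<and>
                  Metric_space (topspace X) (Kameyama_pseudometric (topspace X) F r) \<and>
                  doubling (topspace X) (Kameyama_pseudometric (topspace X) F r))"
  then show "finite_dimensional X"
    by (elim exE conjE) (rule doubling_Kameyama_imp_finite_dimensional)
qed

end
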